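(* Let $\Omega,k,D,\rho$ be as specified in the context, let $n(x)=1+\chi_D(x)\rho(x)$, and let $u\in H^2(\Omega)$ be a strong solution of $\Delta u+k^2n(x)u=0$ in $\Omega$. Let $\omega\in S^1$ be regular with respect to $D$ and let $p=p(\omega)$ be the only point of the set $\{x\in\mathbb R^2: x\cdot\omega=h_D(\omega)\}\cap\partial D$. Assume that $u(p)\neq0$. Then one can calculate $h_D(\omega)$ from the Cauchy data $(u|_{\partial\Omega},\,\partial u/\partial\nu|_{\partial\Omega})$ of $u$ on $\partial\Omega$.
   Context: $\Omega\subset\mathbb R^2$ is a bounded domain with $C^2$ boundary and unit outward normal $\nu$ to $\partial\Omega$; $k>0$ is fixed and known. $D$ is an open subset of $\Omega$ which is a polygon and satisfies $\overline D\subset\Omega$; $\rho\in L^\infty(D)$; and for each vertex $q$ on $\partial D$ there exist an open disk $B(q,\eta)$ centred at $q$ with radius $\eta>0$, a number $0<\alpha\le1$ and a function $\tilde\rho\in C^{0,\alpha}(\overline{B(q,\eta)})$ such that $\rho=\tilde\rho$ on $B(q,\eta)\cap\overline D$ and $\tilde\rho(q)\ne0$. $\chi_D$ is the characteristic function of $D$. The pair $(D,\rho)$ is unknown; the Cauchy data of $u$ on $\partial\Omega$ are known. By the Sobolev imbedding theorem one may assume that $u\in C^{0,\beta}(\overline\Omega)$ for any $\beta\in(0,1)$, so the value $u(p)$ of $u$ at $p$ makes sense. Support function of $D$: $h_D(\omega)=\sup_{x\in D}x\cdot\omega$ for $\omega\in S^1$, where $S^1$ is the set of unit vectors in $\mathbb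 R^2$. A direction $\omega\in S^1$ is called regular with respect to $D$ if and only if the set $\{x\in\mathbb R^2: x\cdot\omega=h_D(\omega)\}\cap\partial D$ consists of only one point. *)

theory Defs
  imports "HOL-Analysis.Analysis"
begin

section \<open>Differentiability classes\<close>

text \<open>
  \<open>C_k n f\<close>: all partial derivatives of \<open>f\<close> of order at most \<open>n\<close> exist and are continuous
  on the whole space.
\<close>

primrec C_k :: "nat \<Rightarrow> ('a::euclidean_space \<Rightarrow> 'b::real_normed_vector) \<Rightarrow> bool" where
  "C_k 0 f \<longleftrightarrow> continuous_on UNIV f"
| "C_k (Suc n) f \<longleftrightarrow> (\<forall>x. f differentiable (at x)) \<and>
     (\<forall>b\<in>Basis. C_k n (\<lambda>x. frechet_derivative f (at x) b))"

definition C_inf :: "('a::euclidean_space \<Rightarrow> 'b::real_normed_vector) \<Rightarrow> bool" where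
  "C_inf f \<longleftrightarrow> (\<forall>n. C_k n f)"

definition partial :: "2 \<Rightarrow> (real^2 \<Rightarrow> 'b::real_normed_vector) \<Rightarrow> real^2 \<Rightarrow> 'b" where
  "partial i f x = frechet_derivative f (at x) (axis i 1)"

definition test_function :: "(real^2) set \<Rightarrow> (real^2 \<Rightarrow> real) \<Rightarrow> bool" where
  "test_function \<Omega> \<phi> \<longleftrightarrow> C_inf \<phi> \<and>
     compact (closure {x. \<phi> x \<noteq> 0}) \<and> closure {x. \<phi> x \<noteq> 0} \<subseteq> \<Omega>"

definition Holder_on :: "(real^2) set \<Rightarrow> real \<Rightarrow> (real^2 \<Rightarrow> complex) \<Rightarrow> bool" where
  "Holder_on S \<alpha> f \<longleftrightarrow> (\<exists>C. \<forall>x\<in>S. \<forall>y\<in>S. cmod (f x - f y) \<le> C * dist x y powr \<alpha>)"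


section \<open>Domains with \<open>C\<^sup>2\<close> boundary\<close>

text \<open>
  Near each boundary point, and in suitable orthonormal coordinates \<open>(y \<bullet> e1, y \<bullet> e2)\<close>,
  the domain is the region below the graph of a \<open>C\<^sup>2\<close> function.
\<close>

definition C2_domain :: "(real^2) set \<Rightarrow> bool" where
  "C2_domain \<Omega> \<longleftrightarrow> open \<Omega> \<and> connected \<Omega> \<and> \<Omega> \<noteq> {} \<and> bounded \<Omega> \<and>
     (\<forall>x\<in>frontier \<Omega>. \<exists>r>0. \<exists>e1 e2. \<exists>\<gamma>::real \<Rightarrow> real.
        norm e1 = 1 \<and> norm e2 = 1 \<and> e1 \<bullet> e2 = 0 \<and> C_k 2 \<gamma> \<and>
        \<Omega> \<inter> ball x r = {y \<in> ball x r. y \<bullet> e2 < \<gamma> (y \<bullet> e1)})"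

text \<open>
  \<open>n\<close> is the outward unit normal at the boundary point \<open>x\<close>: to first order at \<open>x\<close> the set
  \<open>\<Omega>\<close> is the half-plane \<open>{y. (y - x) \<bullet> n < 0}\<close>, i.e. for every aperture \<open>\<epsilon>\<close> the cone
  about \<open>n\<close> is outside \<open>\<Omega>\<close> near \<open>x\<close> and the opposite cone is inside. For a domain with
  \<open>C\<^sup>2\<close> boundary this determines \<open>n\<close>.
\<close>

definition outward_unit_normal :: "(real^2) set \<Rightarrow> real^2 \<Rightarrow> real^2 \<Rightarrow> bool" where
  "outward_unit_normal \<Omega> x n \<longleftrightarrow> norm n = 1 \<and>
     (\<forall>\<epsilon>>0. \<forall>\<^sub>F y in at x.
        ((y - x) \<bullet> n > \<epsilon> * norm (y - x) \<longrightarrow> y \<notin> \<Omega>) \<and>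
        ((y - x) \<bullet> n < - \<epsilon> * norm (y - x) \<longrightarrow> y \<in> \<Omega>))"


section \<open>Arc length measure on the boundary\<close>

text \<open>One-dimensional Hausdorff measure; on rectifiable curves it is arc length.\<close>

definition hausdorff1_outer :: "(real^2) set \<Rightarrow> ennreal" where
  "hausdorff1_outer A =
     (SUP \<delta>\<in>{0::real<..}.
        INF C\<in>{C. A \<subseteq> (\<Union>i. C i) \<and> (\<forall>i. bounded (C i) \<and> diameter (C i) \<le> \<delta>)}.
          \<Sum>i. ennreal (diameter (C i)))"

definition hausdorff1 :: "(real^2) measure" where
  "hausdorff1 = measure_of UNIV (sets borel) hausdorff1_outer"

definition boundary_measure :: "(real^2) set \<Rightarrow> (real^2) measure" where
  "boundary_measure \<Omega> = restrict_space hausdorff1 (frontier \<Omega>)"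


section \<open>Sobolev spaces, traces and strong solutions\<close>

definition in_L2 :: "(real^2) measure \<Rightarrow> (real^2 \<Rightarrow> complex) \<Rightarrow> bool" where
  "in_L2 M f \<longleftrightarrow> f \<in> borel_measurable M \<and> integrable M (\<lambda>x. (cmod (f x))\<^sup>2)"

definition converges_L2 ::
  "(real^2) measure \<Rightarrow> (nat \<Rightarrow> real^2 \<Rightarrow> complex) \<Rightarrow> (real^2 \<Rightarrow> complex) \<Rightarrow> bool" where
  "converges_L2 M F f \<longleftrightarrow>
     (\<lambda>m. \<integral>\<^sup>+x. ennreal ((cmod (F m x - f x))\<^sup>2) \<partial>M) \<longlonglongrightarrow> 0"

definition in_Linf :: "(real^2) set \<Rightarrow> (real^2 \<Rightarrow> complex) \<Rightarrow> bool" where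
  "in_Linf D f \<longleftrightarrow> f \<in> borel_measurable (lebesgue_on D) \<and>
     (\<exists>C. AE x in lebesgue_on D. cmod (f x) \<le> C)"

definition locally_integrable :: "(real^2) set \<Rightarrow> (real^2 \<Rightarrow> complex) \<Rightarrow> bool" where
  "locally_integrable \<Omega> f \<longleftrightarrow> (\<forall>K. compact K \<and> K \<subseteq> \<Omega> \<longrightarrow> integrable (lebesgue_on K) f)"

definition weak_partial ::
  "(real^2) set \<Rightarrow> 2 \<Rightarrow> (real^2 \<Rightarrow> complex) \<Rightarrow> (real^2 \<Rightarrow> complex) \<Rightarrow> bool" where
  "weak_partial \<Omega> i u w \<longleftrightarrow> locally_integrable \<Omega> u \<and> locally_integrable \<Omega> w \<and>
     (\<forall>\<phi>. test_function \<Omega> \<phi> \<longrightarrow>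
        (LINT x|lebesgue_on \<Omega>. partial i \<phi> x *\<^sub>R u x) = - (LINT x|lebesgue_on \<Omega>. \<phi> x *\<^sub>R w x))"

definition in_H2 :: "(real^2) set \<Rightarrow> (real^2 \<Rightarrow> complex) \<Rightarrow> bool" where
  "in_H2 \<Omega> u \<longleftrightarrow> in_L2 (lebesgue_on \<Omega>) u \<and>
     (\<exists>U V. (\<forall>i. weak_partial \<Omega> i u (U i) \<and> in_L2 (lebesgue_on \<Omega>) (U i)) \<and>
            (\<forall>i j. weak_partial \<Omega> j (U i) (V i j) \<and> in_L2 (lebesgue_on \<Omega>) (V i j)))"

definition weak_laplacian :: "(real^2) set \<Rightarrow> (real^2 \<Rightarrow> complex) \<Rightarrow> (real^2 \<Rightarrow> complex) \<Rightarrow> bool" where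
  "weak_laplacian \<Omega> u L \<longleftrightarrow>
     (\<exists>U V. (\<forall>i. weak_partial \<Omega> i u (U i) \<and> weak_partial \<Omega> i (U i) (V i)) \<and>
            (\<forall>x. L x = (\<Sum>i\<in>UNIV. V i x)))"

definition strong_solution ::
  "(real^2) set \<Rightarrow> real \<Rightarrow> (real^2 \<Rightarrow> complex) \<Rightarrow> (real^2 \<Rightarrow> complex) \<Rightarrow> bool" where
  "strong_solution \<Omega> k n u \<longleftrightarrow> in_H2 \<Omega> u \<and>
     (\<exists>L. weak_laplacian \<Omega> u L \<and>
          (AE x in lebesgue_on \<Omega>. L x + of_real (k\<^sup>2) * n x * u x = 0))"

text \<open>
  \<open>T\<close> is the boundary trace of \<open>w \<in> H\<^sup>1(\<Omega>)\<close>: the \<open>L\<^sup>2(\<partial>\<Omega>)\<close>-limit of the boundary values of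
  functions smooth up to the boundary that converge to \<open>w\<close> in \<open>H\<^sup>1(\<Omega>)\<close>.
\<close>

definition boundary_trace :: "(real^2) set \<Rightarrow> (real^2 \<Rightarrow> complex) \<Rightarrow> (real^2 \<Rightarrow> complex) \<Rightarrow> bool" where
  "boundary_trace \<Omega> w T \<longleftrightarrow> in_L2 (lebesgue_on \<Omega>) w \<and> in_L2 (boundary_measure \<Omega>) T \<and>
     (\<exists>W F. (\<forall>i. weak_partial \<Omega> i w (W i) \<and> in_L2 (lebesgue_on \<Omega>) (W i)) \<and>
            (\<forall>m. C_inf (F m)) \<and>
            converges_L2 (lebesgue_on \<Omega>) F w \<and>
            (\<forall>i. converges_L2 (lebesgue_on \<Omega>) (\<lambda>m. partial i (F m)) (W i)) \<and>
            converges_L2 (boundary_measure \<Omega>) F T)"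

text \<open>\<open>\<partial>u/\<partial>\<nu> = \<nu> \<bullet> \<nabla>u\<close> on \<open>\<partial>\<Omega>\<close>, with the traces of the weak first derivatives of \<open>u\<close>.\<close>

definition normal_derivative ::
  "(real^2) set \<Rightarrow> (real^2 \<Rightarrow> real^2) \<Rightarrow> (real^2 \<Rightarrow> complex) \<Rightarrow> (real^2 \<Rightarrow> complex) \<Rightarrow> bool" where
  "normal_derivative \<Omega> \<nu> u g \<longleftrightarrow> in_L2 (boundary_measure \<Omega>) g \<and>
     (\<exists>U G. (\<forall>i. weak_partial \<Omega> i u (U i) \<and> boundary_trace \<Omega> (U i) (G i)) \<and>
            (AE x in boundary_measure \<Omega>. g x = (\<Sum>i\<in>UNIV. of_real (\<nu> x $ i) * G i x)))"


section \<open>Polygons, vertices and the support function\<close>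

fun polyline :: "(real^2) list \<Rightarrow> real \<Rightarrow> real^2" where
  "polyline [] = linepath 0 0"
| "polyline [a] = linepath a a"
| "polyline [a, b] = linepath a b"
| "polyline (a # b # c # vs) = linepath a b +++ polyline (b # c # vs)"

text \<open>
  \<open>D\<close> is the region enclosed by the simple closed polygonal curve through the points of \<open>vs\<close>.
  Non-collinearity of consecutive points makes \<open>set vs\<close> exactly the set of vertices of \<open>D\<close>.
\<close>

definition polygon_with_vertices :: "(real^2) set \<Rightarrow> (real^2) list \<Rightarrow> bool" where
  "polygon_with_vertices D vs \<longleftrightarrow> length vs \<ge> 3 \<and>
     (\<forall>i<length vs. \<not> collinear {vs ! i, vs ! (Suc i mod length vs), vs ! (Suc (Suc i) mod length vs)}) \<and>
     simple_path (polyline (vs @ [hd vs])) \<and>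
     D = inside (path_image (polyline (vs @ [hd vs])))"

text \<open>
  The condition on \<open>\<rho>\<close> at a vertex \<open>q\<close>. As \<open>\<rho>\<close> is an element of \<open>L\<^sup>\<infinity>(D)\<close>, its equality with
  \<open>\<rho>'\<close> is almost everywhere.
\<close>

definition Holder_nonzero_at :: "(real^2) set \<Rightarrow> (real^2 \<Rightarrow> complex) \<Rightarrow> real^2 \<Rightarrow> bool" where
  "Holder_nonzero_at D \<rho> q \<longleftrightarrow>
     (\<exists>\<eta>>0. \<exists>\<alpha>>0. \<exists>\<rho>'. \<alpha> \<le> 1 \<and> Holder_on (cball q \<eta>) \<alpha> \<rho>' \<and>
        (AE x in lebesgue_on (ball q \<eta> \<inter> closure D). \<rho> x = \<rho>' x) \<and> \<rho>' q \<noteq> 0)"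

definition support_function :: "(real^2) set \<Rightarrow> real^2 \<Rightarrow> real" where
  "support_function D \<omega> = (SUP x\<in>D. x \<bullet> \<omega>)"

definition support_line :: "(real^2) set \<Rightarrow> real^2 \<Rightarrow> (real^2) set" where
  "support_line D \<omega> = {x. x \<bullet> \<omega> = support_function D \<omega>}"

definition regular_direction :: "(real^2) set \<Rightarrow> real^2 \<Rightarrow> bool" where
  "regular_direction D \<omega> \<longleftrightarrow> norm \<omega> = 1 \<and> (\<exists>!x. x \<in> support_line D \<omega> \<inter> frontier D)"


section \<open>The indicator function computed from the Cauchy data\<close>

definition perp :: "real^2 \<Rightarrow> real^2" where
  "perp \<omega> = vector [- (\<omega> $ 2), \<omega> $ 1]"

text \<open>
  The complex exponential \<open>v(x) = exp (x \<bullet> (\<tau> \<omega> + \<i> \<surd>(\<tau>\<^sup>2 + k\<^sup>2) \<omega>\<^sup>\<bottom>))\<close>,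
  a solution of \<open>\<Delta>v + k\<^sup>2 v = 0\<close>.
\<close>

definition exp_solution :: "real \<Rightarrow> real^2 \<Rightarrow> real \<Rightarrow> real^2 \<Rightarrow> complex" where
  "exp_solution k \<omega> \<tau> x = exp (Complex (\<tau> * (x \<bullet> \<omega>)) (sqrt (\<tau>\<^sup>2 + k\<^sup>2) * (x \<bullet> perp \<omega>)))"

text \<open>
  \<open>I(\<tau>) = \<integral>\<^bsub>\<partial>\<Omega>\<^esub> (\<partial>u/\<partial>\<nu> v - \<partial>v/\<partial>\<nu> u) d\<sigma>\<close> as a functional of the Cauchy data
  \<open>f = u|\<partial>\<Omega>\<close> and \<open>g = \<partial>u/\<partial>\<nu>|\<partial>\<Omega>\<close>; besides \<open>(f, g)\<close> it involves only \<open>\<Omega>\<close>, \<open>k\<close> and \<open>\<omega>\<close>.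
\<close>

definition enclosure_indicator ::
  "(real^2) set \<Rightarrow> (real^2 \<Rightarrow> real^2) \<Rightarrow> real \<Rightarrow> real^2 \<Rightarrow>
   (real^2 \<Rightarrow> complex) \<Rightarrow> (real^2 \<Rightarrow> complex) \<Rightarrow> real \<Rightarrow> complex" where
  "enclosure_indicator \<Omega> \<nu> k \<omega> f g \<tau> =
     (LINT x|boundary_measure \<Omega>.
        g x * exp_solution k \<omega> \<tau> x
        - frechet_derivative (exp_solution k \<omega> \<tau>) (at x) (\<nu> x) * f x)"

end

theory Submission
  imports Defs "HOL-Real_Asymp.Real_Asymp"
begin

text \<open>
  By Green's formula the indicator function equals \<open>- k\<^sup>2 \<integral>\<^sub>D \<rho> u v\<close>, where \<open>v\<close> is the complex
  exponential solution of the Helmholtz equation. Since \<open>|v x| = exp (\<tau> (x \<bullet> \<omega>))\<close>, only a neighbourhood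
  of the support point \<open>p\<close> matters as \<open>\<tau> \<rightarrow> \<infinity>\<close>. Regularity of \<open>\<omega>\<close> forces \<open>p\<close> to be a convex vertex, near
  which \<open>D\<close> is a sector spanned by vectors \<open>A\<close>, \<open>B\<close> with \<open>A \<bullet> \<omega> < 0\<close> and \<open>B \<bullet> \<omega> < 0\<close>. Rescaling the sector by
  \<open>\<tau>\<close> shows that the indicator function is asymptotic to \<open>C \<tau>\<^sup>-\<^sup>2 v p\<close> with
  \<open>C = - k\<^sup>2 \<rho>(p) u(p) |det (A, B)| / (\<alpha> \<beta>)\<close>, where \<open>\<alpha>\<close>, \<open>\<beta>\<close> are the products of \<open>A\<close>, \<open>B\<close> with \<open>\<omega> + \<i> \<omega>\<^sup>\<bottom>\<close>.
  This constant is not zero, and taking logarithms gives the support function.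

  The boundary integral is with respect to Hausdorff measure. It is reduced to the area formula for
  graphs, and the traces enter only through the divergence theorem for smooth functions and a limit
  in \<open>L\<^sup>2\<close>.
\<close>

section \<open>One-dimensional Hausdorff measure\<close>

text \<open>The data come with independent existential choices: the equation holds for one weak
  Laplacian, \<open>normal_derivative\<close> brings its own weak gradient, and every trace its own
  approximating sequence. Green's formula therefore never compares two derivatives pointwise. It
  exchanges them inside integrals against functions smooth up to the boundary, which cutoffs
  exhausting \<Omega> reduce to test functions.

  The vector \<omega> + i \<omega>^perp appears because sqrt (\<tau>^2 + k^2) / \<tau> tends to 1:
  after rescaling, only the imaginary part of the exponent still depends on \<tau>. The signs of the
  products of A and B with \<omega> make the real part decay along both edges, so one integrable
  majorant serves all \<tau> > 0. No factor of C vanishes: k > 0, \<rho>(p) stands for the value of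
  the Hoelder representative at the vertex p, u(p) is nonzero by assumption, and A, B are
  independent. After division by \<tau>, the modulus of C and the power of \<tau> contribute only
  O(log \<tau> / \<tau>).\<close>

definition hausdorff1_pre :: "real \<Rightarrow> (real^2) set \<Rightarrow> ennreal" where
  "hausdorff1_pre \<delta> A = (INF C\<in>{C. A \<subseteq> (\<Union>i::nat. C i) \<and> (\<forall>i. bounded (C i) \<and> diameter (C i) \<le> \<delta>)}.
          \<Sum>i. ennreal (diameter (C i)))"

lemma hausdorff1_outer_eq: "hausdorff1_outer A = (SUP \<delta>\<in>{0<..}. hausdorff1_pre \<delta> A)"
  by (simp add: hausdorff1_outer_def hausdorff1_pre_def)

lemma hausdorff1_pre_le:
  assumes "A \<subseteq> (\<Union>i::nat. C i)" "\<And>i. bounded (C i)" "\<And>i. diameter (C i) \<le> \<delta>"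
  shows "hausdorff1_pre \<delta> A \<le> (\<Sum>i. ennreal (diameter (C i)))"
  unfolding hausdorff1_pre_def by (rule INF_lower) (use assms in auto)

lemma hausdorff1_pre_mono: "A \<subseteq> B \<Longrightarrow> hausdorff1_pre \<delta> A \<le> hausdorff1_pre \<delta> B"
  unfolding hausdorff1_pre_def by (rule INF_superset_mono) auto

lemma hausdorff1_pre_antimono: "\<delta> \<le> \<delta>' \<Longrightarrow> hausdorff1_pre \<delta>' A \<le> hausdorff1_pre \<delta> A"
  unfolding hausdorff1_pre_def by (rule INF_superset_mono) (auto intro: order_trans)

lemma hausdorff1_pre_le_outer: "\<delta> > 0 \<Longrightarrow> hausdorff1_pre \<delta> A \<le> hausdorff1_outer A"
  unfolding hausdorff1_outer_eq by (rule SUP_upper) auto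

lemma hausdorff1_outer_mono: "A \<subseteq> B \<Longrightarrow> hausdorff1_outer A \<le> hausdorff1_outer B"
  unfolding hausdorff1_outer_eq by (intro SUP_mono) (auto intro: hausdorff1_pre_mono)

lemma hausdorff1_outer_empty [simp]: "hausdorff1_outer {} = 0"
proof -
  have "hausdorff1_pre \<delta> {} \<le> 0" if "\<delta> > 0" for \<delta>
    using hausdorff1_pre_le[of "{}" "\<lambda>_. {}" \<delta>] that by simp
  then have "hausdorff1_outer {} \<le> 0"
    unfolding hausdorff1_outer_eq by (intro SUP_least) auto
  then show ?thesis by simp
qed

lemma hausdorff1_pre_approx:
  assumes "hausdorff1_pre \<delta> A < c"
  obtains C where "A \<subseteq> (\<Union>i::nat. C i)" "\<And>i. bounded (C i)" "\<And>i. diameter (C i) \<le> \<delta>"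
     "(\<Sum>i. ennreal (diameter (C i))) < c"
  using assms unfolding hausdorff1_pre_def INF_less_iff by auto

text \<open>The n-th set gets a near-optimal cover with error e / 2^(n+1), so the errors add up to
  e; \<open>prod_decode\<close> merges all the covers into one sequence.\<close>

lemma hausdorff1_pre_countably_subadditive:
  "hausdorff1_pre \<delta> (\<Union>n::nat. A n) \<le> (\<Sum>n. hausdorff1_pre \<delta> (A n))"
proof (rule ennreal_le_epsilon)
  fix e :: real assume fin: "(\<Sum>n. hausdorff1_pre \<delta> (A n)) < top" and e: "0 < e"
  have *: "\<exists>C. A n \<subseteq> (\<Union>i::nat. C i) \<and> (\<forall>i. bounded (C i) \<and> diameter (C i) \<le> \<delta>) \<and>
     (\<Sum>i. ennreal (diameter (C i))) \<le> hausdorff1_pre \<delta> (A n) + ennreal (e * (1/2) ^ Suc n)" for n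
  proof -
    have "hausdorff1_pre \<delta> (A n) < top"
      using fin by (metis ennreal_suminf_lessD)
    then have "hausdorff1_pre \<delta> (A n) < hausdorff1_pre \<delta> (A n) + ennreal (e * (1/2) ^ Suc n)"
      using e by (simp add: ennreal_add_left_cancel_less[of _ 0, simplified])
    then show ?thesis
      by (rule hausdorff1_pre_approx) (blast intro: less_imp_le)
  qed
  obtain C where C: "\<And>n. A n \<subseteq> (\<Union>i::nat. C n i)" "\<And>n i. bounded (C n i)" "\<And>n i. diameter (C n i) \<le> \<delta>"
     "\<And>n. (\<Sum>i. ennreal (diameter (C n i))) \<le> hausdorff1_pre \<delta> (A n) + ennreal (e * (1/2) ^ Suc n)"
    using * by metis
  define B where "B k = C (fst (prod_decode k)) (snd (prod_decode k))" for k
  have "hausdorff1_pre \<delta> (\<Union>n. A n) \<le> (\<Sum>k. ennreal (diameter (B k)))"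
  proof (rule hausdorff1_pre_le)
    show "(\<Union>n. A n) \<subseteq> (\<Union>k. B k)"
    proof
      fix x assume "x \<in> (\<Union>n. A n)"
      then obtain n i where "x \<in> C n i" using C(1) by blast
      then have "x \<in> B (prod_encode (n, i))" by (simp add: B_def)
      then show "x \<in> (\<Union>k. B k)" by blast
    qed
  qed (auto simp: B_def C)
  also have "\<dots> = (\<Sum>n. \<Sum>i. ennreal (diameter (C n i)))"
    using suminf_ennreal_2dimen[of "\<lambda>n. \<Sum>i. ennreal (diameter (C n i))" "\<lambda>(n,i). ennreal (diameter (C n i))"]
    by (simp add: B_def comp_def case_prod_beta)
  also have "\<dots> \<le> (\<Sum>n. hausdorff1_pre \<delta> (A n) + ennreal (e * (1/2) ^ Suc n))"
    by (intro suminf_le C) auto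
  also have "\<dots> = (\<Sum>n. hausdorff1_pre \<delta> (A n)) + (\<Sum>n. ennreal (e * (1/2) ^ Suc n))"
    by (rule suminf_add[symmetric]) auto
  also have "(\<Sum>n. ennreal (e * (1/2) ^ Suc n)) = ennreal e"
  proof (subst suminf_ennreal2)
    have "(\<lambda>n. e * (1/2) ^ Suc n) sums (e * 1)"
      by (intro sums_mult power_half_series)
    then show "summable (\<lambda>n. e * (1/2) ^ Suc n)" "ennreal (\<Sum>n. e * (1/2) ^ Suc n) = ennreal e"
      by (auto simp: sums_iff)
  qed (use e in auto)
  finally show "hausdorff1_pre \<delta> (\<Union>n. A n) \<le> (\<Sum>n. hausdorff1_pre \<delta> (A n)) + ennreal e" .
qed

lemma hausdorff1_outer_countably_subadditive:
  "hausdorff1_outer (\<Union>n::nat. A n) \<le> (\<Sum>n. hausdorff1_outer (A n))"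
proof (subst (1) hausdorff1_outer_eq, intro SUP_least)
  fix \<delta> :: real assume "\<delta> \<in> {0<..}"
  then have "(\<Sum>n. hausdorff1_pre \<delta> (A n)) \<le> (\<Sum>n. hausdorff1_outer (A n))"
    by (intro suminf_le hausdorff1_pre_le_outer) auto
  then show "hausdorff1_pre \<delta> (\<Union>n. A n) \<le> (\<Sum>n. hausdorff1_outer (A n))"
    using hausdorff1_pre_countably_subadditive order_trans by blast
qed

section \<open>Caratheodory measurability of Borel sets\<close>

lemma hausdorff1_outer_measure_space: "outer_measure_space (Pow UNIV) hausdorff1_outer"
  unfolding outer_measure_space_def positive_def increasing_def countably_subadditive_def
  by (auto intro: hausdorff1_outer_mono hausdorff1_outer_countably_subadditive)

lemma hausdorff1_outer_Un: "hausdorff1_outer (A \<union> B) \<le> hausdorff1_outer A + hausdorff1_outer B"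
proof -
  have "subadditive (Pow UNIV) hausdorff1_outer"
    using hausdorff1_outer_measure_space unfolding outer_measure_space_def
    by (intro ring_of_sets.countably_subadditive_subadditive[OF ring_of_sets_Pow]) auto
  then have "hausdorff1_outer (A \<union> (B - A)) \<le> hausdorff1_outer A + hausdorff1_outer (B - A)"
    by (simp add: subadditive_def del: Un_Diff_cancel)
  also have "\<dots> \<le> hausdorff1_outer A + hausdorff1_outer B"
    by (intro add_mono hausdorff1_outer_mono) auto
  finally show ?thesis by simp
qed

text \<open>For \<delta> < d no set of diameter at most \<delta> meets both A and B, so every cover
  of the union splits into a cover of A and a cover of B. Additivity on separated sets is what later
  makes closed sets measurable.\<close>

lemma hausdorff1_outer_separated:
  assumes d: "d > 0" and sep: "\<And>x y. x \<in> A \<Longrightarrow> y \<in> B \<Longrightarrow> d \<le> dist x y"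
  shows "hausdorff1_outer (A \<union> B) = hausdorff1_outer A + hausdorff1_outer B"
proof (rule antisym[OF hausdorff1_outer_Un])
  have small: "hausdorff1_pre \<delta> A + hausdorff1_pre \<delta> B \<le> hausdorff1_pre \<delta> (A \<union> B)" if \<delta>: "\<delta> < d" for \<delta>
  proof (subst (3) hausdorff1_pre_def, intro INF_greatest, safe)
    fix C :: "nat \<Rightarrow> (real^2) set" assume cov: "A \<union> B \<subseteq> (\<Union>i. C i)"
      and C: "\<forall>i. bounded (C i) \<and> diameter (C i) \<le> \<delta>"
    define CA where "CA i = (if C i \<inter> A \<noteq> {} then C i else {})" for i
    define CB where "CB i = (if C i \<inter> B \<noteq> {} then C i else {})" for i
    have \<delta>0: "0 \<le> \<delta>"
      using C diameter_ge_0 order_trans by blast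
    have A: "hausdorff1_pre \<delta> A \<le> (\<Sum>i. ennreal (diameter (CA i)))"
      by (rule hausdorff1_pre_le) (use cov C \<delta>0 in \<open>auto simp: CA_def split: if_splits, blast\<close>)
    have B: "hausdorff1_pre \<delta> B \<le> (\<Sum>i. ennreal (diameter (CB i)))"
      by (rule hausdorff1_pre_le) (use cov C \<delta>0 in \<open>auto simp: CB_def split: if_splits, blast\<close>)
    have not_both: "C i \<inter> A = {} \<or> C i \<inter> B = {}" for i
    proof (rule ccontr)
      assume "\<not> ?thesis"
      then obtain x y where xy: "x \<in> C i" "x \<in> A" "y \<in> C i" "y \<in> B" by auto
      then have "dist x y \<le> diameter (C i)"
        using C diameter_bounded_bound by blast
      then show False using sep[of x y] xy C \<delta> by (meson le_less_trans not_less order_trans)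
    qed
    have "hausdorff1_pre \<delta> A + hausdorff1_pre \<delta> B
        \<le> (\<Sum>i. ennreal (diameter (CA i))) + (\<Sum>i. ennreal (diameter (CB i)))"
      by (intro add_mono A B)
    also have "\<dots> = (\<Sum>i. ennreal (diameter (CA i)) + ennreal (diameter (CB i)))"
      by (rule suminf_add) auto
    also have "\<dots> \<le> (\<Sum>i. ennreal (diameter (C i)))"
      using not_both by (intro suminf_le) (auto simp: CA_def CB_def)
    finally show "hausdorff1_pre \<delta> A + hausdorff1_pre \<delta> B \<le> (\<Sum>i. ennreal (diameter (C i)))" .
  qed
  have *: "hausdorff1_pre \<delta>1 A + hausdorff1_pre \<delta>2 B \<le> hausdorff1_outer (A \<union> B)"
    if "\<delta>1 > 0" "\<delta>2 > 0" for \<delta>1 \<delta>2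
  proof -
    \<comment> \<open>A finer mesh can only increase the pre-measures, so the two meshes may be
      replaced by a common one below d.\<close>
    define \<delta> where "\<delta> = min (min \<delta>1 \<delta>2) (d/2)"
    have "hausdorff1_pre \<delta>1 A + hausdorff1_pre \<delta>2 B \<le> hausdorff1_pre \<delta> A + hausdorff1_pre \<delta> B"
      by (intro add_mono hausdorff1_pre_antimono) (auto simp: \<delta>_def)
    also have "\<dots> \<le> hausdorff1_pre \<delta> (A \<union> B)"
      using d by (intro small) (auto simp: \<delta>_def)
    also have "\<dots> \<le> hausdorff1_outer (A \<union> B)"
      using that d by (intro hausdorff1_pre_le_outer) (auto simp: \<delta>_def)
    finally show ?thesis .
  qed
  have "hausdorff1_pre \<delta>1 A + hausdorff1_outer B \<le> hausdorff1_outer (A \<union> B)" if "\<delta>1 > 0" for \<delta>1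
    unfolding hausdorff1_outer_eq[of B]
    by (subst ennreal_SUP_add_right) (auto intro!: SUP_least * that)
  then show "hausdorff1_outer A + hausdorff1_outer B \<le> hausdorff1_outer (A \<union> B)"
    unfolding hausdorff1_outer_eq[of A]
    by (subst ennreal_SUP_add_left[symmetric]) (auto intro!: SUP_least)
qed

text \<open>
  The measures of the sets \<open>R j\<close> with \<open>j\<close> of one parity add up, because two of them
  have an index strictly between them and are therefore at positive distance.
\<close>

lemma hausdorff1_outer_sum_rings:
  fixes R :: "nat \<Rightarrow> (real^2) set"
  assumes sep: "\<And>i. \<exists>d>0. \<forall>x\<in>(\<Union>j\<le>i. R j). \<forall>y\<in>(\<Union>j\<in>{i+2..}. R j). d \<le> dist x y"
  shows "(\<Sum>j\<in>{j. j < n \<and> even j = e}. hausdorff1_outer (R j)) =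
      hausdorff1_outer (\<Union>j\<in>{j. j < n \<and> even j = e}. R j)"
proof (induction n)
  case 0
  then show ?case by simp
next
  case (Suc n)
  show ?case
  proof (cases "even n = e")
    case False
    then have "{j. j < Suc n \<and> even j = e} = {j. j < n \<and> even j = e}"
      by (auto simp: less_Suc_eq)
    then show ?thesis using Suc by simp
  next
    case True
    then have eq: "{j. j < Suc n \<and> even j = e} = insert n {j. j < n \<and> even j = e}"
      by (auto simp: less_Suc_eq)
    show ?thesis
    proof (cases "n \<ge> 2")
      case n: True
      obtain d where d: "d > 0" and sd: "\<forall>x\<in>(\<Union>j\<le>n-2. R j). \<forall>y\<in>(\<Union>j\<in>{n-2+2..}. R j). d \<le> dist x y"
        using sep[of "n-2"] by blast
      have *: "j \<le> n - 2" if "j < n" "even j = e" for j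
        using that True n by (cases "j = n - 1") auto
      have "hausdorff1_outer ((\<Union>j\<in>{j. j < n \<and> even j = e}. R j) \<union> R n) =
          hausdorff1_outer (\<Union>j\<in>{j. j < n \<and> even j = e}. R j) + hausdorff1_outer (R n)"
      proof (rule hausdorff1_outer_separated[OF d])
        fix x y assume "x \<in> (\<Union>j\<in>{j. j < n \<and> even j = e}. R j)" "y \<in> R n"
        then have "x \<in> (\<Union>j\<le>n-2. R j)" "y \<in> (\<Union>j\<in>{n-2+2..}. R j)" using * n by auto
        then show "d \<le> dist x y" using sd by blast
      qed
      then show ?thesis using Suc unfolding eq by (simp add: Un_commute add.commute)
    next
      case False
      then have "n = 0 \<or> n = 1" by auto
      then have "{j. j < n \<and> even j = e} = {}" using True by auto
      then show ?thesis unfolding eq by (simp only:) simp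
    qed
  qed
qed

text \<open>
  \<open>A - C\<close> is cut into the rings at distance between \<open>1/(n+2)\<close> and \<open>1/(n+1)\<close> from \<open>C\<close>. The
  measures of the rings are summable, so that \<open>A - C\<close> is exhausted by sets separated from \<open>C\<close>.
\<close>

lemma closed_in_lambda_system_hausdorff1:
  assumes C: "closed C"
  shows "C \<in> lambda_system UNIV (Pow UNIV) hausdorff1_outer"
proof (cases "C = {}")
  case True
  then show ?thesis by (auto simp: lambda_system_def)
next
  case False
  have "hausdorff1_outer (A \<inter> C) + hausdorff1_outer (A - C) \<le> hausdorff1_outer A" for A
  proof (cases "hausdorff1_outer A = top")
    case True
    then show ?thesis by simp
  next
    case fin: False
    define S where "S n = {x\<in>A. 1 / real (Suc n) \<le> infdist x C}" for n :: nat
    define R where "R n = {x\<in>A. 1 / real (Suc (Suc n)) \<le> infdist x C \<and> infdist x C < 1 / real (Suc n)}" for n :: nat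
    have sepS: "hausdorff1_outer (A \<inter> C) + hausdorff1_outer (S n) \<le> hausdorff1_outer A" for n
    proof -
      have "hausdorff1_outer ((A \<inter> C) \<union> S n) = hausdorff1_outer (A \<inter> C) + hausdorff1_outer (S n)"
      proof (rule hausdorff1_outer_separated[of "1 / real (Suc n)"])
        fix x y assume "x \<in> A \<inter> C" "y \<in> S n"
        then show "1 / real (Suc n) \<le> dist x y"
          using infdist_le[of x C y] by (auto simp: S_def dist_commute)
      qed simp
      moreover have "hausdorff1_outer ((A \<inter> C) \<union> S n) \<le> hausdorff1_outer A"
        by (rule hausdorff1_outer_mono) (auto simp: S_def)
      ultimately show ?thesis by simp
    qed
    have sepR: "\<exists>d>0. \<forall>x\<in>(\<Union>j\<le>i. R j). \<forall>y\<in>(\<Union>j\<in>{i+2..}. R j). d \<le> dist x y" for i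
    proof (intro exI conjI ballI)
      \<comment> \<open>Rings of index at most i keep distance 1/(i+2) from C, rings of index at
        least i+2 lie within 1/(i+3) of it. As \<open>infdist\<close> is 1-Lipschitz, the difference
        separates them.\<close>
      show "1 / real (Suc (Suc i)) - 1 / real (Suc (Suc (Suc i))) > 0"
        by (simp add: field_simps add_pos_nonneg)
      fix x y assume x: "x \<in> (\<Union>j\<le>i. R j)" and y: "y \<in> (\<Union>j\<in>{i+2..}. R j)"
      from x obtain j where j: "j \<le> i" "1 / real (Suc (Suc j)) \<le> infdist x C" by (auto simp: R_def)
      from y obtain l where l: "l \<ge> i + 2" "infdist y C < 1 / real (Suc l)" by (auto simp: R_def)
      have "1 / real (Suc (Suc i)) \<le> 1 / real (Suc (Suc j))" using j by (simp add: field_simps)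
      moreover have "1 / real (Suc l) \<le> 1 / real (Suc (Suc (Suc i)))" using l by (simp add: field_simps)
      moreover have "infdist x C \<le> infdist y C + dist x y" by (rule infdist_triangle)
      ultimately show "1 / real (Suc (Suc i)) - 1 / real (Suc (Suc (Suc i))) \<le> dist x y"
        using j l by linarith
    qed
    have half: "(\<Sum>j\<in>{j. j < n \<and> even j = e}. hausdorff1_outer (R j)) \<le> hausdorff1_outer A" for n e
      unfolding hausdorff1_outer_sum_rings[of R, OF sepR]
      by (rule hausdorff1_outer_mono) (auto simp: R_def)
    have "(\<Sum>j<n. hausdorff1_outer (R j)) \<le> 2 * hausdorff1_outer A" for n
    proof -
      have "{..<n} = {j. j < n \<and> even j = True} \<union> {j. j < n \<and> even j = False}" by auto
      then have "(\<Sum>j<n. hausdorff1_outer (R j)) = (\<Sum>j\<in>{j. j < n \<and> even j = True}. hausdorff1_outer (R j))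
          + (\<Sum>j\<in>{j. j < n \<and> even j = False}. hausdorff1_outer (R j))"
        by (simp only:) (rule sum.union_disjoint; auto)
      also have "\<dots> \<le> hausdorff1_outer A + hausdorff1_outer A"
        by (intro add_mono half)
      finally show ?thesis by (simp add: mult_2)
    qed
    then have "(\<Sum>j. hausdorff1_outer (R j)) \<le> 2 * hausdorff1_outer A"
      by (intro suminf_le_const summableI) 
    also have "\<dots> < top" using fin by (simp add: ennreal_mult_less_top top.not_eq_extremum)
    finally have finR: "(\<Sum>j. hausdorff1_outer (R j)) \<noteq> top" by simp
    have cov: "A - C \<subseteq> S n \<union> (\<Union>j. R (j + n))" for n
    proof
      fix x assume x: "x \<in> A - C"
      then have pos: "infdist x C > 0"
        using in_closed_iff_infdist_zero[OF C False] infdist_nonneg[of x C] by (auto simp: less_le)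
      show "x \<in> S n \<union> (\<Union>j. R (j + n))"
      proof (cases "1 / real (Suc n) \<le> infdist x C")
        case True
        then show ?thesis using x by (auto simp: S_def)
      next
        case less: False
        obtain m where m: "1 / real (Suc m) < infdist x C" using pos nat_approx_posE by blast
        \<comment> \<open>The first scale at which x is seen to be away from C. It exceeds n because
          x is outside \<open>S n\<close>, and minimality puts x into the ring of index l -
          1.\<close>
        define l where "l = (LEAST l. 1 / real (Suc l) \<le> infdist x C)"
        have l: "1 / real (Suc l) \<le> infdist x C"
          unfolding l_def by (rule LeastI[of _ m]) (use m in simp)
        have "l > n"
        proof (rule ccontr)
          assume "\<not> l > n"
          then have "1 / real (Suc n) \<le> 1 / real (Suc l)" by (simp add: field_simps)
          then show False using l less by simp
        qed
        then obtain j where j: "l = Suc (j + n)" by (metis less_iff_Suc_add add.commute add_Suc_right)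
        have "\<not> 1 / real (Suc (j + n)) \<le> infdist x C"
          using not_less_Least[of "j + n" "\<lambda>l. 1 / real (Suc l) \<le> infdist x C"] j by (simp add: l_def)
        then have "x \<in> R (j + n)" using l x by (auto simp: R_def j)
        then show ?thesis by blast
      qed
    qed
    have le: "hausdorff1_outer (A \<inter> C) + hausdorff1_outer (A - C)
       \<le> hausdorff1_outer A + (\<Sum>j. hausdorff1_outer (R (j + n)))" for n
    proof -
      have "hausdorff1_outer (A - C) \<le> hausdorff1_outer (S n) + hausdorff1_outer (\<Union>j. R (j + n))"
        using hausdorff1_outer_mono[OF cov] hausdorff1_outer_Un order_trans by blast
      also have "\<dots> \<le> hausdorff1_outer (S n) + (\<Sum>j. hausdorff1_outer (R (j + n)))"
        by (intro add_mono hausdorff1_outer_countably_subadditive) simp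
      finally have "hausdorff1_outer (A \<inter> C) + hausdorff1_outer (A - C) \<le>
         hausdorff1_outer (A \<inter> C) + (hausdorff1_outer (S n) + (\<Sum>j. hausdorff1_outer (R (j + n))))"
        by (intro add_mono) simp
      also have "\<dots> \<le> hausdorff1_outer A + (\<Sum>j. hausdorff1_outer (R (j + n)))"
        unfolding add.assoc[symmetric] by (intro add_mono sepS) simp
      finally show ?thesis .
    qed
    \<comment> \<open>Tails of a convergent series; here the finiteness of the measure of A
      enters.\<close>
    have "(\<lambda>n. \<Sum>j. hausdorff1_outer (R (j + n))) \<longlonglongrightarrow> 0"
    proof -
      obtain r where r: "\<And>j. hausdorff1_outer (R j) = ennreal (r j)" "\<And>j. 0 \<le> r j" "summable r"
      proof -
        have fin1: "hausdorff1_outer (R j) < top" for j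
          using finR by (metis ennreal_suminf_lessD top.not_eq_extremum)
        define r where "r j = enn2real (hausdorff1_outer (R j))" for j
        have eq: "hausdorff1_outer (R j) = ennreal (r j)" for j using fin1[of j] by (simp add: r_def)
        moreover have "summable r"
        proof (rule summable_suminf_not_top)
          show "(\<Sum>j. ennreal (r j)) \<noteq> top" using finR unfolding eq .
        qed (simp add: r_def)
        ultimately show ?thesis using that[of r] by (simp add: r_def)
      qed
      have "(\<Sum>j. hausdorff1_outer (R (j + n))) = ennreal (\<Sum>j. r (j + n))" for n
        unfolding r(1) by (rule suminf_ennreal2) (auto simp: r summable_ignore_initial_segment)
      moreover have "(\<lambda>n. \<Sum>j. r (j + n)) \<longlonglongrightarrow> 0"
        using suminf_exist_split2[OF r(3)] by simp
      ultimately show ?thesis by (simp flip: ennreal_0 add: tendsto_ennrealI)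
    qed
    then have "(\<lambda>n. hausdorff1_outer A + (\<Sum>j. hausdorff1_outer (R (j + n)))) \<longlonglongrightarrow> hausdorff1_outer A + 0"
      by (intro tendsto_add tendsto_const) auto
    then show ?thesis
      by (intro LIMSEQ_le_const[of _ "hausdorff1_outer A"]) (use le in auto)
  qed
  moreover have "hausdorff1_outer A \<le> hausdorff1_outer (A \<inter> C) + hausdorff1_outer (A - C)" for A
    using hausdorff1_outer_Un[of "A \<inter> C" "A - C"] by (simp add: Int_Diff_Un)
  ultimately show ?thesis
    unfolding lambda_system_def by (auto simp: Int_commute Diff_eq intro!: antisym)
qed

text \<open>\<open>measure_of\<close> returns the given set function only if that is countably
  additive on the sigma-algebra. Closed sets lie in Caratheodory's lambda system, hence so do all
  Borel sets, and there the outer measure is countably additive.\<close>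

lemma emeasure_hausdorff1:
  assumes "A \<in> sets borel"
  shows "emeasure hausdorff1 A = hausdorff1_outer A"
proof -
  interpret P: sigma_algebra UNIV "Pow UNIV :: (real^2) set set" by (rule sigma_algebra_Pow)
  let ?L = "lambda_system UNIV (Pow UNIV) hausdorff1_outer"
  have ms: "measure_space UNIV ?L hausdorff1_outer"
    by (rule P.caratheodory_lemma[OF hausdorff1_outer_measure_space])
  then have sa: "sigma_algebra UNIV ?L" and ca: "countably_additive ?L hausdorff1_outer"
    by (auto simp: measure_space_def)
  have "sets (borel :: (real^2) measure) \<subseteq> ?L"
  proof -
    have "sets (borel :: (real^2) measure) = sigma_sets UNIV (Collect closed)"
      unfolding borel_eq_closed by simp
    also have "\<dots> \<subseteq> ?L"
      using closed_in_lambda_system_hausdorff1 by (intro sigma_algebra.sigma_sets_subset[OF sa]) auto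
    finally show ?thesis .
  qed
  then have "countably_additive (sets borel) hausdorff1_outer"
    using ca unfolding countably_additive_def by blast
  moreover have "sigma_algebra UNIV (sets (borel :: (real^2) measure))"
    using sets.sigma_algebra_axioms[of borel] by simp
  ultimately show ?thesis
    using assms unfolding hausdorff1_def
    by (subst emeasure_measure_of_sigma) (auto simp: positive_def)
qed

lemma sets_hausdorff1 [simp, measurable_cong]: "sets hausdorff1 = sets borel"
proof -
  have "sigma_algebra UNIV (sets (borel :: (real^2) measure))"
    using sets.sigma_algebra_axioms[of borel] by simp
  then show ?thesis unfolding hausdorff1_def by (simp add: sigma_algebra.sigma_sets_eq)
qed

lemma space_hausdorff1 [simp]: "space hausdorff1 = UNIV"
  using sets_eq_imp_space_eq[OF sets_hausdorff1] by simp

section \<open>Arc length of graphs\<close>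

text \<open>Cut the interval into N equal pieces of length h. Their images have diameter at most M *
  h, which is below any given mesh for large N, while the total N * M * h is M * (b - a) for every
  N.\<close>

lemma hausdorff1_outer_lipschitz_image:
  fixes \<Phi> :: "real \<Rightarrow> real^2"
  assumes ab: "a \<le> b" and M: "0 \<le> M"
    and lip: "\<And>s t. s \<in> {a..b} \<Longrightarrow> t \<in> {a..b} \<Longrightarrow> norm (\<Phi> s - \<Phi> t) \<le> M * \<bar>s - t\<bar>"
  shows "hausdorff1_outer (\<Phi> ` {a..b}) \<le> ennreal (M * (b - a))"
  unfolding hausdorff1_outer_eq
proof (intro SUP_least)
  fix \<delta> :: real assume "\<delta> \<in> {0<..}"
  then have \<delta>: "\<delta> > 0" by simp
  obtain N0 :: nat where N0: "M * (b - a) / \<delta> < real N0" using reals_Archimedean2 by blast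
  define N where "N = Suc N0"
  have N: "N > 0" "M * (b - a) / real N \<le> \<delta>"
    using N0 \<delta> by (auto simp: N_def field_simps)
  define h where "h = (b - a) / real N"
  have h0: "h \<ge> 0" using ab by (simp add: h_def)
  define C where "C i = (if i < N then \<Phi> ` ({a + real i * h .. a + real (Suc i) * h} \<inter> {a..b}) else {})" for i
  have dC: "norm (x - y) \<le> M * h" if "x \<in> C i" "y \<in> C i" for x y i
  proof -
    from that obtain s t where st: "x = \<Phi> s" "y = \<Phi> t"
      "s \<in> {a + real i * h .. a + real (Suc i) * h}" "t \<in> {a + real i * h .. a + real (Suc i) * h}" "s \<in> {a..b}" "t \<in> {a..b}"
      by (auto simp: C_def split: if_splits)
    then have "\<bar>s - t\<bar> \<le> h" by (auto simp: algebra_simps abs_if)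
    then show ?thesis using lip[of s t] st mult_left_mono[OF _ M] order_trans by metis
  qed
  have diam: "diameter (C i) \<le> M * h" for i
    by (rule diameter_le) (use dC M h0 in auto)
  have bd: "bounded (C i)" for i
  proof (cases "C i = {}")
    case False
    then obtain x where "x \<in> C i" by auto
    then show ?thesis unfolding bounded_def dist_norm using dC by blast
  qed simp
  have cov: "\<Phi> ` {a..b} \<subseteq> (\<Union>i. C i)"
  proof safe
    fix s assume s: "s \<in> {a..b}"
    have "\<exists>i<N. s \<in> {a + real i * h .. a + real (Suc i) * h}"
    proof (cases "b = a")
      case True
      then show ?thesis using s N by (auto simp: h_def intro!: exI[of _ 0])
    next
      case False
      then have hp: "h > 0" using ab N by (simp add: h_def)
      show ?thesis
      proof (cases "s = b")
        case True
        \<comment> \<open>The floor used for the other points would give N here, one past the last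
          piece \<open>N0\<close>.\<close>
        have "a + real N * h = b" using N by (simp add: h_def)
        then show ?thesis using True hp by (intro exI[of _ N0]) (auto simp: N_def algebra_simps)
      next
        case nb: False
        define i where "i = nat \<lfloor>(s - a) / h\<rfloor>"
        have ge: "(s - a) / h \<ge> 0" using s hp by simp
        have i: "real i \<le> (s - a) / h" "(s - a) / h < real i + 1"
          using ge unfolding i_def by (auto simp: of_nat_floor)
        have "real i * h \<le> s - a" "s - a \<le> real (Suc i) * h"
          using i hp by (auto simp: field_simps)
        moreover have "i < N"
        proof -
          have "real i * h < real N * h" using \<open>real i * h \<le> s - a\<close> s nb N by (simp add: h_def)
          then show ?thesis using hp by simp
        qed
        ultimately show ?thesis by (intro exI[of _ i]) auto
      qed
    qed
    then show "\<Phi> s \<in> (\<Union>i. C i)" using s by (auto simp: C_def)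
  qed
  have "hausdorff1_pre \<delta> (\<Phi> ` {a..b}) \<le> (\<Sum>i. ennreal (diameter (C i)))"
    by (rule hausdorff1_pre_le[OF cov bd]) (use diam N in \<open>auto simp: h_def intro: order_trans\<close>)
  also have "\<dots> = (\<Sum>i<N. ennreal (diameter (C i)))"
    by (rule suminf_finite) (auto simp: C_def)
  also have "\<dots> \<le> (\<Sum>i<N. ennreal (M * h))"
    by (intro sum_mono ennreal_leI diam)
  also have "\<dots> = ennreal (real N * (M * h))"
    using M h0 by (simp add: ennreal_mult' ennreal_of_nat_eq_real_of_nat)
  also have "real N * (M * h) = M * (b - a)" using N by (simp add: h_def)
  finally show "hausdorff1_pre \<delta> (\<Phi> ` {a..b}) \<le> ennreal (M * (b - a))" .
qed

text \<open>A cover of the image is pulled back to {a..b}. As distances grow by a factor of at least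
  m, each preimage has diameter at most \<open>diameter (C i) / m\<close>, and subadditivity of
  Lebesgue measure bounds b - a. The estimate holds at every mesh; mesh 1 is one instance below the
  outer measure.\<close>

lemma hausdorff1_outer_expanding_image:
  fixes \<Phi> :: "real \<Rightarrow> real^2"
  assumes ab: "a \<le> b" and m: "0 < m"
    and exp: "\<And>s t. s \<in> {a..b} \<Longrightarrow> t \<in> {a..b} \<Longrightarrow> m * \<bar>s - t\<bar> \<le> norm (\<Phi> s - \<Phi> t)"
  shows "ennreal (m * (b - a)) \<le> hausdorff1_outer (\<Phi> ` {a..b})"
proof -
  have "ennreal (m * (b - a)) \<le> hausdorff1_pre 1 (\<Phi> ` {a..b})"
    unfolding hausdorff1_pre_def
  proof (intro INF_greatest, safe)
    fix C :: "nat \<Rightarrow> (real^2) set" assume cov: "\<Phi> ` {a..b} \<subseteq> (\<Union>i. C i)"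
      and C: "\<forall>i. bounded (C i) \<and> diameter (C i) \<le> 1"
    define E where "E i = {s\<in>{a..b}. \<Phi> s \<in> C i}" for i
    \<comment> \<open>The covering sets are arbitrary, so \<open>E i\<close> may fail to be
      measurable; its hull is an interval of the same diameter.\<close>
    define K where "K i = (if E i = {} then {} else {Inf (E i)..Sup (E i)})" for i
    have bE: "bdd_below (E i)" "bdd_above (E i)" for i by (auto simp: E_def bdd_below_def bdd_above_def)
    have EK: "E i \<subseteq> K i" for i using cInf_lower[OF _ bE(1)[of i]] cSup_upper[OF _ bE(2)[of i]] by (auto simp: K_def)
    have ab_cov: "{a..b} \<subseteq> (\<Union>i. K i)"
    proof
      fix s assume "s \<in> {a..b}"
      then obtain i where "s \<in> E i" using cov by (fastforce simp: E_def)
      then show "s \<in> (\<Union>i. K i)" using EK by blast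
    qed
    have mE: "ennreal m * emeasure lborel (K i) \<le> ennreal (diameter (C i))" for i
    proof (cases "E i = {}")
      case True
      then show ?thesis by (simp add: K_def)
    next
      case False
      have "Sup (E i) - Inf (E i) \<le> diameter (C i) / m"
      proof -
        have "Sup (E i) \<le> diameter (C i) / m + Inf (E i)"
        proof (rule cSup_least[OF False])
          fix s assume s: "s \<in> E i"
          have "s - diameter (C i) / m \<le> Inf (E i)"
          proof (rule cInf_greatest[OF False])
            fix t assume t: "t \<in> E i"
            have "m * \<bar>s - t\<bar> \<le> norm (\<Phi> s - \<Phi> t)" using s t by (intro exp) (auto simp: E_def)
            also have "\<dots> \<le> diameter (C i)"
              using diameter_bounded_bound[of "C i" "\<Phi> s" "\<Phi> t"] C s t by (auto simp: E_def dist_norm)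
            finally have "\<bar>s - t\<bar> \<le> diameter (C i) / m" using m by (simp add: field_simps)
            then show "s - diameter (C i) / m \<le> t" by linarith
          qed
          then show "s \<le> diameter (C i) / m + Inf (E i)" by linarith
        qed
        then show ?thesis by linarith
      qed
      moreover have "Inf (E i) \<le> Sup (E i)"
        using False bE by (meson cInf_lower cSup_upper ex_in_conv order_trans)
      ultimately show ?thesis using False m
        by (simp add: K_def ennreal_mult'[symmetric] field_simps ennreal_leI)
    qed
    have "ennreal (m * (b - a)) = ennreal m * emeasure lborel {a..b}"
      using ab m by (simp add: ennreal_mult')
    also have "\<dots> \<le> ennreal m * (\<Sum>i. emeasure lborel (K i))"
    proof (rule mult_left_mono)
      have "emeasure lborel {a..b} \<le> emeasure lborel (\<Union>i. K i)"
        by (rule emeasure_mono[OF ab_cov]) (auto simp: K_def)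
      also have "\<dots> \<le> (\<Sum>i. emeasure lborel (K i))"
        by (rule emeasure_subadditive_countably) (auto simp: K_def)
      finally show "emeasure lborel {a..b} \<le> (\<Sum>i. emeasure lborel (K i))" .
    qed simp
    also have "\<dots> = (\<Sum>i. ennreal m * emeasure lborel (K i))" by simp
    also have "\<dots> \<le> (\<Sum>i. ennreal (diameter (C i)))"
      by (intro suminf_le mE) auto
    finally show "ennreal (m * (b - a)) \<le> (\<Sum>i. ennreal (diameter (C i)))" .
  qed
  also have "\<dots> \<le> hausdorff1_outer (\<Phi> ` {a..b})" by (rule hausdorff1_pre_le_outer) simp
  finally show ?thesis .
qed

lemma inner_real2: "(x::real^2) \<bullet> y = x$1 * y$1 + x$2 * y$2"
  by (simp add: inner_vec_def sum_2)

text \<open>With rows (a, b), (c, d) and determinant t, orthonormality forces (c, d) = t (-b, a) and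
  t^2 = 1. Hence the columns are orthonormal too, which is the expansion in components.\<close>

lemma orthonormal_expansion_real2:
  fixes e1 e2 x :: "real^2"
  assumes "norm e1 = 1" "norm e2 = 1" "e1 \<bullet> e2 = 0"
  shows "(x \<bullet> e1) *\<^sub>R e1 + (x \<bullet> e2) *\<^sub>R e2 = x"
proof -
  define a b c d where abcd: "a = e1$1" "b = e1$2" "c = e2$1" "d = e2$2"
  have n: "a*a + b*b = 1" "c*c + d*d = 1" "a*c + b*d = 0"
    using assms by (auto simp: norm_eq_1 inner_real2 abcd)
  define t where "t = a*d - b*c"
  have "a * t = (a*a + b*b) * d - b * (a*c + b*d)" by (simp add: t_def algebra_simps)
  then have d: "d = a * t" using n by simp
  have "b * t = a * (a*c+b*d) - (a*a + b*b) * c" by (simp add: t_def algebra_simps)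
  then have c: "c = - (b * t)" using n by simp
  have "t * t * (a*a+b*b) = c*c+d*d" by (simp add: c d algebra_simps)
  then have t: "t * t = 1" using n by simp
  have 1: "a*a + c*c = 1" 
  proof -
    have "a*a + c*c = a*a + b*b*(t*t)" by (simp add: c algebra_simps)
    then show ?thesis using t n by simp
  qed
  have 2: "a*b + c*d = 0"
  proof -
    have "a*b + c*d = a*b - a*b*(t*t)" by (simp add: c d algebra_simps)
    then show ?thesis using t n by simp
  qed
  have 3: "b*b + d*d = 1"
  proof -
    have "b*b + d*d = b*b + a*a*(t*t)" by (simp add: d algebra_simps)
    then show ?thesis using t n by simp
  qed
  have "((x \<bullet> e1) *\<^sub>R e1 + (x \<bullet> e2) *\<^sub>R e2)$1 = x$1 * (a*a+c*c) + x$2 * (a*b+c*d)"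
    by (simp add: inner_real2 abcd algebra_simps)
  moreover have "((x \<bullet> e1) *\<^sub>R e1 + (x \<bullet> e2) *\<^sub>R e2)$2 = x$1 * (a*b+c*d) + x$2 * (b*b+d*d)"
    by (simp add: inner_real2 abcd algebra_simps)
  ultimately show ?thesis using 1 2 3 by (simp add: vec_eq_iff forall_2)
qed

section \<open>Arc length along the graph of a continuously differentiable function\<close>

locale plane_graph =
  fixes e1 e2 :: "real^2" and \<gamma> \<gamma>' :: "real \<Rightarrow> real"
  assumes e1: "norm e1 = 1" and e2: "norm e2 = 1" and orth: "e1 \<bullet> e2 = 0"
    and der: "\<And>s. (\<gamma> has_real_derivative \<gamma>' s) (at s)"
    and cont: "continuous_on UNIV \<gamma>'"
begin

definition \<Phi> :: "real \<Rightarrow> real^2" where "\<Phi> s = s *\<^sub>R e1 + \<gamma> s *\<^sub>R e2"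
text \<open>The speed of \<Phi>, hence the expected density of arc length with respect to the
  parameter.\<close>

definition w :: "real \<Rightarrow> real" where "w s = sqrt (1 + (\<gamma>' s)\<^sup>2)"

lemma inner_simps [simp]: "e1 \<bullet> e1 = 1" "e2 \<bullet> e2 = 1" "e1 \<bullet> e2 = 0" "e2 \<bullet> e1 = 0"
  using e1 e2 orth by (auto simp: norm_eq_1 inner_commute)

lemma cont_\<gamma>: "continuous_on UNIV \<gamma>"
  using der by (meson DERIV_isCont continuous_at_imp_continuous_on)

lemma cont_\<Phi>: "continuous_on UNIV \<Phi>"
  unfolding \<Phi>_def by (intro continuous_intros cont_\<gamma>)

lemma \<Phi>_measurable [measurable]: "\<Phi> \<in> borel_measurable borel"
  by (rule borel_measurable_continuous_onI[OF cont_\<Phi>])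

lemma cont_w: "continuous_on S w"
  unfolding w_def by (intro continuous_intros continuous_on_subset[OF cont]) auto

lemma w_pos: "w s \<ge> 1" by (simp add: w_def)

lemma w_measurable [measurable]: "w \<in> borel_measurable borel"
  by (rule borel_measurable_continuous_onI[OF cont_w])

lemma \<Phi>_inner [simp]: "\<Phi> s \<bullet> e1 = s" "\<Phi> s \<bullet> e2 = \<gamma> s"
  by (auto simp: \<Phi>_def inner_add_left)

text \<open>By the mean value theorem a chord has slope \<gamma>' \<xi> for an intermediate \<xi>,
  so its length is exactly w \<xi> times the parameter length. Bounds on w thus become Lipschitz and
  expansion constants of \<Phi>.\<close>

lemma norm_\<Phi>_diff:
  assumes "s < t" obtains \<xi> where "s < \<xi>" "\<xi> < t" "norm (\<Phi> s - \<Phi> t) = w \<xi> * \<bar>s - t\<bar>"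
proof -
  obtain \<xi> where \<xi>: "s < \<xi>" "\<xi> < t" "\<gamma> t - \<gamma> s = (t - s) * \<gamma>' \<xi>"
    using MVT2[OF assms, of \<gamma> \<gamma>'] der by blast
  have "\<Phi> s - \<Phi> t = (s - t) *\<^sub>R e1 + (\<gamma> s - \<gamma> t) *\<^sub>R e2" by (simp add: \<Phi>_def algebra_simps)
  then have "(norm (\<Phi> s - \<Phi> t))\<^sup>2 = (s - t)\<^sup>2 + (\<gamma> s - \<gamma> t)\<^sup>2"
    unfolding power2_norm_eq_inner by (simp add: inner_add_left inner_add_right power2_eq_square)
  also have "\<dots> = (w \<xi> * \<bar>s - t\<bar>)\<^sup>2"
  proof -
    have "\<gamma> s - \<gamma> t = (s - t) * \<gamma>' \<xi>" using \<xi>(3) by (simp add: algebra_simps)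
    then have "(\<gamma> s - \<gamma> t)\<^sup>2 = (s - t)\<^sup>2 * (\<gamma>' \<xi>)\<^sup>2" by (simp only: power_mult_distrib)
    then show ?thesis by (simp add: w_def power_mult_distrib algebra_simps)
  qed
  finally have "norm (\<Phi> s - \<Phi> t) = w \<xi> * \<bar>s - t\<bar>"
    by (rule power2_eq_imp_eq) (use w_pos[of \<xi>] in auto)
  then show ?thesis using that \<xi> by blast
qed

lemma \<Phi>_bounds:
  assumes "\<And>s. s \<in> {a..b} \<Longrightarrow> m \<le> w s \<and> w s \<le> M" "s \<in> {a..b}" "t \<in> {a..b}"
  shows "m * \<bar>s - t\<bar> \<le> norm (\<Phi> s - \<Phi> t)" "norm (\<Phi> s - \<Phi> t) \<le> M * \<bar>s - t\<bar>"
proof -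
  have *: "m * \<bar>s - t\<bar> \<le> norm (\<Phi> s - \<Phi> t) \<and> norm (\<Phi> s - \<Phi> t) \<le> M * \<bar>s - t\<bar>"
    if st: "s < t" "s \<in> {a..b}" "t \<in> {a..b}" for s t
  proof -
    obtain \<xi> where \<xi>: "s < \<xi>" "\<xi> < t" "norm (\<Phi> s - \<Phi> t) = w \<xi> * \<bar>s - t\<bar>"
      by (rule norm_\<Phi>_diff[OF st(1)])
    then have "m \<le> w \<xi>" "w \<xi> \<le> M" using assms(1)[of \<xi>] st by auto
    then show ?thesis unfolding \<xi>(3) by (auto intro: mult_right_mono)
  qed
  show "m * \<bar>s - t\<bar> \<le> norm (\<Phi> s - \<Phi> t)" "norm (\<Phi> s - \<Phi> t) \<le> M * \<bar>s - t\<bar>"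
    using *[of s t] *[of t s] assms by (cases s t rule: linorder_cases; auto simp: norm_minus_commute abs_minus_commute)+
qed

lemma compact_\<Phi>_image: "compact (\<Phi> ` {a..b})"
  by (intro compact_continuous_image continuous_on_subset[OF cont_\<Phi>]) auto

lemma \<Phi>_image_borel [measurable]: "\<Phi> ` {a..b} \<in> sets borel"
  using compact_\<Phi>_image by (intro borel_compact)

lemma inj_\<Phi>: "inj \<Phi>"
  by (rule injI) (metis \<Phi>_inner(1))

lemma emeasure_\<Phi>_bounds:
  assumes "a \<le> b" "\<And>s. s \<in> {a..b} \<Longrightarrow> m \<le> w s \<and> w s \<le> M"
  shows "emeasure hausdorff1 (\<Phi> ` {a..b}) < top"
    "measure hausdorff1 (\<Phi> ` {a..b}) \<le> M * (b - a)"
    "0 < m \<Longrightarrow> m * (b - a) \<le> measure hausdorff1 (\<Phi> ` {a..b})"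
proof -
  have M: "0 \<le> M" using assms(2)[of a] w_pos[of a] assms(1) by auto
  have up: "emeasure hausdorff1 (\<Phi> ` {a..b}) \<le> ennreal (M * (b - a))"
    unfolding emeasure_hausdorff1[OF \<Phi>_image_borel]
    by (rule hausdorff1_outer_lipschitz_image[OF assms(1) M]) (rule \<Phi>_bounds(2)[OF assms(2)])
  then show fin: "emeasure hausdorff1 (\<Phi> ` {a..b}) < top"
    by (rule order_le_less_trans) simp
  show "measure hausdorff1 (\<Phi> ` {a..b}) \<le> M * (b - a)"
    unfolding measure_def using up M assms(1) by (intro enn2real_leI) auto
  assume m: "0 < m"
  have "ennreal (m * (b - a)) \<le> emeasure hausdorff1 (\<Phi> ` {a..b})"
    unfolding emeasure_hausdorff1[OF \<Phi>_image_borel]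
    by (rule hausdorff1_outer_expanding_image[OF assms(1) m]) (rule \<Phi>_bounds(1)[OF assms(2)])
  then show "m * (b - a) \<le> measure hausdorff1 (\<Phi> ` {a..b})"
    using fin m assms(1) by (simp add: emeasure_eq_ennreal_measure)
qed

lemma emeasure_\<Phi>_finite: "emeasure hausdorff1 (\<Phi> ` {a..b}) < top"
proof (cases "a \<le> b")
  case True
  have "compact (w ` {a..b})" by (intro compact_continuous_image cont_w) auto
  then have "bounded (w ` {a..b})" by (rule compact_imp_bounded)
  then obtain M where "\<And>s. s \<in> {a..b} \<Longrightarrow> norm (w s) \<le> M" unfolding bounded_iff by blast
  then show ?thesis using emeasure_\<Phi>_bounds(1)[OF True, of 1 M] w_pos by force
qed simp

lemma measure_\<Phi>_add:
  assumes "a \<le> b" "b \<le> c"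
  shows "measure hausdorff1 (\<Phi> ` {a..c}) = measure hausdorff1 (\<Phi> ` {a..b}) + measure hausdorff1 (\<Phi> ` {b..c})"
proof -
  \<comment> \<open>The common endpoint is a null set: apply the upper bound to an interval of
    length 0.\<close>
  have point: "emeasure hausdorff1 (\<Phi> ` {b..b}) = 0"
    using emeasure_\<Phi>_bounds(1,2)[of b b 0 "w b"] w_pos[of b]
      order.antisym[OF _ measure_nonneg[of hausdorff1 "\<Phi> ` {b..b}"]]
    by (simp add: emeasure_eq_ennreal_measure)
  have "\<Phi> ` {a..c} = \<Phi> ` {a..b} \<union> \<Phi> ` {b..c}" using assms by (auto simp flip: image_Un)
  moreover have "AE x in hausdorff1. x \<in> \<Phi> ` {a..b} \<longrightarrow> x \<notin> \<Phi> ` {b..c}"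
  proof (rule AE_I[where N="\<Phi> ` {b..b}"])
    show "{x \<in> space hausdorff1. \<not> (x \<in> \<Phi> ` {a..b} \<longrightarrow> x \<notin> \<Phi> ` {b..c})} \<subseteq> \<Phi> ` {b..b}"
      using inj_\<Phi> by (auto dest!: injD)
  qed (use point in auto)
  ultimately show ?thesis
    using emeasure_\<Phi>_finite by (simp only:) (intro measure_Un_AE; auto simp: fmeasurable_def)
qed

text \<open>
  On a short parameter interval \<open>\<Phi>\<close> changes distances by a factor close to \<open>w\<close>; hence arc
  length has derivative \<open>w\<close>.
\<close>

lemma measure_\<Phi>_has_integral:
  assumes "a \<le> b"
  shows "(w has_integral measure hausdorff1 (\<Phi> ` {a..b})) {a..b}"
proof -
  define G where "G x = measure hausdorff1 (\<Phi> ` {a..x})" for x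
  have "(G has_vector_derivative w x) (at x within {a..b})" if x: "x \<in> {a..b}" for x
    unfolding has_vector_derivative_def has_derivative_within_alt
  proof (intro conjI allI impI)
    show "bounded_linear (\<lambda>h. h *\<^sub>R w x)" by (rule bounded_linear_scaleR_left)
    fix e :: real assume e: "0 < e"
    \<comment> \<open>Since w x is at least 1, the cap 1/2 keeps w x - e' positive, as the lower
      estimate requires.\<close>
    define e' where "e' = min e (1/2)"
    have e': "0 < e'" "e' \<le> e" "e' < 1" using e by (auto simp: e'_def)
    have "isCont w x" using cont_w continuous_on_eq_continuous_at by blast
    then obtain d where d: "d > 0" "\<And>z. \<bar>z - x\<bar> < d \<Longrightarrow> \<bar>w z - w x\<bar> < e'"
      using e' unfolding continuous_at_eps_delta dist_real_def by metis
    have *: "\<bar>measure hausdorff1 (\<Phi> ` {u..v}) - w x * (v - u)\<bar> \<le> e' * (v - u)"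
      if uv: "u \<le> v" and near: "\<And>z. z \<in> {u..v} \<Longrightarrow> \<bar>z - x\<bar> < d" for u v
    proof -
      have wb: "w x - e' \<le> w z \<and> w z \<le> w x + e'" if "z \<in> {u..v}" for z
        using d(2)[OF near[OF that]] by linarith
      show ?thesis
        using emeasure_\<Phi>_bounds(2,3)[OF uv wb] w_pos[of x] e' by (auto simp: algebra_simps abs_le_iff)
    qed
    show "\<exists>d>0. \<forall>y\<in>{a..b}. norm (y - x) < d \<longrightarrow> norm (G y - G x - (y - x) *\<^sub>R w x) \<le> e * norm (y - x)"
    proof (intro exI[of _ d] conjI ballI impI)
      fix y assume y: "y \<in> {a..b}" "norm (y - x) < d"
      have "\<bar>G y - G x - (y - x) * w x\<bar> \<le> e' * \<bar>y - x\<bar>"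
      proof (cases "x \<le> y")
        case True
        have "G y = G x + measure hausdorff1 (\<Phi> ` {x..y})"
          unfolding G_def using x True by (intro measure_\<Phi>_add) auto
        then show ?thesis using *[OF True] y True by (auto simp: algebra_simps)
      next
        case False
        have "G x = G y + measure hausdorff1 (\<Phi> ` {y..x})"
          unfolding G_def using y False by (intro measure_\<Phi>_add) auto
        then show ?thesis using *[of y x] y False by (auto simp: algebra_simps abs_le_iff)
      qed
      also have "\<dots> \<le> e * \<bar>y - x\<bar>" using e' by (intro mult_right_mono) auto
      finally show "norm (G y - G x - (y - x) *\<^sub>R w x) \<le> e * norm (y - x)" by simp
    qed (use d in auto)
  qed
  then have "(w has_integral G b - G a) {a..b}"
    by (rule fundamental_theorem_of_calculus[OF assms])
  moreover have "G a = 0"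
    using measure_\<Phi>_add[of a a a] by (simp add: G_def)
  ultimately show ?thesis by (simp add: G_def)
qed

definition graph :: "(real^2) set" where "graph = {x. x \<bullet> e2 = \<gamma> (x \<bullet> e1)}"

lemma closed_graph: "closed graph"
  unfolding graph_def
  by (intro closed_Collect_eq continuous_intros continuous_on_compose2[OF cont_\<gamma>]) auto

lemma graph_borel [measurable]: "graph \<in> sets borel"
  using closed_graph by (rule borel_closed)

lemma \<Phi>_proj: "x \<in> graph \<Longrightarrow> \<Phi> (x \<bullet> e1) = x"
  using orthonormal_expansion_real2[OF e1 e2 orth, of x] by (simp add: graph_def \<Phi>_def)

text \<open>On the graph, projection to the first coordinate inverts \<Phi>, so both measures of
  {a..b} equal the arc length over {a..b}. Compact intervals form an intersection-stable generator,
  and those of the form {-n..n} have finite measure and exhaust the line.\<close>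

lemma distr_hausdorff1_graph:
  "distr (restrict_space hausdorff1 graph) borel (\<lambda>x. x \<bullet> e1) = density lborel (\<lambda>s. ennreal (w s))"
  (is "?L = ?R")
proof (rule measure_eqI_generator_eq[where \<Omega>=UNIV and E="range (\<lambda>(a,b). {a..b::real})" and A="\<lambda>n. {- real n..real n}"])
  have m: "(\<lambda>x. x \<bullet> e1) \<in> measurable (restrict_space hausdorff1 graph) borel"
    by (intro measurable_restrict_space1) simp
  have em: "emeasure ?L {a..b} = emeasure hausdorff1 (\<Phi> ` {a..b})" for a b
  proof -
    have "graph \<inter> (\<lambda>x. x \<bullet> e1) -` {a..b} = \<Phi> ` {a..b}"
    proof (intro equalityI subsetI)
      fix x assume "x \<in> graph \<inter> (\<lambda>x. x \<bullet> e1) -` {a..b}"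
      then show "x \<in> \<Phi> ` {a..b}" by (intro image_eqI[of _ _ "x \<bullet> e1"]) (auto simp: \<Phi>_proj)
    qed (auto simp: graph_def)
    moreover have "\<Phi> ` {a..b} \<subseteq> graph" by (auto simp: graph_def)
    ultimately show ?thesis using m
      by (simp add: emeasure_distr emeasure_restrict_space space_restrict_space Int_commute)
  qed
  show "Int_stable (range (\<lambda>(a,b). {a..b::real}))"
    by (force simp: Int_stable_def)
  show "emeasure ?L X = emeasure ?R X" if X: "X \<in> range (\<lambda>(a,b). {a..b})" for X
  proof -
    from X obtain a b where X: "X = {a..b}" by auto
    show ?thesis
    proof (cases "a \<le> b")
      case True
      have "emeasure ?R {a..b} = (\<integral>\<^sup>+s. ennreal (indicator {a..b} s * w s) \<partial>lborel)"
        by (auto simp: emeasure_density indicator_def intro!: nn_integral_cong)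
      also have "\<dots> = ennreal (measure hausdorff1 (\<Phi> ` {a..b}))"
        by (rule nn_integral_has_integral_lebesgue[OF _ measure_\<Phi>_has_integral[OF True]])
          (rule order_trans[OF zero_le_one w_pos])
      also have "\<dots> = emeasure hausdorff1 (\<Phi> ` {a..b})"
        using emeasure_\<Phi>_finite[of a b] by (intro emeasure_eq_ennreal_measure[symmetric]) auto
      finally show ?thesis unfolding X em by simp
    qed (simp add: X)
  qed
  show "sets ?L = sigma_sets UNIV (range (\<lambda>(a,b). {a..b::real}))"
    by (subst sets_measure_of[symmetric]) (simp_all add: borel_eq_atLeastAtMost)
  show "sets ?R = sigma_sets UNIV (range (\<lambda>(a,b). {a..b::real}))"
    by (subst sets_measure_of[symmetric]) (simp_all add: borel_eq_atLeastAtMost)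
  show "(\<Union>i::nat. {- real i..real i}) = UNIV"
  proof -
    have "\<exists>n::nat. x \<in> {- real n..real n}" for x
      using real_arch_simple[of "\<bar>x\<bar>"] by (auto simp: abs_le_iff minus_le_iff)
    then show ?thesis by blast
  qed
  show "emeasure ?L {- real n..real n} \<noteq> \<infinity>" for n
    unfolding em using emeasure_\<Phi>_finite by (simp add: less_top)
qed auto

lemma integral_hausdorff1_graph:
  fixes h :: "real^2 \<Rightarrow> complex"
  assumes [measurable]: "h \<in> borel_measurable borel"
  shows "(LINT x|restrict_space hausdorff1 graph. h x) = (LINT s|lborel. w s *\<^sub>R h (\<Phi> s))"
proof -
  have m: "(\<lambda>x. x \<bullet> e1) \<in> measurable (restrict_space hausdorff1 graph) borel"
    by (intro measurable_restrict_space1) simp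
  have "(LINT x|restrict_space hausdorff1 graph. h x) = (LINT x|restrict_space hausdorff1 graph. h (\<Phi> (x \<bullet> e1)))"
    by (rule Bochner_Integration.integral_cong) (auto simp: space_restrict_space \<Phi>_proj)
  also have "\<dots> = (LINT s|distr (restrict_space hausdorff1 graph) borel (\<lambda>x. x \<bullet> e1). h (\<Phi> s))"
    by (rule integral_distr[symmetric, OF m]) simp
  also have "\<dots> = (LINT s|lborel. w s *\<^sub>R h (\<Phi> s))"
    unfolding distr_hausdorff1_graph
    by (rule integral_density) (auto intro: order_trans[OF zero_le_one w_pos])
  finally show ?thesis .
qed

end

section \<open>Smooth functions and cutoffs\<close>

text \<open>Lets a derivative be exhibited in a form convenient for induction, without reasoning
  about the choice hidden in \<open>frechet_derivative\<close>.\<close>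

lemma C_k_SucI:
  assumes "\<And>x. (f has_derivative D x) (at x)" "\<And>b. b \<in> Basis \<Longrightarrow> C_k n (\<lambda>x. D x b)"
  shows "C_k (Suc n) f"
proof -
  have "frechet_derivative f (at x) = D x" for x
    using frechet_derivative_at[OF assms(1)] by simp
  then show ?thesis using assms by (auto simp: differentiable_def)
qed

lemma C_k_Suc_D: "C_k (Suc n) f \<Longrightarrow> C_k n f"
proof (induction n arbitrary: f)
  case 0
  then show ?case
    by (auto intro!: continuous_at_imp_continuous_on differentiable_imp_continuous_within)
next
  case (Suc n)
  then show ?case by (metis C_k.simps(2))
qed

lemma C_k_mono: "m \<le> n \<Longrightarrow> C_k n f \<Longrightarrow> C_k m f"
  by (induction n rule: dec_induct) (auto dest: C_k_Suc_D simp del: C_k.simps)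

lemma C_k_imp_continuous: "C_k n f \<Longrightarrow> continuous_on S f"
  using C_k_mono[of 0 n f] by (auto intro: continuous_on_subset)

lemma C_k_Suc_has_derivative: "C_k (Suc n) f \<Longrightarrow> (f has_derivative frechet_derivative f (at x)) (at x)"
  by (auto simp: frechet_derivative_works)

lemma C_k_const: "C_k n (\<lambda>x. c)"
proof (induction n arbitrary: c)
  case (Suc n)
  show ?case by (rule C_k_SucI[where D="\<lambda>x h. 0"]) (auto intro!: derivative_eq_intros Suc)
qed simp

lemma C_k_bounded_linear: "bounded_linear L \<Longrightarrow> C_k n L"
proof (induction n)
  case 0
  then show ?case using linear_continuous_on by auto
next
  case (Suc n)
  show ?case by (rule C_k_SucI[where D="\<lambda>x. L"]) (auto intro: bounded_linear_imp_has_derivative Suc C_k_const)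
qed

lemma C_k_linear_compose: "bounded_linear L \<Longrightarrow> C_k n f \<Longrightarrow> C_k n (\<lambda>x. L (f x))"
proof (induction n arbitrary: f)
  case 0
  then show ?case by (auto intro: bounded_linear.continuous_on)
next
  case (Suc n)
  show ?case
  proof (rule C_k_SucI[where D="\<lambda>x h. L (frechet_derivative f (at x) h)"])
    show "((\<lambda>x. L (f x)) has_derivative (\<lambda>h. L (frechet_derivative f (at x) h))) (at x)" for x
      using bounded_linear.has_derivative[OF Suc.prems(1) C_k_Suc_has_derivative[OF Suc.prems(2)]] .
  qed (use Suc in auto)
qed

lemma C_k_add: "C_k n f \<Longrightarrow> C_k n g \<Longrightarrow> C_k n (\<lambda>x. f x + g x)"
proof (induction n arbitrary: f g)
  case 0
  then show ?case by (auto intro: continuous_intros)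
next
  case (Suc n)
  show ?case
    by (rule C_k_SucI[OF has_derivative_add[OF C_k_Suc_has_derivative[OF Suc.prems(1)] C_k_Suc_has_derivative[OF Suc.prems(2)]]])
      (use Suc in auto)
qed

text \<open>One induction covers multiplication, scaling and the inner product.\<close>

lemma C_k_bilinear:
  assumes "bounded_bilinear mul"
  shows "C_k n f \<Longrightarrow> C_k n g \<Longrightarrow> C_k n (\<lambda>x. mul (f x) (g x))"
proof (induction n arbitrary: f g)
  case 0
  then show ?case by (auto intro: bounded_bilinear.continuous_on[OF assms])
next
  case (Suc n)
  show ?case
    by (rule C_k_SucI[OF bounded_bilinear.FDERIV[OF assms C_k_Suc_has_derivative[OF Suc.prems(1)] C_k_Suc_has_derivative[OF Suc.prems(2)]]])
      (intro C_k_add Suc.IH, use Suc.prems Suc.prems[THEN C_k_Suc_D] in auto)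
qed

lemma C_k_mult:
  fixes f g :: "'a::euclidean_space \<Rightarrow> 'b::real_normed_algebra"
  shows "C_k n f \<Longrightarrow> C_k n g \<Longrightarrow> C_k n (\<lambda>x. f x * g x)"
  by (rule C_k_bilinear[OF bounded_bilinear_mult])

lemma C_k_scaleR: "C_k n f \<Longrightarrow> C_k n g \<Longrightarrow> C_k n (\<lambda>x. f x *\<^sub>R g x)"
  by (rule C_k_bilinear[OF bounded_bilinear_scaleR])

lemma C_k_minus: "C_k n f \<Longrightarrow> C_k n (\<lambda>x. - f x)"
  using C_k_linear_compose[OF bounded_linear_minus[OF bounded_linear_ident]] .

lemma C_k_diff: "C_k n f \<Longrightarrow> C_k n g \<Longrightarrow> C_k n (\<lambda>x. f x - g x)"
  using C_k_add[OF _ C_k_minus, of n f g] by simp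

lemma C_k_prod:
  fixes f :: "'i \<Rightarrow> 'a::euclidean_space \<Rightarrow> real"
  shows "(\<And>i. i \<in> I \<Longrightarrow> C_k n (f i)) \<Longrightarrow> C_k n (\<lambda>x. \<Prod>i\<in>I. f i x)"
  by (induction I rule: infinite_finite_induct) (auto intro: C_k_const C_k_mult)

text \<open>The derivative of h at a real point is multiplication by its value at 1. The chain rule
  therefore gives a scaling of h' composed with q, and the induction hypothesis applies to h'; this
  is why h varies in the induction.\<close>

lemma C_k_compose_real:
  fixes h :: "real \<Rightarrow> 'b::real_normed_vector" and q :: "'a::euclidean_space \<Rightarrow> real"
  shows "C_k n h \<Longrightarrow> C_k n q \<Longrightarrow> C_k n (\<lambda>x. h (q x))"
proof (induction n arbitrary: h)
  case 0
  then show ?case by (auto intro: continuous_on_compose2)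
next
  case (Suc n)
  have h': "frechet_derivative h (at y) t = t *\<^sub>R frechet_derivative h (at y) 1" for y t
    using linear_scale[OF has_derivative_linear[OF C_k_Suc_has_derivative[OF Suc.prems(1)]], of y t 1] by simp
  show ?case
  proof (rule C_k_SucI[OF has_derivative_compose[OF C_k_Suc_has_derivative[OF Suc.prems(2)] C_k_Suc_has_derivative[OF Suc.prems(1)]]])
    fix b :: 'a assume b: "b \<in> Basis"
    have "C_k n (\<lambda>x. frechet_derivative q (at x) b *\<^sub>R frechet_derivative h (at (q x)) 1)"
      using Suc.prems Suc.prems[THEN C_k_Suc_D] b by (intro C_k_scaleR Suc.IH) auto
    then show "C_k n (\<lambda>x. frechet_derivative h (at (q x)) (frechet_derivative q (at x) b))"
      by (subst h') 
  qed
qed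

lemma C_k_inverse:
  fixes f :: "'a::euclidean_space \<Rightarrow> real"
  assumes nz: "\<And>x. f x \<noteq> 0"
  shows "C_k n f \<Longrightarrow> C_k n (\<lambda>x. inverse (f x))"
proof (induction n)
  case 0
  then show ?case using nz by (auto intro: continuous_intros)
next
  case (Suc n)
  show ?case
    by (rule C_k_SucI[OF Deriv.has_derivative_inverse[OF nz C_k_Suc_has_derivative[OF Suc.prems(1)]]])
      (intro C_k_minus C_k_mult Suc.IH, use Suc.prems Suc.prems[THEN C_k_Suc_D] in auto)
qed

section \<open>A flat function, bumps and cutoffs\<close>

lemma power_div_fact_le_exp:
  fixes x :: real
  assumes "0 \<le> x"
  shows "x ^ n / fact n \<le> exp x"
proof -
  have "(\<Sum>i\<in>{n}. x ^ i /\<^sub>R fact i) \<le> (\<Sum>i. x ^ i /\<^sub>R fact i)"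
    by (rule sum_le_suminf) (use assms summable_exp_generic[of x] in \<open>auto simp del: real_scaleR_def intro!: scaleR_nonneg_nonneg\<close>)
  then show ?thesis by (simp add: exp_def field_simps)
qed

text \<open>For m = 0 this is the classical exp (-1/x) extended by 0. The powers of 1/x make the
  family closed under differentiation up to linear combinations, so smoothness is proved for all m
  in one induction.\<close>

definition flat :: "nat \<Rightarrow> real \<Rightarrow> real" where
  "flat m x = (if x > 0 then inverse x ^ m * exp (- inverse x) else 0)"

text \<open>Compare exp (1/x) with the single term of index m + 2 of its series. Quadratic decay
  makes the difference quotient at 0 tend to 0.\<close>

lemma flat_bound:
  assumes "x > 0"
  shows "\<bar>flat m x\<bar> \<le> fact (m + 2) * x\<^sup>2"
proof -
  have "inverse x ^ (m + 2) / fact (m + 2) \<le> exp (inverse x)"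
    by (rule power_div_fact_le_exp) (use assms in simp)
  then have "inverse x ^ (m + 2) \<le> exp (inverse x) * fact (m + 2)"
    by (simp only: pos_divide_le_eq[OF fact_gt_zero])
  then have "inverse x ^ (m + 2) * exp (- inverse x) \<le> exp (inverse x) * fact (m + 2) * exp (- inverse x)"
    by (rule mult_right_mono) simp
  also have "\<dots> = fact (m + 2)" by (simp add: exp_minus)
  finally have "inverse x ^ (m + 2) * exp (- inverse x) \<le> fact (m + 2)" .
  then have "inverse x ^ (m + 2) * exp (- inverse x) * x\<^sup>2 \<le> fact (m + 2) * x\<^sup>2"
    by (rule mult_right_mono) simp
  moreover have "inverse x ^ (m + 2) * exp (- inverse x) * x\<^sup>2 = flat m x"
    using assms by (simp add: flat_def power_add power2_eq_square field_simps)
  moreover have "0 \<le> flat m x" by (simp add: flat_def)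
  ultimately show ?thesis by linarith
qed

lemma flat_has_derivative:
  "(flat m has_real_derivative (flat (m + 2) x - real m * flat (m + 1) x)) (at x)"
proof (cases x "0::real" rule: linorder_cases)
  case less
  have A: "((\<lambda>x. 0) has_real_derivative (flat (m + 2) x - real m * flat (m + 1) x)) (at x)"
    using less by (simp add: flat_def)
  have B: "eventually (\<lambda>y. (0::real) = flat m y) (nhds x)"
    using eventually_nhds_in_open[of "{..<0}" x] less by (auto elim!: eventually_mono simp: flat_def)
  show ?thesis by (rule iffD1[OF DERIV_cong_ev[OF refl B refl] A])
next
  case greater
  have A: "((\<lambda>x. inverse x ^ m * exp (- inverse x)) has_real_derivative (flat (m + 2) x - real m * flat (m + 1) x)) (at x)"
    using greater
    by (auto intro!: derivative_eq_intros simp: flat_def power2_eq_square)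
      (cases m; simp add: field_simps power2_eq_square)
  have B: "eventually (\<lambda>y. inverse y ^ m * exp (- inverse y) = flat m y) (nhds x)"
    using eventually_nhds_in_open[of "{0<..}" x] greater by (auto elim!: eventually_mono simp: flat_def)
  show ?thesis by (rule iffD1[OF DERIV_cong_ev[OF refl B refl] A])
next
  case equal
  have "(\<lambda>h. (flat m (0 + h) - flat m 0) / h) \<midarrow>0\<rightarrow> 0"
  proof (rule Lim_null_comparison)
    show "\<forall>\<^sub>F h in at 0. norm ((flat m (0 + h) - flat m 0) / h) \<le> fact (m + 2) * \<bar>h\<bar>"
    proof (rule eventuallyI)
      fix h :: real
      show "norm ((flat m (0 + h) - flat m 0) / h) \<le> fact (m + 2) * \<bar>h\<bar>"
      proof (cases "h > 0")
        case True
        then show ?thesis using flat_bound[OF True, of m]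
          by (simp add: flat_def[of m 0] field_simps power2_eq_square)
      next
        case False
        then have "flat m (0 + h) - flat m 0 = 0" by (simp add: flat_def)
        then show ?thesis by (simp only:) simp
      qed
    qed
    show "((\<lambda>h::real. fact (m + 2) * \<bar>h\<bar>) \<longlongrightarrow> 0) (at 0)"
      by (auto intro!: tendsto_eq_intros)
  qed
  then show ?thesis by (simp add: DERIV_def equal flat_def[of _ 0])
qed

lemma C_k_flat: "C_k n (flat m)"
proof (induction n arbitrary: m)
  case 0
  show ?case using flat_has_derivative by (auto intro!: continuous_at_imp_continuous_on DERIV_isCont)
next
  case (Suc n)
  show ?case
    by (rule C_k_SucI[OF flat_has_derivative[unfolded has_field_derivative_def]])
      (intro C_k_mult C_k_diff C_k_const Suc)
qed

text \<open>Equal to 1 up to 1 and to 0 from 2 on. The denominator never vanishes, because at least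
  one of 2 - t and t - 1 is positive.\<close>

definition smooth_step :: "real \<Rightarrow> real" where
  "smooth_step t = flat 0 (2 - t) * inverse (flat 0 (2 - t) + flat 0 (t - 1))"

lemma flat0: "flat 0 x \<ge> 0" "x > 0 \<Longrightarrow> flat 0 x > 0" "x \<le> 0 \<Longrightarrow> flat 0 x = 0"
  by (auto simp: flat_def)

lemma C_k_smooth_step: "C_k n smooth_step"
proof -
  have nz: "flat 0 (2 - t) + flat 0 (t - 1) \<noteq> 0" for t
    using flat0(1)[of "2 - t"] flat0(1)[of "t - 1"] flat0(2)[of "2 - t"] flat0(2)[of "t - 1"]
    by (cases "t < 2") auto
  have "C_k n (\<lambda>t. flat 0 (2 - t))" "C_k n (\<lambda>t. flat 0 (t - 1))"
    by (intro C_k_compose_real[OF C_k_flat] C_k_diff C_k_const C_k_bounded_linear bounded_linear_ident)+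
  then show ?thesis unfolding smooth_step_def [abs_def]
    by (intro C_k_mult C_k_inverse C_k_add nz)
qed

lemma smooth_step_simps: "t \<le> 1 \<Longrightarrow> smooth_step t = 1" "t \<ge> 2 \<Longrightarrow> smooth_step t = 0"
  using flat0(2)[of "2 - t"] flat0(3)[of "2 - t"] flat0(3)[of "t - 1"] by (auto simp: smooth_step_def)

lemma smooth_step_bounds: "0 \<le> smooth_step t" "smooth_step t \<le> 1"
proof -
  have "0 \<le> flat 0 (2 - t)" "0 \<le> flat 0 (t - 1)" using flat0 by auto
  then show "0 \<le> smooth_step t" "smooth_step t \<le> 1"
    by (auto simp: smooth_step_def divide_inverse[symmetric] divide_le_eq_1)
qed

text \<open>The squared distance keeps the function smooth at the centre. For r > 0 it is 1 on
  \<open>cball c r\<close> and vanishes at distance at least sqrt 2 times r, so in particular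
  outside the doubled ball.\<close>

definition bump :: "real^2 \<Rightarrow> real \<Rightarrow> real^2 \<Rightarrow> real" where
  "bump c r x = smooth_step ((x - c) \<bullet> (x - c) / r\<^sup>2)"

lemma C_k_inner_diff: "C_k n (\<lambda>x::'a::euclidean_space. (x - c) \<bullet> (x - c))"
  by (rule C_k_bilinear[OF bounded_bilinear_inner])
    (intro C_k_diff C_k_const C_k_bounded_linear bounded_linear_ident)+

lemma C_inf_bump: "C_inf (bump c r)"
  unfolding C_inf_def bump_def[abs_def] divide_inverse
  by (intro allI C_k_compose_real[OF C_k_smooth_step] C_k_mult C_k_inner_diff C_k_const)

lemma bump_bounds: "0 \<le> bump c r x" "bump c r x \<le> 1"
  by (auto simp: bump_def smooth_step_bounds)

lemma bump_eq_1: "r > 0 \<Longrightarrow> x \<in> cball c r \<Longrightarrow> bump c r x = 1"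
  unfolding bump_def
  by (rule smooth_step_simps)
    (simp add: dot_square_norm dist_norm norm_minus_commute power_mono)

lemma bump_eq_0: "r > 0 \<Longrightarrow> x \<notin> ball c (2 * r) \<Longrightarrow> bump c r x = 0"
proof -
  assume r: "r > 0" and x: "x \<notin> ball c (2 * r)"
  then have "2 * r \<le> norm (x - c)" by (simp add: dist_norm norm_minus_commute)
  then have "(2 * r)\<^sup>2 \<le> (norm (x - c))\<^sup>2" using r by (intro power_mono) auto
  moreover have "2 * r\<^sup>2 \<le> (2 * r)\<^sup>2" by (simp add: power_mult_distrib)
  ultimately have "2 * r\<^sup>2 \<le> (norm (x - c))\<^sup>2" by linarith
  then show ?thesis unfolding bump_def using r
    by (intro smooth_step_simps) (simp add: dot_square_norm field_simps)
qed

lemma C_infD: "C_inf f \<Longrightarrow> C_k n f" by (simp add: C_inf_def)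

text \<open>By Lindelof countably many balls cover \<Omega> whose closed doubles stay in \<Omega>.
  The product of the factors 1 - bump vanishes at a point as soon as a ball containing that point
  has been used, so the convergence at each point is eventually constant. Together with the bound 1
  this is what dominated convergence needs.\<close>

lemma C_inf_cutoffs:
  fixes \<Omega> :: "(real^2) set"
  assumes "open \<Omega>" "\<Omega> \<noteq> {}"
  obtains \<zeta> :: "nat \<Rightarrow> real^2 \<Rightarrow> real"
  where "\<And>j. test_function \<Omega> (\<zeta> j)" "\<And>j x. \<bar>\<zeta> j x\<bar> \<le> 1" "\<And>x. x \<in> \<Omega> \<Longrightarrow> (\<lambda>j. \<zeta> j x) \<longlonglongrightarrow> 1"
proof -
  have "\<exists>r>0. cball x (2 * r) \<subseteq> \<Omega>" if x: "x \<in> \<Omega>" for x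
  proof -
    obtain e where "e > 0" "cball x e \<subseteq> \<Omega>" using assms(1) x unfolding open_contains_cball by blast
    then show ?thesis by (intro exI[of _ "e/2"]) simp
  qed
  then have "\<forall>x\<in>\<Omega>. \<exists>r. r > 0 \<and> cball x (2 * r) \<subseteq> \<Omega>" by blast
  from bchoice[OF this] obtain r
    where r: "\<And>x. x \<in> \<Omega> \<Longrightarrow> r x > 0" "\<And>x. x \<in> \<Omega> \<Longrightarrow> cball x (2 * r x) \<subseteq> \<Omega>" by blast
  obtain F' where F': "F' \<subseteq> (\<lambda>x. ball x (r x)) ` \<Omega>" "countable F'" "\<Union>F' = \<Union>((\<lambda>x. ball x (r x)) ` \<Omega>)"
    by (rule Lindelof[where \<F>="(\<lambda>x. ball x (r x)) ` \<Omega>"]) auto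
  obtain X where X: "X \<subseteq> \<Omega>" "countable X" "F' = (\<lambda>x. ball x (r x)) ` X"
    using iffD1[OF countable_subset_image conjI[OF F'(2,1)]] by blast
  have cov: "\<exists>c\<in>X. x \<in> ball c (r c)" if "x \<in> \<Omega>" for x
  proof -
    have "x \<in> \<Union>F'" unfolding F'(3) using that r(1)[OF that] by (auto intro!: bexI[of _ x])
    then show ?thesis using X by auto
  qed
  then have Xne: "X \<noteq> {}" using assms by auto
  define c where "c i = from_nat_into X i" for i
  have c: "c i \<in> \<Omega>" for i using from_nat_into[OF Xne] X by (auto simp: c_def)
  define \<zeta> where "\<zeta> j x = 1 - (\<Prod>i<j. 1 - bump (c i) (r (c i)) x)" for j :: nat and x
  have prod: "0 \<le> (\<Prod>i<j. 1 - bump (c i) (r (c i)) x)" "(\<Prod>i<j. 1 - bump (c i) (r (c i)) x) \<le> 1" for j x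
    using bump_bounds by (auto intro!: prod_nonneg prod_le_1)
  show ?thesis
  proof
    show "\<bar>\<zeta> j x\<bar> \<le> 1" for j x using prod[where j=j and x=x] by (auto simp: \<zeta>_def)
    show "test_function \<Omega> (\<zeta> j)" for j
    proof -
      let ?K = "\<Union>i<j. cball (c i) (2 * r (c i))"
      have K: "compact ?K" "?K \<subseteq> \<Omega>" using r(2)[OF c] by auto
      have "{x. \<zeta> j x \<noteq> 0} \<subseteq> ?K"
      proof
        fix x assume "x \<in> {x. \<zeta> j x \<noteq> 0}"
        then have "(\<Prod>i<j. 1 - bump (c i) (r (c i)) x) \<noteq> 1" by (simp add: \<zeta>_def)
        then have "\<not> (\<forall>i<j. bump (c i) (r (c i)) x = 0)"
          by (metis (no_types, lifting) diff_zero lessThan_iff prod.neutral)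
        then obtain i where i: "i < j" "bump (c i) (r (c i)) x \<noteq> 0" by auto
        then have "x \<in> ball (c i) (2 * r (c i))" using bump_eq_0 r(1)[OF c] by blast
        then show "x \<in> ?K" using i by (auto intro!: bexI[of _ i])
      qed
      then have "closure {x. \<zeta> j x \<noteq> 0} \<subseteq> ?K"
        using K(1) by (intro closure_minimal compact_imp_closed)
      moreover have "C_inf (\<zeta> j)" unfolding C_inf_def \<zeta>_def[abs_def]
        by (intro allI C_k_diff C_k_const C_k_prod C_infD[OF C_inf_bump])
      moreover have "compact (closure {x. \<zeta> j x \<noteq> 0})"
        using closed_Int_compact[OF closed_closure K(1), of "{x. \<zeta> j x \<noteq> 0}"] calculation(1)
        by (simp add: inf.absorb1)
      ultimately show ?thesis unfolding test_function_def using K by blast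
    qed
    fix x assume "x \<in> \<Omega>"
    then obtain d where d: "d \<in> X" "x \<in> ball d (r d)" using cov by auto
    obtain n where n: "c n = d" using from_nat_into_surj[OF X(2) d(1)] by (auto simp: c_def)
    have "\<zeta> j x = 1" if "j > n" for j
    proof -
      have "bump (c n) (r (c n)) x = 1" using d r(1) X n by (intro bump_eq_1) auto
      then have "(\<Prod>i<j. 1 - bump (c i) (r (c i)) x) = 0" using that by (auto intro!: bexI[of _ n])
      then show ?thesis by (simp add: \<zeta>_def)
    qed
    then show "(\<lambda>j. \<zeta> j x) \<longlonglongrightarrow> 1"
      by (intro tendsto_eventually) (auto simp: eventually_sequentially intro!: exI[of _ "Suc n"])
  qed
qed

section \<open>Partial derivatives\<close>

lemma axis_in_Basis_real: "axis i (1::real) \<in> Basis"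
  by (simp add: axis_in_Basis_iff)

lemma C_k_partial: "C_k (Suc n) f \<Longrightarrow> C_k n (partial i f)"
  unfolding partial_def[abs_def] using axis_in_Basis_real[of i] by auto

lemma C_inf_partial: "C_inf f \<Longrightarrow> C_inf (partial i f)"
  unfolding C_inf_def using C_k_partial by blast

lemma partial_eqI: "(f has_derivative f') (at x) \<Longrightarrow> partial i f x = f' (axis i 1)"
  unfolding partial_def using frechet_derivative_at by metis

lemma partial_bilinear:
  assumes "bounded_bilinear mul" "f differentiable at x" "g differentiable at x"
  shows "partial i (\<lambda>x. mul (f x) (g x)) x = mul (f x) (partial i g x) + mul (partial i f x) (g x)"
  unfolding partial_def[of i f] partial_def[of i g]
  by (rule partial_eqI[OF bounded_bilinear.FDERIV]) (use assms in \<open>auto simp: frechet_derivative_works\<close>)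

lemma partial_linear:
  assumes "bounded_linear L" "f differentiable at x"
  shows "partial i (\<lambda>x. L (f x)) x = L (partial i f x)"
  unfolding partial_def[of i f]
  by (rule partial_eqI[OF bounded_linear.has_derivative]) (use assms in \<open>auto simp: frechet_derivative_works\<close>)

lemma partial_eq_0_of_support:
  assumes "closed S" "\<And>y. y \<notin> S \<Longrightarrow> f y = 0" "x \<notin> S"
  shows "partial i f x = 0"
proof -
  have "((\<lambda>y. 0) has_derivative (\<lambda>h. 0)) (at x)" by simp
  then have "(f has_derivative (\<lambda>h. 0)) (at x)"
    by (rule has_derivative_transform_within_open[where s="- S"]) (use assms in auto)
  then show ?thesis by (rule partial_eqI)
qed

section \<open>Plane coordinates and integration over subgraphs\<close>

text \<open>It is enough to compare the measures on boxes. The preimage of a box is bounded and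
  open, and the formula for linear images multiplies its measure by the determinant.\<close>

lemma lborel_linear_density:
  fixes g :: "real^2 \<Rightarrow> real^2"
  assumes g: "linear g" and nz: "det (matrix g) \<noteq> 0"
  shows "lborel = density (distr lborel borel g) (\<lambda>_. ennreal \<bar>det (matrix g)\<bar>)"
proof (rule lborel_eqI)
  have gm [measurable]: "g \<in> borel_measurable borel"
    using g by (intro borel_measurable_continuous_onI linear_continuous_on) (simp add: linear_conv_bounded_linear)
  have inj: "inj g" using g nz det_nz_iff_inj by blast
  then have surj: "surj g" using g linear_injective_imp_surjective by blast
  fix l u :: "real^2" assume lu: "\<And>b. b \<in> Basis \<Longrightarrow> l \<bullet> b \<le> u \<bullet> b"
  define S where "S = g -` box l u"
  have S: "open S" unfolding S_def using g
    by (intro open_vimage linear_continuous_on) (auto simp: linear_conv_bounded_linear)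
  obtain h where h: "linear h" "h \<circ> g = id" "g \<circ> h = id"
    using linear_injective_isomorphism[OF g inj] by (auto simp: fun_eq_iff)
  have "S = h ` box l u"
  proof (intro equalityI subsetI)
    fix x assume "x \<in> S"
    then show "x \<in> h ` box l u"
      using h(2) by (intro image_eqI[of _ _ "g x"]) (auto simp: S_def fun_eq_iff)
  qed (use h(3) in \<open>auto simp: S_def fun_eq_iff\<close>)
  then have "bounded S" using bounded_linear_image[of "box l u" h] h(1) by (simp add: linear_conv_bounded_linear)
  then have Sm: "S \<in> lmeasurable" using S lmeasurable_open by blast
  have gS: "g ` S = box l u" using surj by (auto simp: S_def image_vimage_eq)
  have "emeasure (density (distr lborel borel g) (\<lambda>_. ennreal \<bar>det (matrix g)\<bar>)) (box l u)
      = ennreal \<bar>det (matrix g)\<bar> * emeasure lborel S"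
    by (simp add: emeasure_density nn_integral_cmult emeasure_distr S_def)
  also have "emeasure lborel S = ennreal (measure lebesgue S)"
  proof -
    have "S \<in> sets lborel" using S by simp
    then have "emeasure lborel S = emeasure lebesgue S" by simp
    also have "\<dots> = ennreal (measure lebesgue S)" 
      by (rule emeasure_eq_ennreal_measure) (use fmeasurableD2[OF Sm] in simp)
    finally show ?thesis .
  qed
  also have "ennreal \<bar>det (matrix g)\<bar> * ennreal (measure lebesgue S) = ennreal (measure lebesgue (box l u))"
    using measure_linear_image[OF g Sm] gS by (simp add: ennreal_mult')
  also have "\<dots> = ennreal (\<Prod>b\<in>Basis. (u - l) \<bullet> b)"
    using lu by (simp add: measure_completion)
  finally show "emeasure (density (distr lborel borel g) (\<lambda>_. ennreal \<bar>det (matrix g)\<bar>)) (box l u)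
      = ennreal (\<Prod>b\<in>Basis. (u - l) \<bullet> b)" .
qed simp

text \<open>Transfers Fubini's theorem from pairs of reals to vectors.\<close>

lemma lborel_real2_eq_distr:
  "(lborel :: (real^2) measure) = distr (lborel :: (real \<times> real) measure) borel (\<lambda>p. fst p *\<^sub>R axis 1 1 + snd p *\<^sub>R axis 2 1)"
proof (rule lborel_eqI)
  fix l u :: "real^2" assume lu: "\<And>b. b \<in> Basis \<Longrightarrow> l \<bullet> b \<le> u \<bullet> b"
  have B: "(Basis :: (real^2) set) = {axis 1 1, axis 2 1}"
    by (auto simp: Basis_vec_def exhaust_2) (metis exhaust_2)
  have ne: "axis 1 1 \<noteq> (axis 2 1 :: real^2)" by (simp add: axis_eq_axis)
  have ax: "(axis 1 1 :: real^2) $ 1 = 1" "(axis 1 1 :: real^2) $ 2 = 0" "(axis 2 1 :: real^2) $ 1 = 0" "(axis 2 1 :: real^2) $ 2 = 1"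
    by (auto simp: axis_def)
  have le: "l $ 1 \<le> u $ 1" "l $ 2 \<le> u $ 2"
    using lu[of "axis 1 1"] lu[of "axis 2 1"] by (auto simp: B inner_axis)
  have [measurable]: "(\<lambda>p::real\<times>real. fst p *\<^sub>R axis 1 (1::real) + snd p *\<^sub>R axis 2 1 :: real^2) \<in> borel_measurable borel"
    by (intro borel_measurable_continuous_onI continuous_intros)
  have "(\<lambda>p::real\<times>real. fst p *\<^sub>R axis 1 (1::real) + snd p *\<^sub>R axis 2 1 :: real^2) -` box l u
     = box (l $ 1, l $ 2) (u $ 1, u $ 2)"
    using ax by (auto simp: box_def B Basis_prod_def inner_axis inner_add_left)
  then have "emeasure (distr (lborel :: (real \<times> real) measure) borel (\<lambda>p. fst p *\<^sub>R axis 1 1 + snd p *\<^sub>R axis 2 1)) (box l u)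
     = emeasure lborel (box (l $ 1, l $ 2) (u $ 1, u $ 2))"
    by (simp add: emeasure_distr)
  also have "\<dots> = ennreal (\<Prod>b\<in>Basis. (u - l) \<bullet> b)"
    using le ne by (subst emeasure_lborel_box) (auto simp: Basis_prod_def B inner_axis prod.insert_if)
  finally show "emeasure (distr (lborel :: (real \<times> real) measure) borel (\<lambda>p. fst p *\<^sub>R axis 1 1 + snd p *\<^sub>R axis 2 1)) (box l u)
     = ennreal (\<Prod>b\<in>Basis. (u - l) \<bullet> b)" .
qed simp

lemma lborel_plane_coordinates:
  fixes A B :: "real^2"
  assumes d: "A$1 * B$2 - A$2 * B$1 \<noteq> 0"
  shows "(lborel :: (real^2) measure) = density (distr (lborel :: (real \<times> real) measure) borel (\<lambda>p. fst p *\<^sub>R A + snd p *\<^sub>R B))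
      (\<lambda>_. ennreal \<bar>A$1 * B$2 - A$2 * B$1\<bar>)"
proof -
  define g :: "real^2 \<Rightarrow> real^2" where "g x = x$1 *\<^sub>R A + x$2 *\<^sub>R B" for x
  have g: "linear g" by (rule linearI) (auto simp: g_def algebra_simps)
  have det: "det (matrix g) = A$1 * B$2 - A$2 * B$1"
    by (simp add: det_2 matrix_def g_def axis_def)
  have [measurable]: "g \<in> borel_measurable borel"
    using g by (intro borel_measurable_continuous_onI linear_continuous_on) (simp add: linear_conv_bounded_linear)
  have [measurable]: "(\<lambda>p::real\<times>real. fst p *\<^sub>R axis 1 (1::real) + snd p *\<^sub>R axis 2 1 :: real^2) \<in> borel_measurable borel"
    by (intro borel_measurable_continuous_onI continuous_intros)
  have "distr (lborel::(real^2) measure) borel g = distr (lborel :: (real \<times> real) measure) borel (\<lambda>p. fst p *\<^sub>R A + snd p *\<^sub>R B)"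
  proof (subst lborel_real2_eq_distr, subst distr_distr)
    show "distr lborel borel (g \<circ> (\<lambda>p. fst p *\<^sub>R axis 1 1 + snd p *\<^sub>R axis 2 1)) = distr lborel borel (\<lambda>p. fst p *\<^sub>R A + snd p *\<^sub>R B)"
      by (rule arg_cong[where f="distr lborel borel"]) (auto simp: fun_eq_iff g_def axis_def)
  qed simp_all
  then show ?thesis using lborel_linear_density[OF g] d by (simp add: det)
qed

lemma integrable_scaleR_iff:
  fixes f :: "'a \<Rightarrow> 'b::{banach, second_countable_topology}"
  assumes "c \<noteq> 0"
  shows "integrable M (\<lambda>x. c *\<^sub>R f x) \<longleftrightarrow> integrable M f"
  using assms integrable_scaleR_right[of "inverse c" M "\<lambda>x. c *\<^sub>R f x"] by auto

lemma integral_plane_coordinates: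
  fixes A B :: "real^2" and f :: "real^2 \<Rightarrow> 'b::{banach, second_countable_topology}"
  assumes d: "A$1 * B$2 - A$2 * B$1 \<noteq> 0" and f [measurable]: "f \<in> borel_measurable borel"
  shows "integrable lborel f \<longleftrightarrow> integrable (lborel :: (real \<times> real) measure) (\<lambda>p. f (fst p *\<^sub>R A + snd p *\<^sub>R B))"
    "(LINT x|lborel. f x) = \<bar>A$1 * B$2 - A$2 * B$1\<bar> *\<^sub>R (LINT p|(lborel :: (real \<times> real) measure). f (fst p *\<^sub>R A + snd p *\<^sub>R B))"
proof -
  have [measurable]: "(\<lambda>p::real\<times>real. fst p *\<^sub>R A + snd p *\<^sub>R B) \<in> borel_measurable borel"
    by (intro borel_measurable_continuous_onI continuous_intros)
  note eq = lborel_plane_coordinates[OF d]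
  show "integrable lborel f \<longleftrightarrow> integrable (lborel :: (real \<times> real) measure) (\<lambda>p. f (fst p *\<^sub>R A + snd p *\<^sub>R B))"
    using d by (subst eq) (simp add: integrable_density integrable_distr_eq integrable_scaleR_iff)
  show "(LINT x|lborel. f x) = \<bar>A$1 * B$2 - A$2 * B$1\<bar> *\<^sub>R (LINT p|(lborel :: (real \<times> real) measure). f (fst p *\<^sub>R A + snd p *\<^sub>R B))"
    by (subst eq) (simp add: integral_density integral_distr)
qed

section \<open>Integrating derivatives of compactly supported functions\<close>

lemma integrable_continuous_compact_support:
  fixes f :: "'a::euclidean_space \<Rightarrow> 'b::{banach, second_countable_topology}"
  assumes "continuous_on UNIV f" "compact K" "\<And>x. x \<notin> K \<Longrightarrow> f x = 0"
  shows "integrable lborel f"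
proof -
  have "integrable lborel (\<lambda>x. indicator K x *\<^sub>R f x)"
    by (intro borel_integrable_compact continuous_on_subset[OF assms(1)] assms) auto
  also have "(\<lambda>x. indicator K x *\<^sub>R f x) = f" using assms(3) by (auto simp: indicator_def)
  finally show ?thesis .
qed

lemma integral_deriv_halfline:
  fixes F F' :: "real \<Rightarrow> complex"
  assumes der: "\<And>t. (F has_vector_derivative F' t) (at t)" and cont: "continuous_on UNIV F'"
    and zero: "\<And>t. \<bar>t\<bar> > M \<Longrightarrow> F t = 0"
  shows "(LINT t|lborel. indicator {..<0} t *\<^sub>R F' t) = F 0" "(LINT t|lborel. F' t) = 0"
proof -
  have zero': "F' t = 0" if t: "\<bar>t\<bar> > M" for t
  proof -
    have "open {t. \<bar>t\<bar> > M}" by (intro open_Collect_less continuous_intros)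
    then have "(F has_vector_derivative 0) (at t)"
      by (rule has_vector_derivative_transform_within_open[OF has_vector_derivative_const[of 0]]) (use t zero in auto)
    then show ?thesis using der vector_derivative_unique_at by blast
  qed
  define N where "N = \<bar>M\<bar> + 1"
  have N: "N > 0" "F N = 0" "F (- N) = 0" using zero[of N] zero[of "-N"] by (auto simp: N_def)
  have FTC: "(LINT t|lborel. indicator {a..b} t *\<^sub>R F' t) = F b - F a" if "a \<le> b" for a b
    by (rule integral_FTC_Icc[OF that has_vector_derivative_at_within[OF der] continuous_on_subset[OF cont]]) simp
  have "(LINT t|lborel. indicator {..<0} t *\<^sub>R F' t) = (LINT t|lborel. indicator {-N..0} t *\<^sub>R F' t)"
  proof (rule integral_cong_AE)
    show "AE t in lborel. indicator {..<0} t *\<^sub>R F' t = indicator {-N..0} t *\<^sub>R F' t"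
      using AE_lborel_singleton[of 0]
    proof eventually_elim
      case (elim t)
      then show ?case using zero'[of t] by (cases "t < -N") (auto simp: indicator_def N_def)
    qed
  qed (use borel_measurable_continuous_onI[OF cont] in auto)
  then show "(LINT t|lborel. indicator {..<0} t *\<^sub>R F' t) = F 0" using FTC[of "-N" 0] N by simp
  have "(LINT t|lborel. F' t) = (LINT t|lborel. indicator {-N..N} t *\<^sub>R F' t)"
    by (rule Bochner_Integration.integral_cong) (use zero' in \<open>auto simp: indicator_def N_def\<close>)
  then show "(LINT t|lborel. F' t) = 0" using FTC[of "-N" N] N by simp
qed

text \<open>The derivative of \<phi> at y in direction v, written through the partial derivatives so
  that linearity in v and continuity in y are visible.\<close>

definition dderiv :: "(real^2 \<Rightarrow> complex) \<Rightarrow> real^2 \<Rightarrow> real^2 \<Rightarrow> complex" where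
  "dderiv \<phi> v y = v$1 *\<^sub>R partial 1 \<phi> y + v$2 *\<^sub>R partial 2 \<phi> y"

lemma dderiv_has_derivative:
  assumes "C_k 1 \<phi>"
  shows "(\<phi> has_derivative (\<lambda>v. dderiv \<phi> v y)) (at y)"
proof -
  have D: "(\<phi> has_derivative frechet_derivative \<phi> (at y)) (at y)"
    using assms by (auto simp: frechet_derivative_works)
  interpret linear "frechet_derivative \<phi> (at y)" using has_derivative_linear[OF D] .
  have "frechet_derivative \<phi> (at y) v = dderiv \<phi> v y" for v
  proof -
    have "v = v$1 *\<^sub>R axis 1 1 + v$2 *\<^sub>R axis 2 1" by (simp add: vec_eq_iff forall_2 axis_def)
    then have "frechet_derivative \<phi> (at y) v = frechet_derivative \<phi> (at y) (v$1 *\<^sub>R axis 1 1 + v$2 *\<^sub>R axis 2 1)" by simp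
    then show ?thesis by (simp only: add scale dderiv_def partial_def)
  qed
  then have "frechet_derivative \<phi> (at y) = (\<lambda>v. dderiv \<phi> v y)" by (rule ext)
  then show ?thesis using D by (simp only:)
qed

lemma dderiv_add: "dderiv \<phi> (v + w) y = dderiv \<phi> v y + dderiv \<phi> w y"
  by (simp add: dderiv_def algebra_simps)

lemma dderiv_scaleR: "dderiv \<phi> (c *\<^sub>R v) y = c *\<^sub>R dderiv \<phi> v y"
  by (simp add: dderiv_def algebra_simps)

lemma dderiv_axis: "dderiv \<phi> (axis i 1) y = partial i \<phi> y"
  using exhaust_2[of i] by (auto simp: dderiv_def axis_def)

lemma C_k_1_partial_continuous: "C_k 1 \<phi> \<Longrightarrow> continuous_on S (partial i \<phi>)"
  using C_k_imp_continuous[OF C_k_partial, of 0 \<phi>] by simp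

context plane_graph
begin

lemma det_eq: "\<bar>e1$1 * e2$2 - e1$2 * e2$1\<bar> = 1"
proof -
  have "(e1$1 * e2$2 - e1$2 * e2$1)\<^sup>2 = (e1 \<bullet> e1) * (e2 \<bullet> e2) - (e1 \<bullet> e2)\<^sup>2"
    unfolding inner_real2 by (simp add: power2_eq_square algebra_simps)
  then have "(e1$1 * e2$2 - e1$2 * e2$1)\<^sup>2 = 1" by simp
  then show ?thesis by (simp add: power2_eq_1_iff) auto
qed

text \<open>
  The shear \<open>(s, \<tau>) \<mapsto> s e\<^sub>1 + (\<tau> + \<gamma> s) e\<^sub>2\<close> straightens the boundary to \<open>\<tau> = 0\<close>. In these
  coordinates the \<open>s\<close>-derivative integrates to \<open>0\<close> and the \<open>\<tau>\<close>-derivative to the boundary values.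
\<close>

lemma integral_subgraph_partial:
  fixes \<phi> :: "real^2 \<Rightarrow> complex"
  assumes \<phi>: "C_k 1 \<phi>" and supp: "\<And>y. norm y > R \<Longrightarrow> \<phi> y = 0"
  shows "(LINT y|lborel. indicator {y. y \<bullet> e2 < \<gamma> (y \<bullet> e1)} y *\<^sub>R partial i \<phi> y)
     = (LINT s|lborel. (e2$i - \<gamma>' s * e1$i) *\<^sub>R \<phi> (\<Phi> s))"
proof -
  define \<Psi> where "\<Psi> s \<tau> = s *\<^sub>R e1 + (\<tau> + \<gamma> s) *\<^sub>R e2" for s \<tau>
  define Q where "Q = partial i \<phi>"
  have \<phi>c: "continuous_on UNIV \<phi>" using C_k_imp_continuous[OF \<phi>] .
  have pc: "continuous_on S (partial j \<phi>)" for j S using C_k_1_partial_continuous[OF \<phi>] .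
  have zero: "partial j \<phi> y = 0" if "norm y > R" for y j
    by (rule partial_eq_0_of_support[of "cball 0 R"]) (use supp that in auto)
  have \<Psi>_inner: "\<Psi> s \<tau> \<bullet> e1 = s" "\<Psi> s \<tau> \<bullet> e2 = \<tau> + \<gamma> s" for s \<tau>
    by (auto simp: \<Psi>_def inner_add_left)
  have norm_\<Psi>: "\<bar>s\<bar> \<le> norm (\<Psi> s \<tau>)" "\<bar>\<tau> + \<gamma> s\<bar> \<le> norm (\<Psi> s \<tau>)" for s \<tau>
    using Cauchy_Schwarz_ineq2[of "\<Psi> s \<tau>" e1] Cauchy_Schwarz_ineq2[of "\<Psi> s \<tau>" e2] e1 e2 by (auto simp: \<Psi>_inner)
  have "compact (\<gamma> ` {-\<bar>R\<bar>..\<bar>R\<bar>})" by (intro compact_continuous_image continuous_on_subset[OF cont_\<gamma>]) auto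
  then have "bounded (\<gamma> ` {-\<bar>R\<bar>..\<bar>R\<bar>})" by (rule compact_imp_bounded)
  then obtain G where G: "\<And>s. s \<in> {-\<bar>R\<bar>..\<bar>R\<bar>} \<Longrightarrow> \<bar>\<gamma> s\<bar> \<le> G" unfolding bounded_iff real_norm_def by blast
  define M where "M = \<bar>R\<bar> + G"
  have far: "norm (\<Psi> s \<tau>) > R" if "\<bar>s\<bar> > \<bar>R\<bar> \<or> \<bar>\<tau>\<bar> > M" for s \<tau>
  proof (cases "\<bar>s\<bar> > \<bar>R\<bar>")
    case False
    then have "\<bar>\<gamma> s\<bar> \<le> G" by (intro G) auto
    then show ?thesis using that False norm_\<Psi>(2)[of \<tau> s] unfolding M_def by linarith
  qed (use norm_\<Psi>(1)[of s \<tau>] in linarith)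
  have cont_\<Psi>: "continuous_on UNIV (\<lambda>p. \<Psi> (fst p) (snd p))"
    unfolding \<Psi>_def by (intro continuous_intros continuous_on_compose2[OF cont_\<gamma>]) auto
  define F1 where "F1 s \<tau> = dderiv \<phi> (e1 + \<gamma>' s *\<^sub>R e2) (\<Psi> s \<tau>)" for s \<tau>
  define F2 where "F2 s \<tau> = dderiv \<phi> e2 (\<Psi> s \<tau>)" for s \<tau>
  have cF1: "continuous_on UNIV (\<lambda>p. F1 (fst p) (snd p))"
    unfolding F1_def dderiv_def
    by (simp, intro continuous_intros continuous_on_compose2[OF pc cont_\<Psi>] continuous_on_compose2[OF cont]) auto
  have cF2: "continuous_on UNIV (\<lambda>p. F2 (fst p) (snd p))"
    unfolding F2_def dderiv_def
    by (intro continuous_intros continuous_on_compose2[OF pc cont_\<Psi>]) auto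
  have sec: "continuous_on UNIV (\<lambda>p. f (fst p) (snd p)) \<Longrightarrow> continuous_on UNIV (f s) \<and> continuous_on UNIV (\<lambda>s. f s \<tau>)"
    for f :: "real \<Rightarrow> real \<Rightarrow> complex" and s \<tau>
  proof -
    assume f: "continuous_on UNIV (\<lambda>p. f (fst p) (snd p))"
    have "continuous_on UNIV (\<lambda>t. f (fst (s, t)) (snd (s, t)))"
      by (rule continuous_on_compose2[OF f]) (auto intro!: continuous_intros)
    moreover have "continuous_on UNIV (\<lambda>s. f (fst (s, \<tau>)) (snd (s, \<tau>)))"
      by (rule continuous_on_compose2[OF f]) (auto intro!: continuous_intros)
    ultimately show ?thesis by simp
  qed
  have Fz: "F1 s \<tau> = 0" "F2 s \<tau> = 0" "\<phi> (\<Psi> s \<tau>) = 0" if "\<bar>s\<bar> > \<bar>R\<bar> \<or> \<bar>\<tau>\<bar> > M" for s \<tau>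
    using zero[OF far[OF that]] supp[OF far[OF that]] by (auto simp: F1_def F2_def dderiv_def)
  have Fz': "F1 s \<tau> = 0" "F2 s \<tau> = 0" if "\<not> (- M \<le> \<tau> \<and> \<tau> \<le> M)" for s \<tau>
  proof -
    have "M < \<bar>\<tau>\<bar>" using that by linarith
    then show "F1 s \<tau> = 0" "F2 s \<tau> = 0" using Fz by blast+
  qed
  have d\<tau>: "((\<lambda>\<tau>. \<phi> (\<Psi> s \<tau>)) has_vector_derivative F2 s \<tau>) (at \<tau>)" for s \<tau>
  proof -
    have "((\<lambda>\<tau>. s *\<^sub>R e1 + (\<tau> + \<gamma> s) *\<^sub>R e2) has_derivative (\<lambda>h. 0 + (h + 0) *\<^sub>R e2)) (at \<tau>)"
      by (intro has_derivative_add has_derivative_const has_derivative_scaleR_left has_derivative_ident)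
    then have "((\<lambda>\<tau>. \<Psi> s \<tau>) has_derivative (\<lambda>h. h *\<^sub>R e2)) (at \<tau>)"
      by (simp add: \<Psi>_def)
    from has_derivative_compose[OF this dderiv_has_derivative[OF \<phi>]] show ?thesis
      by (simp only: has_vector_derivative_def F2_def dderiv_scaleR)
  qed
  have ds: "((\<lambda>s. \<phi> (\<Psi> s \<tau>)) has_vector_derivative F1 s \<tau>) (at s)" for s \<tau>
  proof -
    have "((\<lambda>s. s *\<^sub>R e1 + (\<tau> + \<gamma> s) *\<^sub>R e2) has_derivative (\<lambda>h. h *\<^sub>R e1 + (0 + \<gamma>' s * h) *\<^sub>R e2)) (at s)"
      by (intro has_derivative_add has_derivative_const has_derivative_scaleR_left has_derivative_ident
          der[unfolded has_field_derivative_def])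
    then have "((\<lambda>s. \<Psi> s \<tau>) has_derivative (\<lambda>h. h *\<^sub>R (e1 + \<gamma>' s *\<^sub>R e2))) (at s)"
      by (simp add: \<Psi>_def algebra_simps)
    from has_derivative_compose[OF this dderiv_has_derivative[OF \<phi>]] show ?thesis
      by (simp only: has_vector_derivative_def F1_def dderiv_scaleR)
  qed
  \<comment> \<open>Expand \<open>axis i 1\<close> in e1, e2 and write e1 as the tangent e1 +
    \<gamma>' s e2 minus \<gamma>' s e2. The tangent direction is the s-derivative, e2 the
    \<tau>-derivative.\<close>
  have Q_eq: "Q (\<Psi> s \<tau>) = e1$i *\<^sub>R F1 s \<tau> + (e2$i - \<gamma>' s * e1$i) *\<^sub>R F2 s \<tau>" for s \<tau>
  proof -
    have "axis i 1 = e1$i *\<^sub>R e1 + e2$i *\<^sub>R e2"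
      using orthonormal_expansion_real2[OF e1 e2 orth, of "axis i 1"] by (simp add: inner_axis')
    then have "Q (\<Psi> s \<tau>) = dderiv \<phi> (e1$i *\<^sub>R e1 + e2$i *\<^sub>R e2) (\<Psi> s \<tau>)"
      by (simp add: Q_def dderiv_axis[symmetric])
    then show ?thesis by (simp add: F1_def F2_def dderiv_add dderiv_scaleR algebra_simps)
  qed
  let ?S = "{y. y \<bullet> e2 < \<gamma> (y \<bullet> e1)}"
  have S_open: "open ?S"
    by (intro open_Collect_less continuous_intros continuous_on_compose2[OF cont_\<gamma>]) auto
  have [measurable]: "?S \<in> sets borel" using S_open by simp
  have Qm [measurable]: "Q \<in> borel_measurable borel"
    unfolding Q_def using pc by (intro borel_measurable_continuous_onI)
  have Qint: "integrable lborel Q"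
    unfolding Q_def by (rule integrable_continuous_compact_support[OF pc, of "cball 0 R"]) (auto intro: zero)
  have SQint: "integrable lborel (\<lambda>y. indicator ?S y *\<^sub>R Q y)"
    using Qint by (intro integrable_mult_indicator) auto
  have det0: "e1$1 * e2$2 - e1$2 * e2$1 \<noteq> 0" using det_eq by auto
  have ind: "indicator ?S (s *\<^sub>R e1 + t *\<^sub>R e2) = indicator {..<\<gamma> s} t" for s t
    by (auto simp: indicator_def inner_add_left)
  have pint: "integrable (lborel \<Otimes>\<^sub>M lborel) (\<lambda>p. indicator {..<\<gamma> (fst p)} (snd p) *\<^sub>R Q (fst p *\<^sub>R e1 + snd p *\<^sub>R e2))"
    using SQint unfolding lborel_prod by (subst (asm) integral_plane_coordinates(1)[OF det0]) (auto simp: ind)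
have F1int: "integrable (lborel \<Otimes>\<^sub>M lborel) (\<lambda>p. indicator {..<0} (snd p) *\<^sub>R F1 (fst p) (snd p))"
  proof -
    have "integrable lborel (\<lambda>p. F1 (fst p) (snd p))"
      by (rule integrable_continuous_compact_support[OF cF1, of "cbox (-\<bar>R\<bar>, -M) (\<bar>R\<bar>, M)"])
        (use Fz(1) in \<open>force simp: mem_box Basis_prod_def\<close>)+
    then have "integrable lborel (\<lambda>p. indicator (UNIV \<times> {..<0}) p *\<^sub>R F1 (fst p) (snd p))"
      by (intro integrable_mult_indicator) (auto simp: open_Times)
    also have "(\<lambda>p. indicator (UNIV \<times> {..<0}) p *\<^sub>R F1 (fst p) (snd p)) = (\<lambda>p. indicator {..<0} (snd p) *\<^sub>R F1 (fst p) (snd p))"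
      by (auto simp: indicator_def fun_eq_iff)
    finally show ?thesis by (simp add: lborel_prod)
  qed
  have "(LINT y|lborel. indicator ?S y *\<^sub>R Q y)
      = (LINT p|lborel. indicator {..<\<gamma> (fst p)} (snd p) *\<^sub>R Q (fst p *\<^sub>R e1 + snd p *\<^sub>R e2))"
    by (subst integral_plane_coordinates(2)[OF det0]) (auto simp: det_eq ind)
  also have "\<dots> = (LINT s|lborel. LINT t|lborel. indicator {..<\<gamma> s} t *\<^sub>R Q (s *\<^sub>R e1 + t *\<^sub>R e2))"
    using lborel_pair.integral_fst'[OF pint] by (simp add: lborel_prod)
  also have "\<dots> = (LINT s|lborel. LINT \<tau>|lborel. indicator {..<0} \<tau> *\<^sub>R Q (\<Psi> s \<tau>))"
  proof (rule Bochner_Integration.integral_cong[OF refl])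
    fix s
    show "(LINT t|lborel. indicator {..<\<gamma> s} t *\<^sub>R Q (s *\<^sub>R e1 + t *\<^sub>R e2)) = (LINT \<tau>|lborel. indicator {..<0} \<tau> *\<^sub>R Q (\<Psi> s \<tau>))"
      by (subst lborel_integral_real_affine[where c=1 and t="\<gamma> s"])
        (auto simp: \<Psi>_def indicator_def add.commute intro!: Bochner_Integration.integral_cong)
  qed
  also have "\<dots> = (LINT s|lborel. e1$i *\<^sub>R (LINT \<tau>|lborel. indicator {..<0} \<tau> *\<^sub>R F1 s \<tau>) + (e2$i - \<gamma>' s * e1$i) *\<^sub>R \<phi> (\<Phi> s))"
  proof (rule Bochner_Integration.integral_cong[OF refl])
    fix s
    have i: "integrable lborel (\<lambda>\<tau>. indicator {..<0} \<tau> *\<^sub>R F1 s \<tau>)" "integrable lborel (\<lambda>\<tau>. indicator {..<0} \<tau> *\<^sub>R F2 s \<tau>)"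
      using sec[OF cF1] sec[OF cF2] Fz'
      by (intro integrable_mult_indicator integrable_continuous_compact_support[where K="{-M..M}"]; simp)+
    have "(LINT \<tau>|lborel. indicator {..<0} \<tau> *\<^sub>R Q (\<Psi> s \<tau>)) =
       (LINT \<tau>|lborel. e1$i *\<^sub>R (indicator {..<0} \<tau> *\<^sub>R F1 s \<tau>) + (e2$i - \<gamma>' s * e1$i) *\<^sub>R (indicator {..<0} \<tau> *\<^sub>R F2 s \<tau>))"
      by (rule Bochner_Integration.integral_cong) (auto simp: Q_eq indicator_def)
    also have "\<dots> = e1$i *\<^sub>R (LINT \<tau>|lborel. indicator {..<0} \<tau> *\<^sub>R F1 s \<tau>) + (e2$i - \<gamma>' s * e1$i) *\<^sub>R (LINT \<tau>|lborel. indicator {..<0} \<tau> *\<^sub>R F2 s \<tau>)"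
      by (subst Bochner_Integration.integral_add) (intro integrable_scaleR_right i refl | simp only: integral_scaleR_right)+
    also have "(LINT \<tau>|lborel. indicator {..<0} \<tau> *\<^sub>R F2 s \<tau>) = \<phi> (\<Psi> s 0)"
      using sec[OF cF2] Fz by (intro integral_deriv_halfline(1)[where M=M] d\<tau>) auto
    also have "\<Psi> s 0 = \<Phi> s" by (simp add: \<Psi>_def \<Phi>_def)
    finally show "(LINT \<tau>|lborel. indicator {..<0} \<tau> *\<^sub>R Q (\<Psi> s \<tau>)) = e1$i *\<^sub>R (LINT \<tau>|lborel. indicator {..<0} \<tau> *\<^sub>R F1 s \<tau>) + (e2$i - \<gamma>' s * e1$i) *\<^sub>R \<phi> (\<Phi> s)" .
  qed
  also have "\<dots> = e1$i *\<^sub>R (LINT s|lborel. LINT \<tau>|lborel. indicator {..<0} \<tau> *\<^sub>R F1 s \<tau>) + (LINT s|lborel. (e2$i - \<gamma>' s * e1$i) *\<^sub>R \<phi> (\<Phi> s))"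
  proof -
    have "integrable lborel (\<lambda>s. (e2$i - \<gamma>' s * e1$i) *\<^sub>R \<phi> (\<Phi> s))"
    proof (rule integrable_continuous_compact_support[where K="{-\<bar>R\<bar>..\<bar>R\<bar>}"])
      show "(e2$i - \<gamma>' s * e1$i) *\<^sub>R \<phi> (\<Phi> s) = 0" if "s \<notin> {-\<bar>R\<bar>..\<bar>R\<bar>}" for s
        using Fz(3)[of s 0] that by (auto simp: \<Psi>_def \<Phi>_def)
      show "continuous_on UNIV (\<lambda>s. (e2$i - \<gamma>' s * e1$i) *\<^sub>R \<phi> (\<Phi> s))"
        by (intro continuous_intros cont continuous_on_compose2[OF \<phi>c cont_\<Phi>]) auto
    qed auto
    moreover have "integrable lborel (\<lambda>s. e1$i *\<^sub>R (LINT \<tau>|lborel. indicator {..<0} \<tau> *\<^sub>R F1 s \<tau>))"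
      using lborel_pair.integrable_fst'[OF F1int] by (intro integrable_scaleR_right) (simp only: fst_conv snd_conv)
    ultimately show ?thesis
      by (subst Bochner_Integration.integral_add) (simp_all only: integral_scaleR_right)
  qed
  also have "(LINT s|lborel. LINT \<tau>|lborel. indicator {..<0} \<tau> *\<^sub>R F1 s \<tau>) = 0"
  proof -
    \<comment> \<open>With the s-integral inside, the cutoff in \<tau> is a constant factor and the
      integrand is the full derivative of a function with bounded support.\<close>
    have "(LINT s|lborel. LINT \<tau>|lborel. indicator {..<0} \<tau> *\<^sub>R F1 s \<tau>) = (LINT \<tau>|lborel. LINT s|lborel. indicator {..<0} \<tau> *\<^sub>R F1 s \<tau>)"
      
      by (rule lborel_pair.Fubini_integral[symmetric]) (use F1int in \<open>simp add: case_prod_beta'\<close>)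
    also have "\<dots> = (LINT \<tau>|lborel. indicator {..<0} \<tau> *\<^sub>R (LINT s|lborel. F1 s \<tau>))" by simp
    also have "\<dots> = 0"
    proof -
      have "(LINT s|lborel. F1 s \<tau>) = 0" for \<tau>
        by (rule integral_deriv_halfline(2)[where M="\<bar>R\<bar>" and F="\<lambda>s. \<phi> (\<Psi> s \<tau>)"])
          (use ds sec[OF cF1] Fz(3) in auto)
      then show ?thesis by simp
    qed
    finally show ?thesis .
  qed
  finally show ?thesis by (simp add: Q_def)
qed

end

section \<open>The divergence theorem on domains with \<open>C\<^sup>2\<close> boundary\<close>

declare C_k.simps(2) [simp del]

lemma integral_lebesgue_on_open:
  fixes f :: "real^2 \<Rightarrow> complex"
  assumes "open \<Omega>" and f: "f \<in> borel_measurable borel"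
  shows "integrable (lebesgue_on \<Omega>) f \<longleftrightarrow> integrable lborel (\<lambda>x. indicator \<Omega> x *\<^sub>R f x)"
    "(LINT x|lebesgue_on \<Omega>. f x) = (LINT x|lborel. indicator \<Omega> x *\<^sub>R f x)"
proof -
  have [measurable]: "\<Omega> \<in> sets borel" using assms(1) by simp
  note f [measurable]
  have m: "(\<lambda>x. indicator \<Omega> x *\<^sub>R f x) \<in> borel_measurable lborel" by measurable
  have \<Omega>: "\<Omega> \<inter> space lebesgue \<in> sets lebesgue" using assms(1) by simp
  show "integrable (lebesgue_on \<Omega>) f \<longleftrightarrow> integrable lborel (\<lambda>x. indicator \<Omega> x *\<^sub>R f x)"
    using integrable_restrict_space[OF \<Omega>, of f] integrable_completion[OF m] by simp
  show "(LINT x|lebesgue_on \<Omega>. f x) = (LINT x|lborel. indicator \<Omega> x *\<^sub>R f x)"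
    using integral_restrict_space[OF \<Omega>, of f] integral_completion[OF m] by simp
qed

lemma integrable_lebesgue_on_continuous:
  fixes f :: "real^2 \<Rightarrow> complex"
  assumes "open \<Omega>" "bounded \<Omega>" and f: "continuous_on UNIV f"
  shows "integrable (lebesgue_on \<Omega>) f"
proof -
  have fm: "f \<in> borel_measurable borel" using f by (rule borel_measurable_continuous_onI)
  have "integrable lborel (\<lambda>x. indicator (closure \<Omega>) x *\<^sub>R f x)"
    using assms by (intro borel_integrable_compact continuous_on_subset[OF f]) auto
  then have "integrable lborel (\<lambda>x. indicator \<Omega> x *\<^sub>R (indicator (closure \<Omega>) x *\<^sub>R f x))"
    by (rule integrable_mult_indicator[rotated]) (use assms(1) in simp)
  also have "(\<lambda>x. indicator \<Omega> x *\<^sub>R (indicator (closure \<Omega>) x *\<^sub>R f x)) = (\<lambda>x. indicator \<Omega> x *\<^sub>R f x)"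
    using closure_subset[of \<Omega>] by (auto simp: indicator_def fun_eq_iff)
  finally show ?thesis using integral_lebesgue_on_open(1)[OF assms(1) fm] by simp
qed

text \<open>If n had a component orthogonal to N, following that component and moving slightly
  against N would give v with v . N < 0 and v . n > 0. So n is N or -N, and v = -N rules out the
  latter.\<close>

lemma unit_normals_eq:
  fixes n N :: "'a::real_inner"
  assumes n: "norm n = 1" and N: "norm N = 1" and half: "\<And>v. v \<bullet> N < 0 \<Longrightarrow> v \<bullet> n \<le> 0"
  shows "n = N"
proof -
  define c where "c = n \<bullet> N"
  have nn: "n \<bullet> n = 1" "N \<bullet> N = 1" using n N by (auto simp: norm_eq_1)
  have c0: "c \<ge> 0" using half[of "- N"] nn by (simp add: c_def inner_commute)
  have c1: "c \<le> 1" using norm_cauchy_schwarz[of n N] n N by (simp add: c_def)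
  have "1 - c\<^sup>2 \<le> 0"
  proof (rule ccontr)
    assume pos: "\<not> 1 - c\<^sup>2 \<le> 0"
    \<comment> \<open>For v = n - c N - \<delta> N one gets v . N = -\<delta> and v . n = 2 \<delta>
      - \<delta> c, which is at least \<delta> since c is at most 1.\<close>
    define \<delta> where "\<delta> = (1 - c\<^sup>2) / 2"
    have "(n - c *\<^sub>R N - \<delta> *\<^sub>R N) \<bullet> n \<le> 0"
      by (rule half) (use pos nn in \<open>simp add: inner_diff_left c_def \<delta>_def\<close>)
    moreover have "(n - c *\<^sub>R N - \<delta> *\<^sub>R N) \<bullet> n = n \<bullet> n - c * c - \<delta> * c"
      by (simp only: inner_diff_left inner_scaleR_left c_def inner_commute[of N n])
    ultimately have "1 - c\<^sup>2 - \<delta> * c \<le> 0"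
      using nn by (simp add: power2_eq_square)
    moreover have \<delta>: "\<delta> > 0" "1 - c\<^sup>2 = 2 * \<delta>" using pos by (auto simp: \<delta>_def)
    moreover have "\<delta> * c \<le> \<delta>" using c1 \<delta>(1) by (simp add: mult_left_le)
    ultimately show False by linarith
  qed
  then have "c = 1" using c0 c1 by (metis abs_of_nonneg abs_square_less_1 diff_gt_0_iff_gt less_eq_real_def not_le)
  then have "(n - N) \<bullet> (n - N) = 0" using nn by (simp add: inner_diff_left inner_diff_right c_def inner_commute)
  then show ?thesis by simp
qed

context plane_graph
begin

text \<open>The unit vector orthogonal to the tangent e1 + \<gamma>' s e2 that points out of the
  region below the graph.\<close>

definition N :: "real \<Rightarrow> real^2" where "N s = (1 / w s) *\<^sub>R (e2 - \<gamma>' s *\<^sub>R e1)"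

lemma w_nz: "w s \<noteq> 0" using w_pos[of s] by auto

lemma norm_N: "norm (N s) = 1"
proof -
  have "(e2 - \<gamma>' s *\<^sub>R e1) \<bullet> (e2 - \<gamma>' s *\<^sub>R e1) = (w s)\<^sup>2"
    by (simp add: inner_diff_left inner_diff_right w_def power2_eq_square)
  then have "norm (e2 - \<gamma>' s *\<^sub>R e1) = w s"
    using w_pos[of s] by (simp add: norm_eq_sqrt_inner real_sqrt_abs)
  then show ?thesis using w_pos[of s] by (simp add: N_def)
qed

lemma cont_N: "continuous_on S N"
  unfolding N_def using w_nz
  by (intro continuous_intros cont_w continuous_on_subset[OF cont]) auto

end

section \<open>Boundary charts\<close>

locale boundary_chart = plane_graph +
  fixes \<Omega> :: "(real^2) set" and x :: "real^2" and r :: real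
  assumes open_\<Omega>: "open \<Omega>" and r: "r > 0"
    and chart: "\<Omega> \<inter> ball x r = {y \<in> ball x r. y \<bullet> e2 < \<gamma> (y \<bullet> e1)}"
begin

lemma mem_\<Omega>_iff: "y \<in> ball x r \<Longrightarrow> y \<in> \<Omega> \<longleftrightarrow> y \<bullet> e2 < \<gamma> (y \<bullet> e1)"
  using chart by blast

lemma frontier_iff_graph:
  assumes y: "y \<in> ball x r"
  shows "y \<in> frontier \<Omega> \<longleftrightarrow> y \<in> graph"
proof
  assume fr: "y \<in> frontier \<Omega>"
  then have "y \<notin> \<Omega>" using open_\<Omega> by (simp add: frontier_def interior_open)
  then have ge: "\<gamma> (y \<bullet> e1) \<le> y \<bullet> e2" using mem_\<Omega>_iff[OF y] by simp
  have "\<not> \<gamma> (y \<bullet> e1) < y \<bullet> e2"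
  proof
    assume gt: "\<gamma> (y \<bullet> e1) < y \<bullet> e2"
    have "open {y. \<gamma> (y \<bullet> e1) < y \<bullet> e2}"
      by (intro open_Collect_less continuous_intros continuous_on_compose2[OF cont_\<gamma>]) auto
    then have "open (ball x r \<inter> {y. \<gamma> (y \<bullet> e1) < y \<bullet> e2})" by auto
    moreover have "y \<in> closure \<Omega>" using fr by (simp add: frontier_def)
    ultimately obtain z where "z \<in> \<Omega>" "z \<in> ball x r" "\<gamma> (z \<bullet> e1) < z \<bullet> e2"
      using y gt unfolding closure_iff_nhds_not_empty by blast
    then show False using mem_\<Omega>_iff[of z] by simp
  qed
  then show "y \<in> graph" using ge by (simp add: graph_def)
next
  assume g: "y \<in> graph"
  then have "y \<notin> \<Omega>" using mem_\<Omega>_iff[OF y] by (simp add: graph_def)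
  moreover have "y \<in> closure \<Omega>"
    unfolding closure_approachable
  proof (intro allI impI)
    fix e :: real assume e: "e > 0"
    define h where "h = min e (r - dist x y) / 2"
    have h: "h > 0" "h < e" "dist x y + h < r" using e y by (auto simp: h_def min_def field_simps)
    have d: "dist (y - h *\<^sub>R e2) y = h" using h e2 by (simp add: dist_norm)
    then have b: "y - h *\<^sub>R e2 \<in> ball x r"
      using dist_triangle[of x "y - h *\<^sub>R e2" y] h by (simp add: dist_commute)
    moreover have "y - h *\<^sub>R e2 \<in> \<Omega>"
      using mem_\<Omega>_iff[OF b] g h by (simp add: inner_diff_left graph_def)
    ultimately show "\<exists>z\<in>\<Omega>. dist z y < e" using d h by (intro bexI[of _ "y - h *\<^sub>R e2"]) auto
  qed
  ultimately show "y \<in> frontier \<Omega>" using open_\<Omega> by (simp add: frontier_def interior_open)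
qed

text \<open>A direction v with v . N < 0 enters the region below the graph, so y + h v is in
  \<Omega> for small h > 0. If v . n were positive, these points would lie in the outward cone of
  aperture \<epsilon> = (v . n) / (2 |v|), which misses \<Omega> near y.\<close>

lemma outward_normal_eq:
  assumes y: "y \<in> ball x r" "y \<in> frontier \<Omega>" and n: "outward_unit_normal \<Omega> y n"
  shows "n = N (y \<bullet> e1)"
proof (rule unit_normals_eq)
  show "norm n = 1" using n by (simp add: outward_unit_normal_def)
  show "norm (N (y \<bullet> e1)) = 1" by (rule norm_N)
  fix v assume v: "v \<bullet> N (y \<bullet> e1) < 0"
  have yg: "y \<bullet> e2 = \<gamma> (y \<bullet> e1)" using frontier_iff_graph[OF y(1)] y(2) by (simp add: graph_def)
  show "v \<bullet> n \<le> 0"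
  proof (rule ccontr)
    assume "\<not> v \<bullet> n \<le> 0"
    then have vn: "v \<bullet> n > 0" by simp
    then have v0: "v \<noteq> 0" by auto
    define s where "s = y \<bullet> e1"
    have slope: "v \<bullet> e2 < \<gamma>' s * (v \<bullet> e1)"
      using v w_pos[of s] by (simp add: N_def s_def inner_diff_right divide_less_0_iff)
    define f where "f h = \<gamma> (s + h * (v \<bullet> e1)) - (\<gamma> s + h * (v \<bullet> e2))" for h
    have df: "(f has_real_derivative (\<gamma>' s * (v \<bullet> e1) - v \<bullet> e2)) (at 0)"
    proof -
      have "((\<lambda>h. \<gamma> (s + h * (v \<bullet> e1))) has_real_derivative \<gamma>' (s + 0 * (v \<bullet> e1)) * (v \<bullet> e1)) (at 0)"
        by (rule DERIV_chain2[OF der]) (auto intro!: derivative_eq_intros)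
      then show ?thesis unfolding f_def by (auto intro!: derivative_eq_intros)
    qed
    obtain d1 where d1: "d1 > 0" "\<And>h. h > 0 \<Longrightarrow> h < d1 \<Longrightarrow> f 0 < f (0 + h)"
      using DERIV_pos_inc_right[OF df] slope by auto
    define \<epsilon> where "\<epsilon> = (v \<bullet> n) / (2 * norm v)"
    have "\<epsilon> > 0" using vn v0 by (simp add: \<epsilon>_def)
    then have "\<forall>\<^sub>F z in at y. (z - y) \<bullet> n > \<epsilon> * norm (z - y) \<longrightarrow> z \<notin> \<Omega>"
      using n unfolding outward_unit_normal_def by (auto elim: eventually_mono)
    then obtain d2 where d2: "d2 > 0" "\<And>z. z \<noteq> y \<Longrightarrow> dist z y < d2 \<Longrightarrow> (z - y) \<bullet> n > \<epsilon> * norm (z - y) \<Longrightarrow> z \<notin> \<Omega>"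
      unfolding eventually_at by auto
    define d3 where "d3 = min d2 (r - dist x y) / norm v"
    have d3: "d3 > 0" using d2 y(1) v0 by (simp add: d3_def)
    define h where "h = min d1 d3 / 2"
    have h: "h > 0" "h < d1" "h < d3" using d1 d3 by (auto simp: h_def)
    then have hv: "h * norm v < d2" "h * norm v < r - dist x y" using v0 by (auto simp: d3_def field_simps)
    define z where "z = y + h *\<^sub>R v"
    have dzy: "dist z y = h * norm v" using h by (simp add: z_def dist_norm)
    then have zb: "z \<in> ball x r" using hv dist_triangle[of x z y] by (simp add: dist_commute)
    have "z \<bullet> e2 < \<gamma> (z \<bullet> e1)"
      using d1(2)[OF h(1,2)] yg by (simp add: f_def z_def inner_add_left s_def)
    then have "z \<in> \<Omega>" using mem_\<Omega>_iff[OF zb] by simp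
    moreover have "z \<noteq> y" using h v0 by (simp add: z_def)
    moreover have "(z - y) \<bullet> n > \<epsilon> * norm (z - y)"
      using h v0 vn by (simp add: z_def \<epsilon>_def)
    ultimately show False using d2(2)[of z] dzy hv by simp
  qed
qed

text \<open>On the support of \<phi>, \<Omega> is the region below the graph and its frontier is the
  graph. The weight e2 - \<gamma>' e1 of the parameter integral equals w N, so the area formula
  absorbs w and leaves the normal.\<close>

lemma local_divergence:
  fixes \<phi> :: "real^2 \<Rightarrow> complex"
  assumes nu: "\<And>y. y \<in> frontier \<Omega> \<Longrightarrow> outward_unit_normal \<Omega> y (\<nu> y)"
    and \<phi>: "C_k 1 \<phi>" and r': "r' < r" and supp: "\<And>y. y \<notin> cball x r' \<Longrightarrow> \<phi> y = 0"
  shows "(LINT y|lebesgue_on \<Omega>. partial i \<phi> y) = (LINT y|boundary_measure \<Omega>. (\<nu> y $ i) *\<^sub>R \<phi> y)"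
proof -
  have pz: "partial i \<phi> y = 0" if "y \<notin> cball x r'" for y
    by (rule partial_eq_0_of_support[of "cball x r'"]) (use supp that in auto)
  have sub: "cball x r' \<subseteq> ball x r" using r' by auto
  have pm: "partial i \<phi> \<in> borel_measurable borel"
    using C_k_1_partial_continuous[OF \<phi>] by (rule borel_measurable_continuous_onI)
  have \<phi>m [measurable]: "\<phi> \<in> borel_measurable borel"
    using C_k_imp_continuous[OF \<phi>] by (rule borel_measurable_continuous_onI)
  have [measurable]: "N \<in> borel_measurable borel"
    using cont_N by (rule borel_measurable_continuous_onI)
  have "(LINT y|lebesgue_on \<Omega>. partial i \<phi> y) = (LINT y|lborel. indicator \<Omega> y *\<^sub>R partial i \<phi> y)"
    by (rule integral_lebesgue_on_open(2)[OF open_\<Omega> pm])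
  also have "\<dots> = (LINT y|lborel. indicator {y. y \<bullet> e2 < \<gamma> (y \<bullet> e1)} y *\<^sub>R partial i \<phi> y)"
  proof (rule Bochner_Integration.integral_cong[OF refl])
    fix y
    show "indicator \<Omega> y *\<^sub>R partial i \<phi> y = indicator {y. y \<bullet> e2 < \<gamma> (y \<bullet> e1)} y *\<^sub>R partial i \<phi> y"
      using pz[of y] mem_\<Omega>_iff[of y] sub by (cases "y \<in> cball x r'") (auto simp: indicator_def)
  qed
  also have "\<dots> = (LINT s|lborel. (e2$i - \<gamma>' s * e1$i) *\<^sub>R \<phi> (\<Phi> s))"
  proof (rule integral_subgraph_partial[OF \<phi>])
    fix y :: "real^2" assume y: "norm y > norm x + \<bar>r'\<bar>"
    have "norm y \<le> norm x + dist x y" using norm_triangle_ineq2[of y x] by (simp add: dist_norm norm_minus_commute)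
    then show "\<phi> y = 0" using y by (intro supp) auto
  qed
  also have "\<dots> = (LINT s|lborel. w s *\<^sub>R ((N (\<Phi> s \<bullet> e1) $ i) *\<^sub>R \<phi> (\<Phi> s)))"
    using w_nz by (intro Bochner_Integration.integral_cong) (auto simp: N_def)
  also have "\<dots> = (LINT y|restrict_space hausdorff1 graph. (N (y \<bullet> e1) $ i) *\<^sub>R \<phi> y)"
  proof (rule integral_hausdorff1_graph[symmetric])
    have "continuous_on UNIV (\<lambda>y. N (y \<bullet> e1))"
      by (rule continuous_on_compose2[OF cont_N]) (auto intro!: continuous_intros)
    then have "continuous_on UNIV (\<lambda>y. (N (y \<bullet> e1) $ i) *\<^sub>R \<phi> y)"
      by (intro continuous_intros C_k_imp_continuous[OF \<phi>])
    then show "(\<lambda>y. (N (y \<bullet> e1) $ i) *\<^sub>R \<phi> y) \<in> borel_measurable borel"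
      by (rule borel_measurable_continuous_onI)
  qed
  also have "\<dots> = (LINT y|hausdorff1. indicator graph y *\<^sub>R ((N (y \<bullet> e1) $ i) *\<^sub>R \<phi> y))"
    by (rule integral_restrict_space) simp
  also have "\<dots> = (LINT y|hausdorff1. indicator (frontier \<Omega>) y *\<^sub>R ((\<nu> y $ i) *\<^sub>R \<phi> y))"
  proof (rule Bochner_Integration.integral_cong[OF refl])
    fix y
    show "indicator graph y *\<^sub>R ((N (y \<bullet> e1) $ i) *\<^sub>R \<phi> y) = indicator (frontier \<Omega>) y *\<^sub>R ((\<nu> y $ i) *\<^sub>R \<phi> y)"
    proof (cases "y \<in> cball x r'")
      case True
      then have yb: "y \<in> ball x r" using sub by blast
      show ?thesis
        using frontier_iff_graph[OF yb] outward_normal_eq[OF yb _ nu] by (auto simp: indicator_def)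
    qed (simp add: supp)
  qed
  also have "\<dots> = (LINT y|boundary_measure \<Omega>. (\<nu> y $ i) *\<^sub>R \<phi> y)"
    unfolding boundary_measure_def by (rule integral_restrict_space[symmetric]) simp
  finally show ?thesis .
qed

lemma emeasure_frontier_chart_finite:
  assumes "r' < r"
  shows "emeasure hausdorff1 (frontier \<Omega> \<inter> cball x r') < top"
proof -
  have "frontier \<Omega> \<inter> cball x r' \<subseteq> \<Phi> ` {x \<bullet> e1 - r .. x \<bullet> e1 + r}"
  proof
    fix y assume y: "y \<in> frontier \<Omega> \<inter> cball x r'"
    then have yb: "y \<in> ball x r" using assms by auto
    then have "y \<in> graph" using frontier_iff_graph y by blast
    moreover have "\<bar>(x - y) \<bullet> e1\<bar> \<le> norm (x - y)" using Cauchy_Schwarz_ineq2[of "x - y" e1] e1 by simp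
    ultimately show "y \<in> \<Phi> ` {x \<bullet> e1 - r .. x \<bullet> e1 + r}"
      using yb by (intro image_eqI[of _ _ "y \<bullet> e1"]) (auto simp: \<Phi>_proj dist_norm inner_diff_left)
  qed
  then have "emeasure hausdorff1 (frontier \<Omega> \<inter> cball x r') \<le> emeasure hausdorff1 (\<Phi> ` {x \<bullet> e1 - r .. x \<bullet> e1 + r})"
    by (rule emeasure_mono) simp
  then show ?thesis using emeasure_\<Phi>_finite by (rule order_le_less_trans)
qed

end

section \<open>From charts to the whole domain\<close>

lemma C2_domain_boundary_chart:
  assumes "C2_domain \<Omega>" "x \<in> frontier \<Omega>"
  obtains e1 e2 \<gamma> \<gamma>' r where "boundary_chart e1 e2 \<gamma> \<gamma>' \<Omega> x r"
proof -
  obtain r e1 e2 \<gamma> where *: "r > 0" "norm e1 = 1" "norm e2 = 1" "e1 \<bullet> e2 = 0" "C_k 2 (\<gamma> :: real \<Rightarrow> real)"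
      "\<Omega> \<inter> ball x r = {y \<in> ball x r. y \<bullet> e2 < \<gamma> (y \<bullet> e1)}"
    using assms unfolding C2_domain_def by meson
  define \<gamma>' where "\<gamma>' s = frechet_derivative \<gamma> (at s) 1" for s
  have \<gamma>: "C_k (Suc 1) \<gamma>" using * by (simp add: numeral_2_eq_2)
  have "(\<gamma> has_real_derivative \<gamma>' s) (at s)" for s
  proof -
    have D: "(\<gamma> has_derivative frechet_derivative \<gamma> (at s)) (at s)"
      using C_k_Suc_has_derivative[OF \<gamma>] .
    have "frechet_derivative \<gamma> (at s) t = \<gamma>' s * t" for t
      using linear_scale[OF has_derivative_linear[OF D], of t 1] by (simp add: \<gamma>'_def)
    then have "frechet_derivative \<gamma> (at s) = (*) (\<gamma>' s)" by (rule ext)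
    then show ?thesis using D by (simp only: has_field_derivative_def)
  qed
  moreover have "continuous_on UNIV \<gamma>'"
  proof -
    have "C_k 1 \<gamma>'" using \<gamma> unfolding \<gamma>'_def by (simp only: C_k.simps(2)) simp
    then show ?thesis by (rule C_k_imp_continuous)
  qed
  moreover have "open \<Omega>" using assms(1) by (simp add: C2_domain_def)
  ultimately have "boundary_chart e1 e2 \<gamma> \<gamma>' \<Omega> x r"
    using * by unfold_locales blast+
  then show ?thesis by (rule that)
qed

lemma compact_frontier_C2: "C2_domain \<Omega> \<Longrightarrow> compact (frontier \<Omega>)"
  by (simp add: C2_domain_def compact_frontier_bounded)

text \<open>Finitely many charts cover the compact boundary. Finiteness makes square integrable
  boundary data integrable.\<close>

lemma finite_measure_boundary:
  assumes "C2_domain \<Omega>"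
  shows "finite_measure (boundary_measure \<Omega>)"
proof -
  have "\<exists>r. r > 0 \<and> emeasure hausdorff1 (frontier \<Omega> \<inter> cball x r) < top" if x: "x \<in> frontier \<Omega>" for x
  proof -
    obtain e1 e2 \<gamma> \<gamma>' r where c: "boundary_chart e1 e2 \<gamma> \<gamma>' \<Omega> x r" by (rule C2_domain_boundary_chart[OF assms x])
    then interpret boundary_chart e1 e2 \<gamma> \<gamma>' \<Omega> x r .
    show ?thesis using emeasure_frontier_chart_finite[of "r/2"] r by (intro exI[of _ "r/2"] conjI) simp_all
  qed
  then have "\<forall>x\<in>frontier \<Omega>. \<exists>r. r > 0 \<and> emeasure hausdorff1 (frontier \<Omega> \<inter> cball x r) < top" ..
  from bchoice[OF this] obtain r where "\<forall>x\<in>frontier \<Omega>. r x > 0 \<and> emeasure hausdorff1 (frontier \<Omega> \<inter> cball x (r x)) < top" ..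
  then have r: "\<And>x. x \<in> frontier \<Omega> \<Longrightarrow> r x > 0"
      "\<And>x. x \<in> frontier \<Omega> \<Longrightarrow> emeasure hausdorff1 (frontier \<Omega> \<inter> cball x (r x)) < top"
    by auto
  have cov: "frontier \<Omega> \<subseteq> (\<Union>x\<in>frontier \<Omega>. ball x (r x))"
  proof
    fix y assume "y \<in> frontier \<Omega>"
    then show "y \<in> (\<Union>x\<in>frontier \<Omega>. ball x (r x))" using r(1) by (intro UN_I[of y]) auto
  qed
  obtain X where X: "X \<subseteq> frontier \<Omega>" "finite X" "frontier \<Omega> \<subseteq> (\<Union>x\<in>X. ball x (r x))"
    by (rule compactE_image[OF compact_frontier_C2[OF assms] open_ball cov]) (rule that)
  have "emeasure hausdorff1 (frontier \<Omega>) \<le> emeasure hausdorff1 (\<Union>x\<in>X. frontier \<Omega> \<inter> cball x (r x))"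
  proof (rule emeasure_mono)
    show "frontier \<Omega> \<subseteq> (\<Union>x\<in>X. frontier \<Omega> \<inter> cball x (r x))"
      using X(3) ball_subset_cball by blast
    show "(\<Union>x\<in>X. frontier \<Omega> \<inter> cball x (r x)) \<in> sets hausdorff1"
      using X(2) by (intro sets.finite_UN) simp_all
  qed
  also have "\<dots> \<le> (\<Sum>x\<in>X. emeasure hausdorff1 (frontier \<Omega> \<inter> cball x (r x)))"
    by (rule emeasure_subadditive_finite) (use X in auto)
  also have "\<dots> < top" using r(2) X(1,2) by (subst ennreal_sum_less_top) (auto simp: subset_iff)
  finally show ?thesis
    unfolding boundary_measure_def
    by (intro finite_measureI) (simp add: emeasure_restrict_space space_restrict_space less_top)
qed

text \<open>Near each boundary point \<nu> is N of a chart coordinate. Continuity makes \<nu> an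
  admissible weight in boundary integrals.\<close>

lemma normal_continuous_on:
  assumes \<Omega>: "C2_domain \<Omega>" and nu: "\<And>y. y \<in> frontier \<Omega> \<Longrightarrow> outward_unit_normal \<Omega> y (\<nu> y)"
  shows "continuous_on (frontier \<Omega>) \<nu>"
  unfolding continuous_on_eq_continuous_within
proof
  fix x assume x: "x \<in> frontier \<Omega>"
  obtain e1 e2 \<gamma> \<gamma>' r where "boundary_chart e1 e2 \<gamma> \<gamma>' \<Omega> x r" by (rule C2_domain_boundary_chart[OF \<Omega> x])
  then interpret boundary_chart e1 e2 \<gamma> \<gamma>' \<Omega> x r .
  have "continuous_on UNIV (\<lambda>y. N (y \<bullet> e1))"
    by (rule continuous_on_compose2[OF cont_N]) (auto intro!: continuous_intros)
  then have "continuous (at x within frontier \<Omega>) (\<lambda>y. N (y \<bullet> e1))"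
    by (simp add: continuous_on_eq_continuous_at continuous_at_imp_continuous_within)
  then show "continuous (at x within frontier \<Omega>) \<nu>"
  proof (rule continuous_transform_within[OF _ r x])
    fix y assume "y \<in> frontier \<Omega>" "dist y x < r"
    then show "N (y \<bullet> e1) = \<nu> y" using outward_normal_eq[OF _ _ nu, of y] by (simp add: dist_commute)
  qed
qed

lemma integrable_boundary_normal:
  fixes f :: "real^2 \<Rightarrow> complex"
  assumes \<Omega>: "C2_domain \<Omega>" and nu: "\<And>y. y \<in> frontier \<Omega> \<Longrightarrow> outward_unit_normal \<Omega> y (\<nu> y)"
    and f: "continuous_on UNIV f"
  shows "(\<lambda>y. (\<nu> y $ i) *\<^sub>R f y) \<in> borel_measurable (boundary_measure \<Omega>)"
    "integrable (boundary_measure \<Omega>) (\<lambda>y. (\<nu> y $ i) *\<^sub>R f y)"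
proof -
  interpret finite_measure "boundary_measure \<Omega>" by (rule finite_measure_boundary[OF \<Omega>])
  have c: "continuous_on (frontier \<Omega>) (\<lambda>y. (\<nu> y $ i) *\<^sub>R f y)"
    by (intro continuous_intros normal_continuous_on[OF \<Omega> nu] continuous_on_subset[OF f]) auto
  have s: "sets (boundary_measure \<Omega>) = sets (restrict_space borel (frontier \<Omega>))"
    unfolding boundary_measure_def by (intro sets_restrict_space_cong) simp
  have "(\<lambda>y. (\<nu> y $ i) *\<^sub>R f y) \<in> borel_measurable (restrict_space borel (frontier \<Omega>))"
    by (rule borel_measurable_continuous_on_restrict[OF c])
  then show m: "(\<lambda>y. (\<nu> y $ i) *\<^sub>R f y) \<in> borel_measurable (boundary_measure \<Omega>)"
    using measurable_cong_sets[OF s refl] by blast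
  have "bounded ((\<lambda>y. (\<nu> y $ i) *\<^sub>R f y) ` frontier \<Omega>)"
    by (intro compact_imp_bounded compact_continuous_image c compact_frontier_C2[OF \<Omega>])
  then obtain B where "\<And>y. y \<in> frontier \<Omega> \<Longrightarrow> norm ((\<nu> y $ i) *\<^sub>R f y) \<le> B"
    unfolding bounded_iff by blast
  then show "integrable (boundary_measure \<Omega>) (\<lambda>y. (\<nu> y $ i) *\<^sub>R f y)"
    by (intro integrable_const_bound[where B=B] m)
      (auto simp: boundary_measure_def space_restrict_space intro!: AE_I2)
qed

text \<open>Take the graph of a constant lying above the support: the boundary values vanish and the
  region below it contains the support.\<close>

lemma integral_UNIV_partial:
  fixes \<phi> :: "real^2 \<Rightarrow> complex"
  assumes \<phi>: "C_k 1 \<phi>" and supp: "\<And>y. norm y > R \<Longrightarrow> \<phi> y = 0"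
  shows "(LINT y|lborel. partial i \<phi> y) = 0"
proof -
  define c where "c = \<bar>R\<bar> + 1"
  interpret plane_graph "axis 1 1" "axis 2 1" "\<lambda>_. c" "\<lambda>_. 0"
    by unfold_locales (auto simp: inner_axis_axis)
  have pz: "partial i \<phi> y = 0" if "norm y > R" for y
    by (rule partial_eq_0_of_support[of "cball 0 R"]) (use supp that in auto)
  have "\<phi> (\<Phi> s) = 0" for s
  proof (rule supp)
    have "\<bar>\<Phi> s \<bullet> axis 2 1\<bar> \<le> norm (\<Phi> s)" using Cauchy_Schwarz_ineq2[of "\<Phi> s" "axis 2 1"] by simp
    moreover have "\<Phi> s \<bullet> axis 2 1 = c" by (rule \<Phi>_inner(2))
    ultimately show "R < norm (\<Phi> s)" unfolding c_def by linarith
  qed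
  then have "(LINT y|lborel. indicator {y. y \<bullet> axis 2 1 < c} y *\<^sub>R partial i \<phi> y) = 0"
    using integral_subgraph_partial[OF \<phi> supp, where i=i] by simp
  moreover have "indicator {y. y \<bullet> axis 2 1 < c} y *\<^sub>R partial i \<phi> y = partial i \<phi> y" for y
  proof (cases "norm y > R")
    case False
    have "\<bar>y \<bullet> axis 2 1\<bar> \<le> norm y" using Cauchy_Schwarz_ineq2[of y "axis 2 1"] by simp
    then have "y \<bullet> axis 2 1 < c" using False unfolding c_def by linarith
    then show ?thesis by simp
  qed (simp add: pz)
  ultimately show ?thesis by simp
qed

lemma interior_divergence:
  fixes \<phi> :: "real^2 \<Rightarrow> complex"
  assumes \<Omega>: "open \<Omega>" and \<phi>: "C_k 1 \<phi>" and r': "cball x r' \<subseteq> \<Omega>" and supp: "\<And>y. y \<notin> cball x r' \<Longrightarrow> \<phi> y = 0"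
  shows "(LINT y|lebesgue_on \<Omega>. partial i \<phi> y) = (LINT y|boundary_measure \<Omega>. (\<nu> y $ i) *\<^sub>R \<phi> y)"
proof -
  have pz: "partial i \<phi> y = 0" if "y \<notin> cball x r'" for y
    by (rule partial_eq_0_of_support[of "cball x r'"]) (use supp that in auto)
  have pm: "partial i \<phi> \<in> borel_measurable borel"
    using C_k_1_partial_continuous[OF \<phi>] by (rule borel_measurable_continuous_onI)
  have "(LINT y|lebesgue_on \<Omega>. partial i \<phi> y) = (LINT y|lborel. indicator \<Omega> y *\<^sub>R partial i \<phi> y)"
    by (rule integral_lebesgue_on_open(2)[OF \<Omega> pm])
  also have "\<dots> = (LINT y|lborel. partial i \<phi> y)"
  proof (rule Bochner_Integration.integral_cong[OF refl])
    fix y show "indicator \<Omega> y *\<^sub>R partial i \<phi> y = partial i \<phi> y"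
      using pz[of y] r' by (cases "y \<in> cball x r'") (auto simp: indicator_def)
  qed
  also have "\<dots> = 0"
  proof (rule integral_UNIV_partial[OF \<phi>])
    fix y :: "real^2" assume y: "norm y > norm x + \<bar>r'\<bar>"
    have "norm y \<le> norm x + dist x y" using norm_triangle_ineq2[of y x] by (simp add: dist_norm norm_minus_commute)
    then show "\<phi> y = 0" using y by (intro supp) auto
  qed
  also have "0 = (LINT y|boundary_measure \<Omega>. (\<nu> y $ i) *\<^sub>R \<phi> y)"
  proof -
    have "\<phi> y = 0" if "y \<in> space (boundary_measure \<Omega>)" for y
    proof -
      have "y \<in> frontier \<Omega>" using that by (simp add: boundary_measure_def space_restrict_space)
      then have "y \<notin> \<Omega>" using \<Omega> by (simp add: frontier_def interior_open)
      then show ?thesis using supp r' by blast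
    qed
    then show ?thesis by (simp cong: Bochner_Integration.integral_cong)
  qed
  finally show ?thesis .
qed

text \<open>
  In place of a partition of unity, the factor \<open>1 - (\<Prod>c\<in>X. 1 - bump c (r c))\<close> is built up one
  bump at a time; each step adds a function supported in a single chart.
\<close>

theorem divergence_C2_domain:
  fixes \<phi> :: "real^2 \<Rightarrow> complex"
  assumes \<Omega>: "C2_domain \<Omega>" and nu: "\<And>y. y \<in> frontier \<Omega> \<Longrightarrow> outward_unit_normal \<Omega> y (\<nu> y)"
    and \<phi>: "C_k 1 \<phi>"
  shows "(LINT y|lebesgue_on \<Omega>. partial i \<phi> y) = (LINT y|boundary_measure \<Omega>. (\<nu> y $ i) *\<^sub>R \<phi> y)"
proof -
  have op: "open \<Omega>" and bd: "bounded \<Omega>" using \<Omega> by (auto simp: C2_domain_def)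
  define G where "G \<phi> \<longleftrightarrow> (LINT y|lebesgue_on \<Omega>. partial i \<phi> y) = (LINT y|boundary_measure \<Omega>. (\<nu> y $ i) *\<^sub>R \<phi> y)" for \<phi> :: "real^2 \<Rightarrow> complex"
  have G_add: "G (\<lambda>x. f x + g x)" if f: "C_k 1 f" "G f" and g: "C_k 1 g" "G g" for f g
  proof -
    have "partial i (\<lambda>x. f x + g x) y = partial i f y + partial i g y" for y
      unfolding partial_def[of i f] partial_def[of i g]
      by (rule partial_eqI[OF has_derivative_add]) (use f(1) g(1) in \<open>auto intro!: C_k_Suc_has_derivative\<close>)
    then have "(LINT y|lebesgue_on \<Omega>. partial i (\<lambda>x. f x + g x) y) = (LINT y|lebesgue_on \<Omega>. partial i f y + partial i g y)"
      by simp
    also have "\<dots> = (LINT y|lebesgue_on \<Omega>. partial i f y) + (LINT y|lebesgue_on \<Omega>. partial i g y)"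
      by (intro Bochner_Integration.integral_add integrable_lebesgue_on_continuous[OF op bd] C_k_1_partial_continuous f g)
    also have "\<dots> = (LINT y|boundary_measure \<Omega>. (\<nu> y $ i) *\<^sub>R f y) + (LINT y|boundary_measure \<Omega>. (\<nu> y $ i) *\<^sub>R g y)"
      using f(2) g(2) by (simp add: G_def)
    also have "\<dots> = (LINT y|boundary_measure \<Omega>. (\<nu> y $ i) *\<^sub>R f y + (\<nu> y $ i) *\<^sub>R g y)"
      by (intro Bochner_Integration.integral_add[symmetric] integrable_boundary_normal(2)[OF \<Omega> nu] C_k_imp_continuous[OF f(1)] C_k_imp_continuous[OF g(1)])
    finally show ?thesis by (simp add: G_def scaleR_add_right)
  qed
  have "\<exists>r. r > 0 \<and> (\<forall>\<phi>. C_k 1 \<phi> \<longrightarrow> (\<forall>y. y \<notin> ball x (2 * r) \<longrightarrow> \<phi> y = 0) \<longrightarrow> G \<phi>)" if x: "x \<in> closure \<Omega>" for x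
  proof (cases "x \<in> \<Omega>")
    case True
    then obtain e where e: "e > 0" "cball x e \<subseteq> \<Omega>" using op unfolding open_contains_cball by blast
    have "G \<phi>" if \<phi>: "C_k 1 \<phi>" and z: "\<forall>y. y \<notin> ball x (2 * (e/2)) \<longrightarrow> \<phi> y = 0" for \<phi>
      unfolding G_def by (rule interior_divergence[OF op \<phi> e(2)]) (use z in auto)
    then show ?thesis using e(1) by (intro exI[of _ "e/2"]) auto
  next
    case False
    then have "x \<in> frontier \<Omega>" using x op by (simp add: frontier_def interior_open)
    then obtain e1 e2 \<gamma> \<gamma>' r where "boundary_chart e1 e2 \<gamma> \<gamma>' \<Omega> x r" by (rule C2_domain_boundary_chart[OF \<Omega>])
    then interpret boundary_chart e1 e2 \<gamma> \<gamma>' \<Omega> x r .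
    have "G \<phi>" if \<phi>: "C_k 1 \<phi>" and z: "\<forall>y. y \<notin> ball x (2 * (r/4)) \<longrightarrow> \<phi> y = 0" for \<phi>
      unfolding G_def by (rule local_divergence[OF nu \<phi>, where r'="r/2"]) (use z r in auto)
    then show ?thesis using r by (intro exI[of _ "r/4"]) auto
  qed
  then have "\<forall>x\<in>closure \<Omega>. \<exists>r. r > 0 \<and> (\<forall>\<phi>. C_k 1 \<phi> \<longrightarrow> (\<forall>y. y \<notin> ball x (2 * r) \<longrightarrow> \<phi> y = 0) \<longrightarrow> G \<phi>)" ..
  from bchoice[OF this] obtain r where r0: "\<forall>x\<in>closure \<Omega>. r x > 0 \<and>
      (\<forall>\<phi>. C_k 1 \<phi> \<longrightarrow> (\<forall>y. y \<notin> ball x (2 * r x) \<longrightarrow> \<phi> y = 0) \<longrightarrow> G \<phi>)" ..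
  have r: "\<And>x. x \<in> closure \<Omega> \<Longrightarrow> r x > 0"
    "\<And>x \<phi>. x \<in> closure \<Omega> \<Longrightarrow> C_k 1 \<phi> \<Longrightarrow> (\<And>y. y \<notin> ball x (2 * r x) \<Longrightarrow> \<phi> y = 0) \<Longrightarrow> G \<phi>"
    using r0 by blast+
  have comp: "compact (closure \<Omega>)" using bd by simp
  have cov: "closure \<Omega> \<subseteq> (\<Union>x\<in>closure \<Omega>. ball x (r x))"
  proof
    fix y assume "y \<in> closure \<Omega>"
    then show "y \<in> (\<Union>x\<in>closure \<Omega>. ball x (r x))" using r(1) by (intro UN_I[of y]) auto
  qed
  obtain X where X: "X \<subseteq> closure \<Omega>" "finite X" "closure \<Omega> \<subseteq> (\<Union>x\<in>X. ball x (r x))"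
    by (rule compactE_image[OF comp open_ball cov]) (rule that)
  define P where "P X y = (\<Prod>c\<in>X. 1 - bump c (r c) y)" for X y
  have P: "C_k 1 (P X)" for X
    unfolding P_def[abs_def] by (intro C_k_diff C_k_const C_k_prod C_infD[OF C_inf_bump])
  have "G (\<lambda>y. (1 - P X y) *\<^sub>R \<phi> y)" using X(2,1)
  proof (induction X rule: finite_induct)
    case empty
    have "G (\<lambda>y. 0)" using r(2)[OF _ C_k_const, of _ 0]
      by (simp add: G_def partial_def frechet_derivative_const)
    then show ?case by (simp add: P_def)
  next
    case (insert c X)
    have c: "c \<in> closure \<Omega>" using insert by simp
    \<comment> \<open>The increment comes from 1 - P (insert c X) = (1 - P X) + bump * P X, with the
      bump centred at c.\<close>
    have "G (\<lambda>y. (bump c (r c) y * P X y) *\<^sub>R \<phi> y)"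
    proof (rule r(2)[OF c])
      show "C_k 1 (\<lambda>y. (bump c (r c) y * P X y) *\<^sub>R \<phi> y)"
        by (intro C_k_scaleR C_k_mult P \<phi> C_infD[OF C_inf_bump])
    qed (simp add: bump_eq_0[OF r(1)[OF c]])
    then have "G (\<lambda>y. (1 - P X y) *\<^sub>R \<phi> y + (bump c (r c) y * P X y) *\<^sub>R \<phi> y)"
      using insert by (intro G_add C_k_scaleR C_k_mult C_k_diff C_k_const P \<phi> C_infD[OF C_inf_bump]) auto
    also have "(\<lambda>y. (1 - P X y) *\<^sub>R \<phi> y + (bump c (r c) y * P X y) *\<^sub>R \<phi> y) = (\<lambda>y. (1 - P (insert c X) y) *\<^sub>R \<phi> y)"
      using insert by (auto simp: P_def fun_eq_iff algebra_simps)
    finally show ?case .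
  qed
  \<comment> \<open>Every point of the closure lies in a chosen ball, where one factor of P X is 0.
    So the remainder contributes nothing on the boundary, and since \<Omega> is open its derivatives
    vanish inside too.\<close>
  moreover have "G (\<lambda>y. P X y *\<^sub>R \<phi> y)"
  proof -
    have z: "P X y *\<^sub>R \<phi> y = 0" if y: "y \<in> closure \<Omega>" for y
    proof -
      obtain c where c: "c \<in> X" "y \<in> ball c (r c)" using X(3) y by blast
      then have "bump c (r c) y = 1" using r(1) X by (intro bump_eq_1) auto
      then have "P X y = 0" unfolding P_def using X c by (auto intro!: bexI[of _ c])
      then show ?thesis by simp
    qed
    have "partial i (\<lambda>y. P X y *\<^sub>R \<phi> y) y = 0" if "y \<in> \<Omega>" for y
      by (rule partial_eq_0_of_support[of "- \<Omega>"]) (use z op that closure_subset in auto)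
    then have "(LINT y|lebesgue_on \<Omega>. partial i (\<lambda>y. P X y *\<^sub>R \<phi> y) y) = (LINT y|lebesgue_on \<Omega>. 0)"
      by (intro Bochner_Integration.integral_cong) simp_all
    then have "(LINT y|lebesgue_on \<Omega>. partial i (\<lambda>y. P X y *\<^sub>R \<phi> y) y) = 0" by simp
    moreover have "(LINT y|boundary_measure \<Omega>. (\<nu> y $ i) *\<^sub>R (P X y *\<^sub>R \<phi> y)) = 0"
    proof -
      have "(\<nu> y $ i) *\<^sub>R (P X y *\<^sub>R \<phi> y) = 0" if "y \<in> space (boundary_measure \<Omega>)" for y
      proof -
        have "y \<in> closure \<Omega>" using that by (simp add: boundary_measure_def space_restrict_space frontier_def)
        then show ?thesis using z by simp
      qed
      then have "(LINT y|boundary_measure \<Omega>. (\<nu> y $ i) *\<^sub>R (P X y *\<^sub>R \<phi> y)) = (LINT y|boundary_measure \<Omega>. 0)"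
        by (intro Bochner_Integration.integral_cong) simp_all
      then show ?thesis by simp
    qed
    ultimately show ?thesis by (simp add: G_def)
  qed
  ultimately have "G (\<lambda>y. (1 - P X y) *\<^sub>R \<phi> y + P X y *\<^sub>R \<phi> y)"
    by (intro G_add C_k_scaleR C_k_diff C_k_const P \<phi>)
  then show ?thesis by (simp add: G_def scaleR_diff_left)
qed

section \<open>Traces and Green's formula\<close>

lemma in_L2_integrable:
  assumes "finite_measure M" "in_L2 M f" and h: "h \<in> borel_measurable M" "\<And>x. x \<in> space M \<Longrightarrow> cmod (h x) \<le> B"
  shows "integrable M (\<lambda>x. f x * h x)"
proof -
  interpret finite_measure M by fact
  have f: "f \<in> borel_measurable M" "integrable M (\<lambda>x. (cmod (f x))\<^sup>2)" using assms(2) by (auto simp: in_L2_def)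
  have "integrable M (\<lambda>x. (1 + (cmod (f x))\<^sup>2) * \<bar>B\<bar>)" using f by (intro integrable_mult_left Bochner_Integration.integrable_add) auto
  then show ?thesis
  proof (rule Bochner_Integration.integrable_bound)
    show "(\<lambda>x. f x * h x) \<in> borel_measurable M" using f h by measurable
    show "AE x in M. norm (f x * h x) \<le> norm ((1 + (cmod (f x))\<^sup>2) * \<bar>B\<bar>)"
    proof (rule AE_I2)
      fix x assume x: "x \<in> space M"
      have "0 \<le> (cmod (f x) - 1)\<^sup>2" by simp
      then have "2 * cmod (f x) \<le> 1 + (cmod (f x))\<^sup>2" by (simp add: power2_eq_square algebra_simps)
      then have "cmod (f x) \<le> 1 + (cmod (f x))\<^sup>2" using norm_ge_zero[of "f x"] by linarith
      then have "cmod (f x) * cmod (h x) \<le> (1 + (cmod (f x))\<^sup>2) * \<bar>B\<bar>"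
        using h(2)[OF x] by (intro mult_mono) auto
      then show "norm (f x * h x) \<le> norm ((1 + (cmod (f x))\<^sup>2) * \<bar>B\<bar>)"
        by (simp add: norm_mult)
    qed
  qed
qed

text \<open>Young's inequality with a free \<epsilon> plays the part of Cauchy-Schwarz: the error is
  at most C \<epsilon> \<mu> plus C / \<epsilon> times the squared distance. First \<epsilon> is
  fixed, then m is taken large.\<close>

lemma converges_L2_tendsto_integral:
  assumes M: "finite_measure M" and conv: "converges_L2 M F f" and f: "in_L2 M f"
    and F: "\<And>m. F m \<in> borel_measurable M" "\<And>m. integrable M (\<lambda>x. F m x * h x)"
    and h: "h \<in> borel_measurable M" "\<And>x. x \<in> space M \<Longrightarrow> cmod (h x) \<le> B"
  shows "(\<lambda>m. LINT x|M. F m x * h x) \<longlonglongrightarrow> (LINT x|M. f x * h x)"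
proof -
  interpret finite_measure M by (rule M)
  define \<mu> where "\<mu> = measure M (space M)"
  define C where "C = \<bar>B\<bar> + 1"
  have C: "C > 0" "\<And>x. x \<in> space M \<Longrightarrow> cmod (h x) \<le> C"
    using h(2) by (auto simp: C_def) (smt (verit) h(2))
  have [measurable]: "f \<in> borel_measurable M" "h \<in> borel_measurable M" "\<And>m. F m \<in> borel_measurable M"
    using f h F by (auto simp: in_L2_def)
  have fh: "integrable M (\<lambda>x. f x * h x)" by (rule in_L2_integrable[OF M f h])
  have bound: "cmod ((LINT x|M. F m x * h x) - (LINT x|M. f x * h x)) \<le> C * \<epsilon> * \<mu> + C / \<epsilon> * \<delta>"
    if \<epsilon>: "\<epsilon> > 0" and \<delta>: "\<delta> \<ge> 0" "(\<integral>\<^sup>+x. ennreal ((cmod (F m x - f x))\<^sup>2) \<partial>M) \<le> ennreal \<delta>" for m \<epsilon> \<delta>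
  proof -
    have "ennreal (cmod ((LINT x|M. F m x * h x) - (LINT x|M. f x * h x))) = ennreal (cmod (LINT x|M. F m x * h x - f x * h x))"
      using F(2) fh by simp
    also have "\<dots> \<le> (\<integral>\<^sup>+x. ennreal (cmod (F m x * h x - f x * h x)) \<partial>M)"
      using F(2) fh by (intro integral_norm_bound_ennreal) auto
    also have "\<dots> \<le> (\<integral>\<^sup>+x. ennreal (C * \<epsilon>) + ennreal (C / \<epsilon>) * ennreal ((cmod (F m x - f x))\<^sup>2) \<partial>M)"
    proof (rule nn_integral_mono)
      fix x assume x: "x \<in> space M"
      define a where "a = cmod (F m x - f x)"
      \<comment> \<open>Young's inequality \<open>a \<le> \<epsilon> + a\<^sup>2 / \<epsilon>\<close>\<close>
      have "0 \<le> (a - \<epsilon>)\<^sup>2" by simp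
      then have "2 * a * \<epsilon> \<le> \<epsilon> * \<epsilon> + a\<^sup>2" by (simp add: power2_eq_square algebra_simps)
      moreover have "0 \<le> a * \<epsilon>" using \<epsilon> by (simp add: a_def)
      ultimately have "a * \<epsilon> \<le> \<epsilon> * \<epsilon> + a\<^sup>2" by linarith
      then have "a \<le> \<epsilon> + a\<^sup>2 / \<epsilon>" using \<epsilon> by (simp add: field_simps)
      then have "C * a \<le> C * \<epsilon> + C / \<epsilon> * a\<^sup>2"
        using mult_left_mono[of a "\<epsilon> + a\<^sup>2 / \<epsilon>" C] C by (simp add: algebra_simps)
      moreover have "F m x * h x - f x * h x = h x * (F m x - f x)" by (simp add: algebra_simps)
      then have "cmod (F m x * h x - f x * h x) \<le> C * a"
        using mult_right_mono[OF C(2)[OF x], of a] by (simp add: a_def norm_mult)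
      ultimately have "cmod (F m x * h x - f x * h x) \<le> C * \<epsilon> + C / \<epsilon> * a\<^sup>2" by linarith
      then show "ennreal (cmod (F m x * h x - f x * h x)) \<le> ennreal (C * \<epsilon>) + ennreal (C / \<epsilon>) * ennreal ((cmod (F m x - f x))\<^sup>2)"
        using C \<epsilon> by (simp add: a_def ennreal_leI flip: ennreal_mult' ennreal_plus)
    qed
    also have "\<dots> = ennreal (C * \<epsilon>) * emeasure M (space M) + ennreal (C / \<epsilon>) * (\<integral>\<^sup>+x. ennreal ((cmod (F m x - f x))\<^sup>2) \<partial>M)"
      by (simp add: nn_integral_add nn_integral_cmult)
    also have "\<dots> \<le> ennreal (C * \<epsilon>) * ennreal \<mu> + ennreal (C / \<epsilon>) * ennreal \<delta>"
      using \<delta> by (intro add_mono mult_left_mono) (auto simp: \<mu>_def emeasure_eq_measure)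
    also have "\<dots> = ennreal (C * \<epsilon> * \<mu> + C / \<epsilon> * \<delta>)"
      using C \<epsilon> \<delta> by (simp add: \<mu>_def flip: ennreal_mult' ennreal_plus)
    finally show ?thesis
      using C \<epsilon> \<delta> by (subst (asm) ennreal_le_iff) (auto simp: \<mu>_def)
  qed
  show ?thesis
    unfolding tendsto_iff
  proof (intro allI impI)
    fix e :: real assume e: "e > 0"
    \<comment> \<open>Chosen so that the first error term is at most e/4; \<mu> + 1 avoids division
      by 0. The \<delta> below makes the second term equal to e/4.\<close>
    define \<epsilon> where "\<epsilon> = e / (4 * C * (\<mu> + 1))"
    have \<mu>: "\<mu> \<ge> 0" by (simp add: \<mu>_def)
    have \<epsilon>: "\<epsilon> > 0" using e C \<mu> by (simp add: \<epsilon>_def)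
    define \<delta> where "\<delta> = e * \<epsilon> / (4 * C)"
    have \<delta>: "\<delta> > 0" using e \<epsilon> C by (simp add: \<delta>_def)
    have "C * \<epsilon> * \<mu> \<le> C * \<epsilon> * (\<mu> + 1)" using C \<epsilon> by (intro mult_left_mono) auto
    also have "\<dots> = e / 4"
    proof -
      have "C * (e / (4 * C * q)) * q = e / 4" if "q > 0" for q using that C by (simp add: field_simps)
      then show ?thesis unfolding \<epsilon>_def using \<mu> by simp
    qed
    finally have 1: "C * \<epsilon> * \<mu> \<le> e / 4" .
    have 2: "C / \<epsilon> * \<delta> = e / 4" using C \<epsilon> by (simp add: \<delta>_def)
    have "0 < ennreal \<delta>" using \<delta> ennreal_less_iff[of 0 \<delta>] by simp
    then have "\<forall>\<^sub>F m in sequentially. (\<integral>\<^sup>+x. ennreal ((cmod (F m x - f x))\<^sup>2) \<partial>M) < ennreal \<delta>"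
      using conv unfolding converges_L2_def by (intro order_tendstoD(2))
    then show "\<forall>\<^sub>F m in sequentially. dist (LINT x|M. F m x * h x) (LINT x|M. f x * h x) < e"
    proof eventually_elim
      case (elim m)
      then show ?case
        using bound[OF \<epsilon> less_imp_le[OF \<delta>] less_imp_le[OF elim]] 1 2 e unfolding dist_norm by linarith
    qed
  qed
qed

lemma borel_measurable_lebesgue_on_continuous:
  fixes f :: "real^2 \<Rightarrow> complex"
  assumes "continuous_on UNIV f"
  shows "f \<in> borel_measurable (lebesgue_on \<Omega>)"
proof -
  have "f \<in> borel_measurable borel" using assms by (rule borel_measurable_continuous_onI)
  then have "f \<in> borel_measurable lebesgue" by (intro measurable_completion) simp
  then show ?thesis by (rule measurable_restrict_space1)
qed

lemma borel_measurable_boundary_continuous: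
  fixes f :: "real^2 \<Rightarrow> complex"
  assumes "continuous_on UNIV f"
  shows "f \<in> borel_measurable (boundary_measure \<Omega>)"
  unfolding boundary_measure_def
  using borel_measurable_continuous_onI[OF assms]
  by (intro measurable_restrict_space1) (simp cong: measurable_cong_sets)

lemma finite_measure_lebesgue_on_bounded:
  "open \<Omega> \<Longrightarrow> bounded \<Omega> \<Longrightarrow> finite_measure (lebesgue_on (\<Omega> :: (real^2) set))"
  by (intro finite_measure_lebesgue_on lmeasurable_open)

lemma continuous_bounded_on_closure:
  fixes f :: "real^2 \<Rightarrow> complex"
  assumes "bounded \<Omega>" "continuous_on (closure \<Omega>) f"
  obtains B where "\<And>x. x \<in> closure \<Omega> \<Longrightarrow> cmod (f x) \<le> B"
proof -
  have "bounded (f ` closure \<Omega>)"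
    using assms by (intro compact_imp_bounded compact_continuous_image) auto
  then show ?thesis using that unfolding bounded_iff by blast
qed

text \<open>Apply the divergence theorem to the products F m * \<psi>. After the product rule each
  integral pairs an L2-convergent sequence with a fixed bounded function, so the identity passes to
  the limit. The gradient W is the one hidden in the definition of the trace, which is why it is
  obtained and not prescribed.\<close>

lemma trace_divergence:
  assumes \<Omega>: "C2_domain \<Omega>" and nu: "\<And>y. y \<in> frontier \<Omega> \<Longrightarrow> outward_unit_normal \<Omega> y (\<nu> y)"
    and tr: "boundary_trace \<Omega> w T"
  obtains W where "\<And>i. weak_partial \<Omega> i w (W i)" "\<And>i. in_L2 (lebesgue_on \<Omega>) (W i)"
    "\<And>i \<psi>. C_inf \<psi> \<Longrightarrow> integrable (boundary_measure \<Omega>) (\<lambda>y. T y * (of_real (\<nu> y $ i) * \<psi> y))"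
    "\<And>i \<psi>. C_inf \<psi> \<Longrightarrow> (LINT y|boundary_measure \<Omega>. T y * (of_real (\<nu> y $ i) * \<psi> y))
       = (LINT y|lebesgue_on \<Omega>. w y * partial i \<psi> y) + (LINT y|lebesgue_on \<Omega>. W i y * \<psi> y)"
proof -
  have op: "open \<Omega>" and bd: "bounded \<Omega>" using \<Omega> by (auto simp: C2_domain_def)
  obtain W F where W: "\<And>i. weak_partial \<Omega> i w (W i)" "\<And>i. in_L2 (lebesgue_on \<Omega>) (W i)"
    and F: "\<And>m. C_inf (F m)" and c: "converges_L2 (lebesgue_on \<Omega>) F w"
      "\<And>i. converges_L2 (lebesgue_on \<Omega>) (\<lambda>m. partial i (F m)) (W i)" "converges_L2 (boundary_measure \<Omega>) F T"
    using tr unfolding boundary_trace_def by blast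
  have L2: "in_L2 (lebesgue_on \<Omega>) w" "in_L2 (boundary_measure \<Omega>) T" using tr by (auto simp: boundary_trace_def)
  note fin = finite_measure_lebesgue_on_bounded[OF op bd] finite_measure_boundary[OF \<Omega>]
  have cont: "continuous_on S f" if "C_inf f" for f :: "real^2 \<Rightarrow> complex" and S
    using C_k_imp_continuous[OF C_infD[OF that, of 0]] .
  note meas = borel_measurable_lebesgue_on_continuous[OF cont] borel_measurable_boundary_continuous[OF cont]
  have *: "integrable (boundary_measure \<Omega>) (\<lambda>y. T y * (of_real (\<nu> y $ i) * \<psi> y)) \<and>
     (LINT y|boundary_measure \<Omega>. T y * (of_real (\<nu> y $ i) * \<psi> y))
       = (LINT y|lebesgue_on \<Omega>. w y * partial i \<psi> y) + (LINT y|lebesgue_on \<Omega>. W i y * \<psi> y)" if \<psi>: "C_inf \<psi>" for i \<psi>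
  proof -
    have p\<psi>: "C_inf (partial i \<psi>)" using \<psi> by (rule C_inf_partial)
    obtain B1 where B1: "\<And>x. x \<in> closure \<Omega> \<Longrightarrow> cmod (\<psi> x) \<le> B1"
      by (rule continuous_bounded_on_closure[OF bd cont[OF \<psi>]]) (rule that)
    obtain B2 where B2: "\<And>x. x \<in> closure \<Omega> \<Longrightarrow> cmod (partial i \<psi> x) \<le> B2"
      by (rule continuous_bounded_on_closure[OF bd cont[OF p\<psi>]]) (rule that)
    have cl: "x \<in> closure \<Omega>" if "x \<in> space (lebesgue_on \<Omega>)" for x
      using that closure_subset by auto
    have clb: "x \<in> closure \<Omega>" "x \<in> frontier \<Omega>" if "x \<in> space (boundary_measure \<Omega>)" for x
      using that by (auto simp: boundary_measure_def space_restrict_space frontier_def)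
    have prod: "C_inf (\<lambda>x. F m x * \<psi> x)" for m
      using F \<psi> by (auto simp: C_inf_def intro!: C_k_mult)
    have lim1: "(\<lambda>m. LINT y|lebesgue_on \<Omega>. F m y * partial i \<psi> y) \<longlonglongrightarrow> (LINT y|lebesgue_on \<Omega>. w y * partial i \<psi> y)"
      by (rule converges_L2_tendsto_integral[OF fin(1) c(1) L2(1), where B=B2])
        (use B2 cl in \<open>auto intro!: meas F p\<psi> integrable_lebesgue_on_continuous op bd continuous_on_mult[OF cont cont]\<close>)
    have lim2: "(\<lambda>m. LINT y|lebesgue_on \<Omega>. partial i (F m) y * \<psi> y) \<longlonglongrightarrow> (LINT y|lebesgue_on \<Omega>. W i y * \<psi> y)"
      by (rule converges_L2_tendsto_integral[OF fin(1) c(2) W(2), where B=B1])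
        (use B1 cl in \<open>auto intro!: meas F \<psi> C_inf_partial integrable_lebesgue_on_continuous op bd continuous_on_mult[OF cont cont]\<close>)
    have hb: "(\<lambda>y. of_real (\<nu> y $ i) * \<psi> y) \<in> borel_measurable (boundary_measure \<Omega>)"
      using integrable_boundary_normal(1)[OF \<Omega> nu cont[OF \<psi>], of i] by (simp add: scaleR_conv_of_real)
    have hB: "cmod (of_real (\<nu> y $ i) * \<psi> y) \<le> B1" if "y \<in> space (boundary_measure \<Omega>)" for y
    proof -
      have "\<bar>\<nu> y $ i\<bar> \<le> norm (\<nu> y)" by (rule component_le_norm_cart)
      also have "\<dots> = 1" using nu[OF clb(2)[OF that]] by (simp add: outward_unit_normal_def)
      finally have "\<bar>\<nu> y $ i\<bar> * cmod (\<psi> y) \<le> 1 * B1"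
        using B1[OF clb(1)[OF that]] by (intro mult_mono) auto
      then show ?thesis by (simp add: norm_mult)
    qed
    have intb: "integrable (boundary_measure \<Omega>) (\<lambda>y. F m y * (of_real (\<nu> y $ i) * \<psi> y))" for m
      using integrable_boundary_normal(2)[OF \<Omega> nu cont[OF prod], of i m]
      by (simp add: scaleR_conv_of_real mult_ac)
    have lim3: "(\<lambda>m. LINT y|boundary_measure \<Omega>. F m y * (of_real (\<nu> y $ i) * \<psi> y)) \<longlonglongrightarrow> (LINT y|boundary_measure \<Omega>. T y * (of_real (\<nu> y $ i) * \<psi> y))"
      by (rule converges_L2_tendsto_integral[OF fin(2) c(3) L2(2) _ intb hb hB]) (auto intro!: meas F)
    have eq: "(LINT y|boundary_measure \<Omega>. F m y * (of_real (\<nu> y $ i) * \<psi> y)) =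
      (LINT y|lebesgue_on \<Omega>. F m y * partial i \<psi> y) + (LINT y|lebesgue_on \<Omega>. partial i (F m) y * \<psi> y)" for m
    proof -
      have "partial i (\<lambda>x. F m x * \<psi> x) y = F m y * partial i \<psi> y + partial i (F m) y * \<psi> y" for y
        by (rule partial_bilinear[OF bounded_bilinear_mult])
          (use C_infD[OF F, of "Suc 0"] C_infD[OF \<psi>, of "Suc 0"] in \<open>auto simp: C_k.simps(2)\<close>)
      moreover have "(LINT y|lebesgue_on \<Omega>. partial i (\<lambda>x. F m x * \<psi> x) y) = (LINT y|boundary_measure \<Omega>. (\<nu> y $ i) *\<^sub>R (F m y * \<psi> y))"
        by (rule divergence_C2_domain[OF \<Omega> nu C_infD[OF prod]])
      moreover have "(LINT y|lebesgue_on \<Omega>. F m y * partial i \<psi> y + partial i (F m) y * \<psi> y) = 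
        (LINT y|lebesgue_on \<Omega>. F m y * partial i \<psi> y) + (LINT y|lebesgue_on \<Omega>. partial i (F m) y * \<psi> y)"
        by (intro Bochner_Integration.integral_add integrable_lebesgue_on_continuous op bd continuous_on_mult[OF cont cont] F \<psi> C_inf_partial)
      ultimately show ?thesis by (simp add: scaleR_conv_of_real mult_ac)
    qed
    have "(\<lambda>m. LINT y|boundary_measure \<Omega>. F m y * (of_real (\<nu> y $ i) * \<psi> y)) \<longlonglongrightarrow>
       (LINT y|lebesgue_on \<Omega>. w y * partial i \<psi> y) + (LINT y|lebesgue_on \<Omega>. W i y * \<psi> y)"
      unfolding eq by (intro tendsto_add lim1 lim2)
    then have "(LINT y|boundary_measure \<Omega>. T y * (of_real (\<nu> y $ i) * \<psi> y))
       = (LINT y|lebesgue_on \<Omega>. w y * partial i \<psi> y) + (LINT y|lebesgue_on \<Omega>. W i y * \<psi> y)"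
      using lim3 LIMSEQ_unique by blast
    moreover have "integrable (boundary_measure \<Omega>) (\<lambda>y. T y * (of_real (\<nu> y $ i) * \<psi> y))"
      by (rule in_L2_integrable[OF fin(2) L2(2) hb hB])
    ultimately show ?thesis by blast
  qed
  show ?thesis by (rule that[of W]) (use W * in auto)
qed

section \<open>Test functions and weak derivatives\<close>

lemma test_function_mult:
  assumes \<zeta>: "test_function \<Omega> \<zeta>" and h: "C_inf h"
  shows "test_function \<Omega> (\<lambda>x. \<zeta> x * h x)"
proof -
  have "C_inf (\<lambda>x. \<zeta> x * h x)"
    using assms by (auto simp: test_function_def C_inf_def intro!: C_k_mult)
  moreover have sub: "closure {x. \<zeta> x * h x \<noteq> 0} \<subseteq> closure {x. \<zeta> x \<noteq> 0}"
    by (rule closure_mono) auto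
  moreover have "compact (closure {x. \<zeta> x * h x \<noteq> 0})"
    using closed_Int_compact[of "closure {x. \<zeta> x * h x \<noteq> 0}" "closure {x. \<zeta> x \<noteq> 0}"] sub \<zeta>
    by (simp add: inf.absorb1 test_function_def)
  ultimately show ?thesis using \<zeta> by (auto simp: test_function_def)
qed

lemma test_function_partial:
  assumes \<zeta>: "test_function \<Omega> \<zeta>"
  shows "test_function \<Omega> (partial i \<zeta>)"
proof -
  have "partial i \<zeta> x = 0" if "x \<notin> closure {x. \<zeta> x \<noteq> 0}" for x
    by (rule partial_eq_0_of_support[OF closed_closure _ that]) (use closure_subset in force)
  then have sub: "closure {x. partial i \<zeta> x \<noteq> 0} \<subseteq> closure {x. \<zeta> x \<noteq> 0}"
    by (intro closure_minimal) auto
  moreover have "compact (closure {x. partial i \<zeta> x \<noteq> 0})"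
    using closed_Int_compact[of "closure {x. partial i \<zeta> x \<noteq> 0}" "closure {x. \<zeta> x \<noteq> 0}"] sub \<zeta>
    by (simp add: inf.absorb1 test_function_def)
  ultimately show ?thesis using \<zeta> C_inf_partial by (auto simp: test_function_def)
qed

text \<open>\<zeta> is bounded and supported in a compact subset of \<Omega>, where local
  integrability gives an integrable majorant.\<close>

lemma test_function_integrable:
  assumes op: "open \<Omega>" and V: "locally_integrable \<Omega> V" and \<zeta>: "test_function \<Omega> \<zeta>"
  shows "integrable (lebesgue_on \<Omega>) (\<lambda>x. \<zeta> x *\<^sub>R V x)"
proof -
  define K where "K = closure {x. \<zeta> x \<noteq> 0}"
  have K: "compact K" "K \<subseteq> \<Omega>" using \<zeta> by (auto simp: K_def test_function_def)
  have zK: "\<zeta> x = 0" if "x \<notin> K" for x using that closure_subset by (force simp: K_def)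
  have cont: "continuous_on S \<zeta>" for S
    using C_k_imp_continuous[OF C_infD[of \<zeta> 0], of S] \<zeta> by (simp only: test_function_def simp_thms)
  have "K \<in> sets borel" using K(1) borel_compact by blast
  then have Kl: "K \<in> sets lebesgue" by simp
  have "integrable (lebesgue_on K) V" using V K by (auto simp: locally_integrable_def)
  then have i: "integrable lebesgue (\<lambda>x. indicator K x *\<^sub>R V x)"
    using Kl by (simp add: integrable_restrict_space)
  have "bounded (\<zeta> ` K)" by (intro compact_imp_bounded compact_continuous_image cont K)
  then obtain B where B: "\<And>x. x \<in> K \<Longrightarrow> \<bar>\<zeta> x\<bar> \<le> B" unfolding bounded_iff real_norm_def by blast
  have "integrable lebesgue (\<lambda>x. \<zeta> x *\<^sub>R (indicator K x *\<^sub>R V x))"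
  proof (rule Bochner_Integration.integrable_bound)
    show "integrable lebesgue (\<lambda>x. B *\<^sub>R (indicator K x *\<^sub>R V x))" using i by (intro integrable_scaleR_right)
    have "\<zeta> \<in> borel_measurable lebesgue"
      by (intro measurable_completion) (use borel_measurable_continuous_onI[OF cont] in simp)
    then show "(\<lambda>x. \<zeta> x *\<^sub>R (indicator K x *\<^sub>R V x)) \<in> borel_measurable lebesgue"
      by (rule borel_measurable_scaleR[OF _ borel_measurable_integrable[OF i]])
    show "AE x in lebesgue. norm (\<zeta> x *\<^sub>R (indicator K x *\<^sub>R V x)) \<le> norm (B *\<^sub>R (indicator K x *\<^sub>R V x))"
    proof (rule AE_I2)
      fix x
      show "norm (\<zeta> x *\<^sub>R (indicator K x *\<^sub>R V x)) \<le> norm (B *\<^sub>R (indicator K x *\<^sub>R V x))"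
        using B[of x] by (cases "x \<in> K") (auto intro!: mult_right_mono)
    qed
  qed
  also have "(\<lambda>x. \<zeta> x *\<^sub>R (indicator K x *\<^sub>R V x)) = (\<lambda>x. indicator \<Omega> x *\<^sub>R (\<zeta> x *\<^sub>R V x))"
    using zK K(2) by (auto simp: indicator_def fun_eq_iff)
  finally show ?thesis using op by (simp add: integrable_restrict_space)
qed

text \<open>
  With this lemma different weak derivatives of one function can be exchanged in integrals against
  functions that are smooth up to the boundary.
\<close>

lemma weak_annihilation:
  fixes a \<psi> :: "real^2 \<Rightarrow> complex"
  assumes op: "open \<Omega>" and bd: "bounded \<Omega>" and ne: "\<Omega> \<noteq> {}" and a: "integrable (lebesgue_on \<Omega>) a"
    and ann: "\<And>\<phi>. test_function \<Omega> \<phi> \<Longrightarrow> (LINT x|lebesgue_on \<Omega>. \<phi> x *\<^sub>R a x) = 0"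
    and \<psi>: "C_inf \<psi>"
  shows "(LINT x|lebesgue_on \<Omega>. a x * \<psi> x) = 0"
proof -
  obtain \<zeta> where \<zeta>: "\<And>j. test_function \<Omega> (\<zeta> j)" "\<And>j x. \<bar>\<zeta> j x\<bar> \<le> 1" "\<And>x. x \<in> \<Omega> \<Longrightarrow> (\<lambda>j. \<zeta> j x) \<longlonglongrightarrow> 1"
    by (rule C_inf_cutoffs[OF op ne]) (rule that)
  have cont: "continuous_on S \<psi>" for S using C_k_imp_continuous[OF C_infD[OF \<psi>, of 0]] .
  obtain B where B: "\<And>x. x \<in> closure \<Omega> \<Longrightarrow> cmod (\<psi> x) \<le> B"
    by (rule continuous_bounded_on_closure[OF bd cont]) (rule that)
  have \<psi>m: "\<psi> \<in> borel_measurable (lebesgue_on \<Omega>)" by (rule borel_measurable_lebesgue_on_continuous[OF cont])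
  have a\<psi>: "integrable (lebesgue_on \<Omega>) (\<lambda>x. a x * \<psi> x)"
  proof (rule Bochner_Integration.integrable_bound)
    show "integrable (lebesgue_on \<Omega>) (\<lambda>x. B * norm (a x))" using a by auto
    show "(\<lambda>x. a x * \<psi> x) \<in> borel_measurable (lebesgue_on \<Omega>)" using a \<psi>m by auto
    show "AE x in lebesgue_on \<Omega>. norm (a x * \<psi> x) \<le> norm (B * norm (a x))"
    proof (rule AE_I2)
      fix x assume "x \<in> space (lebesgue_on \<Omega>)"
      then have "x \<in> closure \<Omega>" using closure_subset by auto
      then have "cmod (a x) * cmod (\<psi> x) \<le> cmod (a x) * \<bar>B\<bar>" using B[of x] by (intro mult_left_mono) auto
      then show "norm (a x * \<psi> x) \<le> norm (B * norm (a x))" by (simp add: norm_mult abs_mult mult.commute)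
    qed
  qed
  \<comment> \<open>Test functions are real valued, so the complex \<psi> is handled through its
    real and imaginary parts.\<close>
  have test: "test_function \<Omega> (\<lambda>x. \<zeta> j x * Re (\<psi> x))" "test_function \<Omega> (\<lambda>x. \<zeta> j x * Im (\<psi> x))" for j
    using \<psi> by (auto intro!: test_function_mult \<zeta> simp: C_inf_def C_k_linear_compose[OF bounded_linear_Re] C_k_linear_compose[OF bounded_linear_Im])
  have cutoff: "(LINT x|lebesgue_on \<Omega>. \<zeta> j x *\<^sub>R (a x * \<psi> x)) = 0" for j
  proof -
    have i: "integrable (lebesgue_on \<Omega>) (\<lambda>x. \<phi> x *\<^sub>R a x)" if "test_function \<Omega> \<phi>" for \<phi>
    proof (rule test_function_integrable[OF op _ that])
      show "locally_integrable \<Omega> a" unfolding locally_integrable_def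
      proof (intro allI impI)
        fix K assume K: "compact K \<and> K \<subseteq> \<Omega>"
        then have "K \<in> sets borel" using borel_compact by blast
        then have Kl: "K \<in> sets lebesgue" by simp
        have "integrable lebesgue (\<lambda>x. indicator \<Omega> x *\<^sub>R a x)" using a op by (simp add: integrable_restrict_space)
        then have "integrable lebesgue (\<lambda>x. indicator K x *\<^sub>R (indicator \<Omega> x *\<^sub>R a x))"
          by (rule integrable_mult_indicator[OF Kl])
        also have "(\<lambda>x. indicator K x *\<^sub>R (indicator \<Omega> x *\<^sub>R a x)) = (\<lambda>x. indicator K x *\<^sub>R a x)"
          using K by (auto simp: indicator_def fun_eq_iff)
        finally show "integrable (lebesgue_on K) a" using Kl by (simp add: integrable_restrict_space)
      qed
    qed
    have "(LINT x|lebesgue_on \<Omega>. \<zeta> j x *\<^sub>R (a x * \<psi> x)) =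
      (LINT x|lebesgue_on \<Omega>. (\<zeta> j x * Re (\<psi> x)) *\<^sub>R a x + \<i> * ((\<zeta> j x * Im (\<psi> x)) *\<^sub>R a x))"
      by (intro Bochner_Integration.integral_cong) (auto simp: complex_eq_iff algebra_simps)
    also have "\<dots> = (LINT x|lebesgue_on \<Omega>. (\<zeta> j x * Re (\<psi> x)) *\<^sub>R a x) + \<i> * (LINT x|lebesgue_on \<Omega>. (\<zeta> j x * Im (\<psi> x)) *\<^sub>R a x)"
      using i[OF test(1)] i[OF test(2)] by (subst Bochner_Integration.integral_add) (auto simp del: mult_scaleR_right)
    also have "\<dots> = 0" using ann[OF test(1)] ann[OF test(2)] by simp
    finally show ?thesis .
  qed
  \<comment> \<open>All these integrals are 0, and the cutoffs tend to 1 on \<Omega>; dominated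
    convergence removes them although \<psi> need not vanish at the boundary.\<close>
  have "(\<lambda>j. LINT x|lebesgue_on \<Omega>. \<zeta> j x *\<^sub>R (a x * \<psi> x)) \<longlonglongrightarrow> (LINT x|lebesgue_on \<Omega>. a x * \<psi> x)"
  proof (rule integral_dominated_convergence[where w="\<lambda>x. norm (a x * \<psi> x)"])
    show "(\<lambda>x. a x * \<psi> x) \<in> borel_measurable (lebesgue_on \<Omega>)" using a\<psi> by auto
    show "integrable (lebesgue_on \<Omega>) (\<lambda>x. norm (a x * \<psi> x))" using a\<psi> by (rule integrable_norm)
    show "(\<lambda>x. \<zeta> j x *\<^sub>R (a x * \<psi> x)) \<in> borel_measurable (lebesgue_on \<Omega>)" for j
    proof (rule borel_measurable_scaleR)
      have "continuous_on UNIV (\<zeta> j)"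
        using C_k_imp_continuous[OF C_infD[of "\<zeta> j" 0], of UNIV] \<zeta>(1)[of j] by (simp only: test_function_def simp_thms)
      then have "\<zeta> j \<in> borel_measurable lebesgue"
        by (intro measurable_completion) (use borel_measurable_continuous_onI in simp)
      then show "\<zeta> j \<in> borel_measurable (lebesgue_on \<Omega>)" by (rule measurable_restrict_space1)
    qed (use a\<psi> in auto)
    show "AE x in lebesgue_on \<Omega>. (\<lambda>j. \<zeta> j x *\<^sub>R (a x * \<psi> x)) \<longlonglongrightarrow> a x * \<psi> x"
    proof (rule AE_I2)
      fix x assume "x \<in> space (lebesgue_on \<Omega>)"
      then have "(\<lambda>j. \<zeta> j x *\<^sub>R (a x * \<psi> x)) \<longlonglongrightarrow> 1 *\<^sub>R (a x * \<psi> x)"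
        using \<zeta>(3) by (intro tendsto_scaleR tendsto_const) auto
      then show "(\<lambda>j. \<zeta> j x *\<^sub>R (a x * \<psi> x)) \<longlonglongrightarrow> a x * \<psi> x" by simp
    qed
    show "AE x in lebesgue_on \<Omega>. norm (\<zeta> j x *\<^sub>R (a x * \<psi> x)) \<le> norm (a x * \<psi> x)" for j
      using \<zeta>(2)[of j] by (intro AE_I2) (auto simp: mult_left_le_one_le)
  qed
  then show ?thesis unfolding cutoff by (simp add: LIMSEQ_const_iff)
qed

section \<open>Exponential solutions\<close>

lemma C_k_exp_linear:
  fixes L :: "'a::euclidean_space \<Rightarrow> complex"
  assumes L: "bounded_linear L"
  shows "C_k n (\<lambda>x. exp (L x))"
proof (induction n)
  case 0
  show ?case by (simp, intro continuous_on_exp linear_continuous_on L)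
next
  case (Suc n)
  show ?case
  proof (rule C_k_SucI[where D="\<lambda>x h. exp (L x) * L h"])
    have "(exp has_derivative (*) (exp z)) (at z)" for z :: complex
      using DERIV_exp[of z] by (simp add: has_field_derivative_def)
    then show "((\<lambda>x. exp (L x)) has_derivative (\<lambda>h. exp (L x) * L h)) (at x)" for x
      using has_derivative_compose[OF bounded_linear_imp_has_derivative[OF L]] by blast
  qed (intro C_k_mult Suc C_k_const)
qed

lemma exp_solution_linear:
  "bounded_linear (\<lambda>x::real^2. Complex (\<tau> * (x \<bullet> \<omega>)) (s * (x \<bullet> \<omega>')))"
  unfolding linear_conv_bounded_linear[symmetric]
  by (rule linearI) (auto simp: inner_add_left algebra_simps complex_eq_iff)

lemma exp_solution_smooth: "C_inf (exp_solution k \<omega> \<tau>)"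
  unfolding C_inf_def exp_solution_def[abs_def]
  by (intro allI C_k_exp_linear exp_solution_linear)

text \<open>The components of the complex vector z for which \<open>exp_solution\<close> is exp (x .
  z).\<close>

definition exp_dir :: "real \<Rightarrow> real^2 \<Rightarrow> real \<Rightarrow> 2 \<Rightarrow> complex" where
  "exp_dir k \<omega> \<tau> i = Complex (\<tau> * \<omega> $ i) (sqrt (\<tau>\<^sup>2 + k\<^sup>2) * perp \<omega> $ i)"

lemma partial_exp_solution: "partial i (exp_solution k \<omega> \<tau>) = (\<lambda>x. exp_dir k \<omega> \<tau> i * exp_solution k \<omega> \<tau> x)"
proof
  fix x
  let ?L = "\<lambda>x. Complex (\<tau> * (x \<bullet> \<omega>)) (sqrt (\<tau>\<^sup>2 + k\<^sup>2) * (x \<bullet> perp \<omega>))"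
  have "(exp has_derivative (*) (exp z)) (at z)" for z :: complex
    using DERIV_exp[of z] by (simp add: has_field_derivative_def)
  then have "((\<lambda>x. exp (?L x)) has_derivative (\<lambda>h. exp (?L x) * ?L h)) (at x)"
    using has_derivative_compose[OF bounded_linear_imp_has_derivative[OF exp_solution_linear]] by blast
  then have "partial i (\<lambda>x. exp (?L x)) x = exp (?L x) * ?L (axis i 1)" by (rule partial_eqI)
  then show "partial i (exp_solution k \<omega> \<tau>) x = exp_dir k \<omega> \<tau> i * exp_solution k \<omega> \<tau> x"
    by (simp add: exp_solution_def[abs_def] exp_dir_def inner_axis' mult.commute)
qed

text \<open>The bilinear square of z is \<tau>^2 - (\<tau>^2 + k^2), because \<omega> and its
  rotation are orthonormal. This is the Helmholtz equation for exp (x . z).\<close>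

lemma exp_dir_squares:
  assumes "norm \<omega> = 1"
  shows "(\<Sum>i\<in>UNIV. exp_dir k \<omega> \<tau> i * exp_dir k \<omega> \<tau> i) = - of_real (k\<^sup>2)"
proof -
  define a b s where "a = \<omega>$1" "b = \<omega>$2" "s = sqrt (\<tau>\<^sup>2 + k\<^sup>2)"
  have ab: "a * a + b * b = 1" using assms by (simp add: norm_eq_1 inner_real2 a_b_s_def)
  have ss: "s * s = \<tau>\<^sup>2 + k\<^sup>2" by (simp add: a_b_s_def)
  have "\<tau> * \<tau> * (a * a + b * b) - s * s * (a * a + b * b) = - k\<^sup>2"
    unfolding ab ss by (simp add: power2_eq_square)
  then show ?thesis
    by (simp add: sum_2 exp_dir_def perp_def complex_eq_iff flip: a_b_s_def) (simp add: algebra_simps)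
qed

section \<open>Green's formula for the indicator function\<close>

lemma integrable_coefficient_mult:
  fixes D :: "(real^2) set"
  assumes D: "open D" "bounded D" and rho: "in_Linf D \<rho>" and u: "continuous_on (closure D) u"
  shows "integrable (lebesgue_on D) (\<lambda>x. \<rho> x * u x)"
proof -
  obtain B where B: "\<And>x. x \<in> closure D \<Longrightarrow> cmod (u x) \<le> B"
    by (rule continuous_bounded_on_closure[OF D(2) u]) (rule that)
  obtain C where C: "AE x in lebesgue_on D. cmod (\<rho> x) \<le> C" and \<rho>m: "\<rho> \<in> borel_measurable (lebesgue_on D)"
    using rho unfolding in_Linf_def by blast
  have um: "u \<in> borel_measurable (lebesgue_on D)"
    using D(1) closure_subset by (intro continuous_imp_measurable_on_sets_lebesgue continuous_on_subset[OF u]) auto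
  interpret finite_measure "lebesgue_on D" by (rule finite_measure_lebesgue_on_bounded[OF D])
  show ?thesis
  proof (rule integrable_const_bound[where B="\<bar>C\<bar> * \<bar>B\<bar>"])
    show "AE x in lebesgue_on D. norm (\<rho> x * u x) \<le> \<bar>C\<bar> * \<bar>B\<bar>"
      using C AE_space
    proof eventually_elim
      case (elim x)
      then have "x \<in> closure D" using closure_subset by auto
      then have "cmod (\<rho> x) * cmod (u x) \<le> \<bar>C\<bar> * \<bar>B\<bar>" using elim(1) B[of x] by (intro mult_mono) auto
      then show ?case by (simp add: norm_mult)
    qed
  qed (use \<rho>m um in auto)
qed

lemma lebesgue_on_indicator:
  fixes h :: "real^2 \<Rightarrow> complex"
  assumes "open D" "open \<Omega>" "D \<subseteq> \<Omega>"
  shows "integrable (lebesgue_on \<Omega>) (\<lambda>x. indicator D x * h x) \<longleftrightarrow> integrable (lebesgue_on D) h"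
    "(LINT x|lebesgue_on \<Omega>. indicator D x * h x) = (LINT x|lebesgue_on D. h x)"
proof -
  have eq: "(\<lambda>x. indicator \<Omega> x *\<^sub>R (indicator D x * h x)) = (\<lambda>x. indicator D x *\<^sub>R h x)"
    using assms(3) by (auto simp: indicator_def fun_eq_iff)
  show "integrable (lebesgue_on \<Omega>) (\<lambda>x. indicator D x * h x) \<longleftrightarrow> integrable (lebesgue_on D) h"
    using assms by (simp add: integrable_restrict_space eq)
  show "(LINT x|lebesgue_on \<Omega>. indicator D x * h x) = (LINT x|lebesgue_on D. h x)"
    using assms by (simp add: integral_restrict_space eq)
qed

lemma frechet_derivative_exp_solution:
  "frechet_derivative (exp_solution k \<omega> \<tau>) (at x) v = (\<Sum>i\<in>UNIV. of_real (v $ i) * partial i (exp_solution k \<omega> \<tau>) x)"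
  using frechet_derivative_at[OF dderiv_has_derivative[OF C_infD[OF exp_solution_smooth]], of k \<omega> \<tau> x]
  by (metis (no_types, lifting) dderiv_def scaleR_conv_of_real sum_2)

text \<open>Three weak gradients of u occur: U from the normal derivative, W from the trace of u, U'
  from the equation. The second derivatives Z come from the traces of the U i. Integrating by parts
  twice leaves the integral of (Z 1 + Z 2) v against that of u times the Laplacian of v, once U and
  W have been identified against the derivatives of v and Z has been identified with the Laplacian
  of the equation.\<close>

lemma enclosure_indicator_eq:
  assumes \<Omega>: "C2_domain \<Omega>" and nu: "\<And>y. y \<in> frontier \<Omega> \<Longrightarrow> outward_unit_normal \<Omega> y (\<nu> y)"
    and D: "open D" "closure D \<subseteq> \<Omega>" and rho: "in_Linf D \<rho>"
    and sol: "strong_solution \<Omega> k (\<lambda>x. 1 + indicator D x * \<rho> x) u" and uc: "continuous_on (closure \<Omega>) u"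
    and tr: "boundary_trace \<Omega> u f" and nd: "normal_derivative \<Omega> \<nu> u g" and \<omega>: "norm \<omega> = 1"
  shows "enclosure_indicator \<Omega> \<nu> k \<omega> f g \<tau>
    = - of_real (k\<^sup>2) * (LINT x|lebesgue_on D. \<rho> x * u x * exp_solution k \<omega> \<tau> x)"
proof -
  have op: "open \<Omega>" and bd: "bounded \<Omega>" and ne: "\<Omega> \<noteq> {}" using \<Omega> by (auto simp: C2_domain_def)
  have D\<Omega>: "D \<subseteq> \<Omega>" using D(2) closure_subset by blast
  define v where "v = exp_solution k \<omega> \<tau>"
  define c where "c = exp_dir k \<omega> \<tau>"
  have v: "C_inf v" unfolding v_def by (rule exp_solution_smooth)
  have pv: "partial i v = (\<lambda>x. c i * v x)" for i unfolding v_def c_def by (rule partial_exp_solution)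
  have ppv: "partial i (partial i v) = (\<lambda>x. c i * c i * v x)" for i
  proof
    fix x
    have "partial i (\<lambda>x. c i * v x) x = c i * partial i v x"
      by (rule partial_linear[OF bounded_linear_mult_right]) (use C_infD[OF v, of "Suc 0"] in \<open>auto simp: C_k.simps(2)\<close>)
    then show "partial i (partial i v) x = c i * c i * v x" by (simp add: pv)
  qed
  have cc: "(\<Sum>i\<in>UNIV. c i * c i) = - of_real (k\<^sup>2)" unfolding c_def by (rule exp_dir_squares[OF \<omega>])
  have cont: "continuous_on S h" if "C_inf h" for h :: "real^2 \<Rightarrow> complex" and S
    using C_k_imp_continuous[OF C_infD[OF that, of 0]] .
  note fin = finite_measure_lebesgue_on_bounded[OF op bd]
  have L2i: "integrable (lebesgue_on \<Omega>) (\<lambda>x. h x * \<psi> x)" if h: "in_L2 (lebesgue_on \<Omega>) h" and \<psi>: "C_inf \<psi>" for h \<psi>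
  proof -
    obtain B where B: "\<And>x. x \<in> closure \<Omega> \<Longrightarrow> cmod (\<psi> x) \<le> B"
      by (rule continuous_bounded_on_closure[OF bd cont[OF \<psi>]]) (rule that)
    show ?thesis
      by (rule in_L2_integrable[OF fin h borel_measurable_lebesgue_on_continuous[OF cont[OF \<psi>]], of B])
        (use B closure_subset in auto)
  qed
  have one: "C_inf (\<lambda>x. 1 :: complex)" by (simp add: C_inf_def C_k_const)
  have L21: "integrable (lebesgue_on \<Omega>) h" if h: "in_L2 (lebesgue_on \<Omega>) h" for h
    using L2i[OF h one] by simp
  obtain U G where U: "\<And>i. weak_partial \<Omega> i u (U i)" and G: "\<And>i. boundary_trace \<Omega> (U i) (G i)"
    and gG: "AE x in boundary_measure \<Omega>. g x = (\<Sum>i\<in>UNIV. of_real (\<nu> x $ i) * G i x)"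
    and g: "in_L2 (boundary_measure \<Omega>) g"
    using nd unfolding normal_derivative_def by blast
  obtain W where W: "\<And>i. weak_partial \<Omega> i u (W i)" "\<And>i. in_L2 (lebesgue_on \<Omega>) (W i)"
    "\<And>i \<psi>. C_inf \<psi> \<Longrightarrow> integrable (boundary_measure \<Omega>) (\<lambda>y. f y * (of_real (\<nu> y $ i) * \<psi> y))"
    "\<And>i \<psi>. C_inf \<psi> \<Longrightarrow> (LINT y|boundary_measure \<Omega>. f y * (of_real (\<nu> y $ i) * \<psi> y))
       = (LINT y|lebesgue_on \<Omega>. u y * partial i \<psi> y) + (LINT y|lebesgue_on \<Omega>. W i y * \<psi> y)"
    by (rule trace_divergence[OF \<Omega> nu tr]) (assumption, rule that)
  have "\<forall>i. \<exists>Z. weak_partial \<Omega> i (U i) Z \<and> in_L2 (lebesgue_on \<Omega>) Z \<and>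
     integrable (boundary_measure \<Omega>) (\<lambda>y. G i y * (of_real (\<nu> y $ i) * v y)) \<and>
     (LINT y|boundary_measure \<Omega>. G i y * (of_real (\<nu> y $ i) * v y))
       = (LINT y|lebesgue_on \<Omega>. U i y * partial i v y) + (LINT y|lebesgue_on \<Omega>. Z y * v y)"
  proof
    fix i
    obtain Z where Z: "\<And>j. weak_partial \<Omega> j (U i) (Z j)" "\<And>j. in_L2 (lebesgue_on \<Omega>) (Z j)"
    "\<And>j \<psi>. C_inf \<psi> \<Longrightarrow> integrable (boundary_measure \<Omega>) (\<lambda>y. G i y * (of_real (\<nu> y $ j) * \<psi> y))"
    "\<And>j \<psi>. C_inf \<psi> \<Longrightarrow> (LINT y|boundary_measure \<Omega>. G i y * (of_real (\<nu> y $ j) * \<psi> y))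
       = (LINT y|lebesgue_on \<Omega>. U i y * partial j \<psi> y) + (LINT y|lebesgue_on \<Omega>. Z j y * \<psi> y)"
      by (rule trace_divergence[OF \<Omega> nu G[of i]]) (assumption, rule that)
    show "\<exists>Z. weak_partial \<Omega> i (U i) Z \<and> in_L2 (lebesgue_on \<Omega>) Z \<and>
     integrable (boundary_measure \<Omega>) (\<lambda>y. G i y * (of_real (\<nu> y $ i) * v y)) \<and>
     (LINT y|boundary_measure \<Omega>. G i y * (of_real (\<nu> y $ i) * v y))
       = (LINT y|lebesgue_on \<Omega>. U i y * partial i v y) + (LINT y|lebesgue_on \<Omega>. Z y * v y)"
      by (intro exI[of _ "Z i"] conjI Z v)
  qed
  from choice[OF this] obtain Z where Z: "\<forall>i. weak_partial \<Omega> i (U i) (Z i) \<and> in_L2 (lebesgue_on \<Omega>) (Z i) \<and>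
     integrable (boundary_measure \<Omega>) (\<lambda>y. G i y * (of_real (\<nu> y $ i) * v y)) \<and>
     (LINT y|boundary_measure \<Omega>. G i y * (of_real (\<nu> y $ i) * v y))
       = (LINT y|lebesgue_on \<Omega>. U i y * partial i v y) + (LINT y|lebesgue_on \<Omega>. Z i y * v y)" ..
  have UL2: "in_L2 (lebesgue_on \<Omega>) (U i)" for i using G[of i] by (simp add: boundary_trace_def)
  have uL2: "in_L2 (lebesgue_on \<Omega>) u" using tr by (simp add: boundary_trace_def)
  \<comment> \<open>Both are weak derivatives of u, so their difference is annihilated by test
    functions and hence by the smooth function \<open>partial i v\<close>.\<close>
  have UW: "(LINT y|lebesgue_on \<Omega>. U i y * partial i v y) = (LINT y|lebesgue_on \<Omega>. W i y * partial i v y)" for i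
  proof -
    have "(LINT x|lebesgue_on \<Omega>. (U i x - W i x) * partial i v x) = 0"
    proof (rule weak_annihilation[OF op bd ne])
      show "integrable (lebesgue_on \<Omega>) (\<lambda>x. U i x - W i x)" using L21[OF UL2] L21[OF W(2)] by auto
      fix \<phi> assume \<phi>: "test_function \<Omega> \<phi>"
      have "integrable (lebesgue_on \<Omega>) (\<lambda>x. \<phi> x *\<^sub>R U i x)" "integrable (lebesgue_on \<Omega>) (\<lambda>x. \<phi> x *\<^sub>R W i x)"
        using U[of i] W(1)[of i] by (auto intro!: test_function_integrable[OF op _ \<phi>] simp: weak_partial_def)
      then show "(LINT x|lebesgue_on \<Omega>. \<phi> x *\<^sub>R (U i x - W i x)) = 0"
        using U[of i] W(1)[of i] \<phi> by (simp add: weak_partial_def scaleR_diff_right)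
    qed (rule C_inf_partial[OF v])
    then show ?thesis
      using L2i[OF UL2 C_inf_partial[OF v]] L2i[OF W(2) C_inf_partial[OF v]] by (simp add: left_diff_distrib)
  qed
  have ru: "integrable (lebesgue_on D) (\<lambda>x. \<rho> x * u x)"
    using D D\<Omega> bd closure_subset[of \<Omega>]
    by (intro integrable_coefficient_mult rho continuous_on_subset[OF uc]) (auto intro: bounded_subset)
  have ru\<Omega>: "integrable (lebesgue_on \<Omega>) (\<lambda>x. indicator D x * (\<rho> x * u x))"
    using ru by (simp add: lebesgue_on_indicator[OF D(1) op D\<Omega>])
  obtain L U' V' where U': "\<And>i. weak_partial \<Omega> i u (U' i)" "\<And>i. weak_partial \<Omega> i (U' i) (V' i)"
    and LV: "\<And>x. L x = (\<Sum>i\<in>UNIV. V' i x)"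
    and Leq: "AE x in lebesgue_on \<Omega>. L x + of_real (k\<^sup>2) * (1 + indicator D x * \<rho> x) * u x = 0"
    using sol unfolding strong_solution_def weak_laplacian_def by blast
  \<comment> \<open>The residual of the equation with Z in place of the Laplacian supplied by the
    solution. It need only vanish against test functions.\<close>
  define a where "a x = (\<Sum>i\<in>UNIV. Z i x) + of_real (k\<^sup>2) * (u x + indicator D x * (\<rho> x * u x))" for x
  have ai: "integrable (lebesgue_on \<Omega>) a"
    unfolding a_def using Z L21 uL2 ru\<Omega> by (intro Bochner_Integration.integrable_add Bochner_Integration.integrable_sum integrable_mult_right) auto
  have av: "(LINT x|lebesgue_on \<Omega>. a x * v x) = 0"
  proof (rule weak_annihilation[OF op bd ne ai _ v])
    fix \<phi> assume \<phi>: "test_function \<Omega> \<phi>"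
    have iZ: "integrable (lebesgue_on \<Omega>) (\<lambda>x. \<phi> x *\<^sub>R Z i x)" and iV: "integrable (lebesgue_on \<Omega>) (\<lambda>x. \<phi> x *\<^sub>R V' i x)" for i
      using Z U'(2)[of i] by (auto intro!: test_function_integrable[OF op _ \<phi>] simp: weak_partial_def)
    \<comment> \<open>Move both derivatives onto \<phi>: either side becomes the integral of u
      against the second derivative of \<phi>.\<close>
    have eqZV: "(LINT x|lebesgue_on \<Omega>. \<phi> x *\<^sub>R Z i x) = (LINT x|lebesgue_on \<Omega>. \<phi> x *\<^sub>R V' i x)" for i
    proof -
      have p\<phi>: "test_function \<Omega> (partial i \<phi>)" by (rule test_function_partial[OF \<phi>])
      have "(LINT x|lebesgue_on \<Omega>. \<phi> x *\<^sub>R Z i x) = - (LINT x|lebesgue_on \<Omega>. partial i \<phi> x *\<^sub>R U i x)"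
        using Z \<phi> by (simp add: weak_partial_def)
      also have "\<dots> = (LINT x|lebesgue_on \<Omega>. partial i (partial i \<phi>) x *\<^sub>R u x)"
        using U[of i] p\<phi> by (simp add: weak_partial_def)
      also have "\<dots> = - (LINT x|lebesgue_on \<Omega>. partial i \<phi> x *\<^sub>R U' i x)"
        using U'(1)[of i] p\<phi> by (simp add: weak_partial_def)
      also have "\<dots> = (LINT x|lebesgue_on \<Omega>. \<phi> x *\<^sub>R V' i x)"
        using U'(2)[of i] \<phi> by (simp add: weak_partial_def)
      finally show ?thesis .
    qed
    have \<phi>a: "integrable (lebesgue_on \<Omega>) (\<lambda>x. \<Sum>i\<in>UNIV. \<phi> x *\<^sub>R Z i x - \<phi> x *\<^sub>R V' i x)"
      by (intro Bochner_Integration.integrable_sum Bochner_Integration.integrable_diff iZ iV)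
    have "continuous_on UNIV \<phi>"
      using C_k_imp_continuous[OF C_infD[of \<phi> 0], of UNIV] \<phi> by (simp only: test_function_def simp_thms)
    then have "\<phi> \<in> borel_measurable lebesgue"
      by (intro measurable_completion) (use borel_measurable_continuous_onI in simp)
    then have \<phi>m: "\<phi> \<in> borel_measurable (lebesgue_on \<Omega>)" by (rule measurable_restrict_space1)
    have "(LINT x|lebesgue_on \<Omega>. \<phi> x *\<^sub>R a x) = (LINT x|lebesgue_on \<Omega>. (\<Sum>i\<in>UNIV. \<phi> x *\<^sub>R Z i x - \<phi> x *\<^sub>R V' i x))"
    proof (rule integral_cong_AE)
      show "(\<lambda>x. \<phi> x *\<^sub>R a x) \<in> borel_measurable (lebesgue_on \<Omega>)"
        by (rule borel_measurable_scaleR[OF \<phi>m borel_measurable_integrable[OF ai]])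
      show "AE x in lebesgue_on \<Omega>. \<phi> x *\<^sub>R a x = (\<Sum>i\<in>UNIV. \<phi> x *\<^sub>R Z i x - \<phi> x *\<^sub>R V' i x)"
        using Leq
      proof eventually_elim
        case (elim x)
        have "a x = (\<Sum>i\<in>UNIV. Z i x) - L x"
          using elim by (simp add: a_def algebra_simps eq_neg_iff_add_eq_0 flip: add_eq_0_iff)
        then show ?case by (simp add: LV sum_subtractf scaleR_right.sum scaleR_diff_right)
      qed
    qed (use \<phi>a in auto)
    also have "\<dots> = (\<Sum>i\<in>UNIV. (LINT x|lebesgue_on \<Omega>. \<phi> x *\<^sub>R Z i x) - (LINT x|lebesgue_on \<Omega>. \<phi> x *\<^sub>R V' i x))"
      by (subst Bochner_Integration.integral_sum) (auto intro!: Bochner_Integration.integrable_diff iZ iV sum.cong Bochner_Integration.integral_diff)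
    also have "\<dots> = 0" using eqZV by simp
    finally show "(LINT x|lebesgue_on \<Omega>. \<phi> x *\<^sub>R a x) = 0" .
  qed
  have iZv: "integrable (lebesgue_on \<Omega>) (\<lambda>x. Z i x * v x)" for i using Z v by (auto intro: L2i)
  have iuv: "integrable (lebesgue_on \<Omega>) (\<lambda>x. u x * v x)" by (rule L2i[OF uL2 v])
  obtain B where B: "\<And>x. x \<in> closure \<Omega> \<Longrightarrow> cmod (v x) \<le> B"
    by (rule continuous_bounded_on_closure[OF bd cont[OF v]]) (rule that)
  have iruv: "integrable (lebesgue_on D) (\<lambda>x. \<rho> x * u x * v x)"
  proof (rule Bochner_Integration.integrable_bound)
    show "integrable (lebesgue_on D) (\<lambda>x. B * norm (\<rho> x * u x))" using ru by auto
    show "(\<lambda>x. \<rho> x * u x * v x) \<in> borel_measurable (lebesgue_on D)"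
      using borel_measurable_integrable[OF ru] borel_measurable_lebesgue_on_continuous[OF cont[OF v]] by (rule borel_measurable_times)
    show "AE x in lebesgue_on D. norm (\<rho> x * u x * v x) \<le> norm (B * norm (\<rho> x * u x))"
    proof (rule AE_I2)
      fix x assume "x \<in> space (lebesgue_on D)"
      then have "x \<in> closure \<Omega>" using D\<Omega> closure_subset by auto
      then have "cmod (\<rho> x * u x) * cmod (v x) \<le> cmod (\<rho> x * u x) * \<bar>B\<bar>" using B[of x] by (intro mult_left_mono) auto
      then show "norm (\<rho> x * u x * v x) \<le> norm (B * norm (\<rho> x * u x))" by (simp add: norm_mult abs_mult mult.commute)
    qed
  qed
  have Zv: "(\<Sum>i\<in>UNIV. (LINT x|lebesgue_on \<Omega>. Z i x * v x)) = - of_real (k\<^sup>2) * ((LINT x|lebesgue_on \<Omega>. u x * v x) + (LINT x|lebesgue_on D. \<rho> x * u x * v x))"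
  proof -
    have iD: "integrable (lebesgue_on \<Omega>) (\<lambda>x. indicator D x * (\<rho> x * u x * v x))"
      using iruv by (simp add: lebesgue_on_indicator[OF D(1) op D\<Omega>])
    have "(LINT x|lebesgue_on \<Omega>. a x * v x) = (LINT x|lebesgue_on \<Omega>. (\<Sum>i\<in>UNIV. Z i x * v x) + of_real (k\<^sup>2) * (u x * v x + indicator D x * (\<rho> x * u x * v x)))"
      by (intro Bochner_Integration.integral_cong refl) (simp add: a_def algebra_simps sum_distrib_left)
    also have "\<dots> = (\<Sum>i\<in>UNIV. (LINT x|lebesgue_on \<Omega>. Z i x * v x)) + of_real (k\<^sup>2) * ((LINT x|lebesgue_on \<Omega>. u x * v x) + (LINT x|lebesgue_on \<Omega>. indicator D x * (\<rho> x * u x * v x)))"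
      using iZv iuv iD by (subst Bochner_Integration.integral_add) auto
    finally show ?thesis using av by (simp add: lebesgue_on_indicator[OF D(1) op D\<Omega>] eq_neg_iff_add_eq_0)
  qed
  have "enclosure_indicator \<Omega> \<nu> k \<omega> f g \<tau>
     = (LINT x|boundary_measure \<Omega>. g x * v x - (\<Sum>i\<in>UNIV. f x * (of_real (\<nu> x $ i) * partial i v x)))"
    unfolding enclosure_indicator_def frechet_derivative_exp_solution v_def
    by (intro Bochner_Integration.integral_cong refl) (simp add: sum_distrib_left mult.commute)
  also have "\<dots> = (LINT x|boundary_measure \<Omega>. (\<Sum>i\<in>UNIV. G i x * (of_real (\<nu> x $ i) * v x) - f x * (of_real (\<nu> x $ i) * partial i v x)))"
  proof (rule integral_cong_AE)
    have gv: "(\<lambda>x. g x * v x) \<in> borel_measurable (boundary_measure \<Omega>)"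
      using g borel_measurable_boundary_continuous[OF cont[OF v]] by (intro borel_measurable_times) (auto simp: in_L2_def)
    show "(\<lambda>x. g x * v x - (\<Sum>i\<in>UNIV. f x * (of_real (\<nu> x $ i) * partial i v x))) \<in> borel_measurable (boundary_measure \<Omega>)"
      by (intro borel_measurable_diff gv borel_measurable_sum borel_measurable_integrable W(3) C_inf_partial v)
    show "(\<lambda>x. \<Sum>i\<in>UNIV. G i x * (of_real (\<nu> x $ i) * v x) - f x * (of_real (\<nu> x $ i) * partial i v x)) \<in> borel_measurable (boundary_measure \<Omega>)"
      by (intro borel_measurable_diff borel_measurable_sum borel_measurable_integrable W(3) C_inf_partial v) (use Z in auto)
    show "AE x in boundary_measure \<Omega>. g x * v x - (\<Sum>i\<in>UNIV. f x * (of_real (\<nu> x $ i) * partial i v x)) =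
        (\<Sum>i\<in>UNIV. G i x * (of_real (\<nu> x $ i) * v x) - f x * (of_real (\<nu> x $ i) * partial i v x))"
      using gG by eventually_elim (simp add: sum_subtractf sum_distrib_left mult_ac)
  qed
  also have "\<dots> = (\<Sum>i\<in>UNIV. (LINT x|boundary_measure \<Omega>. G i x * (of_real (\<nu> x $ i) * v x)) - (LINT x|boundary_measure \<Omega>. f x * (of_real (\<nu> x $ i) * partial i v x)))"
    using Z W(3)[OF C_inf_partial[OF v]]
    by (subst Bochner_Integration.integral_sum) (auto intro!: Bochner_Integration.integrable_diff sum.cong Bochner_Integration.integral_diff)
  also have "\<dots> = (\<Sum>i\<in>UNIV. (LINT x|lebesgue_on \<Omega>. Z i x * v x) - (LINT y|lebesgue_on \<Omega>. u y * partial i (partial i v) y))"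
    using Z UW W(4)[OF C_inf_partial[OF v]] by (intro sum.cong refl) simp
  also have "\<dots> = (\<Sum>i\<in>UNIV. (LINT x|lebesgue_on \<Omega>. Z i x * v x)) - (\<Sum>i\<in>UNIV. c i * c i * (LINT y|lebesgue_on \<Omega>. u y * v y))"
  proof -
    have "(LINT y|lebesgue_on \<Omega>. u y * partial i (partial i v) y) = c i * c i * (LINT y|lebesgue_on \<Omega>. u y * v y)" for i
    proof -
      have "(LINT y|lebesgue_on \<Omega>. u y * partial i (partial i v) y) = (LINT y|lebesgue_on \<Omega>. (c i * c i) * (u y * v y))"
        by (intro Bochner_Integration.integral_cong refl) (simp add: ppv mult_ac)
      then show ?thesis by simp
    qed
    then show ?thesis by (simp add: sum_subtractf)
  qed
  also have "(\<Sum>i\<in>UNIV. c i * c i * (LINT y|lebesgue_on \<Omega>. u y * v y)) = - of_real (k\<^sup>2) * (LINT y|lebesgue_on \<Omega>. u y * v y)"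
    unfolding sum_distrib_right[symmetric] cc ..
  \<comment> \<open>The two integrals of u v cancel, because v solves the equation with coefficient
    1; only the perturbation on D remains.\<close>
  also have "(\<Sum>i\<in>UNIV. (LINT x|lebesgue_on \<Omega>. Z i x * v x)) - - of_real (k\<^sup>2) * (LINT y|lebesgue_on \<Omega>. u y * v y)
     = - of_real (k\<^sup>2) * (LINT x|lebesgue_on D. \<rho> x * u x * v x)"
    unfolding Zv by (simp add: algebra_simps)
  finally show ?thesis by (simp add: v_def)
qed

section \<open>Local structure of a polygon\<close>

text \<open>One-sided affine germs exist everywhere, and at parameters whose point is outside V the
  two germs fit together. The vector A is read backwards in time, so that A and B both point away
  from g t.\<close>

definition piecewise_affine :: "(real^2) set \<Rightarrow> (real \<Rightarrow> real^2) \<Rightarrow> bool" where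
  "piecewise_affine V g \<longleftrightarrow>
     (\<forall>t. 0 \<le> t \<and> t < 1 \<longrightarrow> (\<exists>\<epsilon>>0. \<exists>B. \<forall>s. 0 \<le> s \<and> s \<le> \<epsilon> \<longrightarrow> g (t + s) = g t + s *\<^sub>R B)) \<and>
     (\<forall>t. 0 < t \<and> t \<le> 1 \<longrightarrow> (\<exists>\<epsilon>>0. \<exists>A. \<forall>s. 0 \<le> s \<and> s \<le> \<epsilon> \<longrightarrow> g (t - s) = g t + s *\<^sub>R A)) \<and>
     (\<forall>t. 0 < t \<and> t < 1 \<and> g t \<notin> V \<longrightarrow> (\<exists>\<epsilon>>0. \<exists>B. \<forall>s. \<bar>s\<bar> \<le> \<epsilon> \<longrightarrow> g (t + s) = g t + s *\<^sub>R B))"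

lemma linepath_affine: "linepath a b (t + s) = linepath a b t + s *\<^sub>R (b - a)"
  by (simp add: linepath_def algebra_simps)

lemma piecewise_affine_linepath: "piecewise_affine V (linepath a b)"
  unfolding piecewise_affine_def
proof (intro conjI allI impI)
  show "\<exists>\<epsilon>>0. \<exists>A. \<forall>s. 0 \<le> s \<and> s \<le> \<epsilon> \<longrightarrow> linepath a b (t - s) = linepath a b t + s *\<^sub>R A" for t
    by (rule exI[of _ 1], simp, rule exI[of _ "a - b"]) (simp add: linepath_def algebra_simps)
qed (use linepath_affine zero_less_one in blast)+

text \<open>Both halves are run at double speed, which doubles the direction vectors. The only new
  corner is at parameter 1/2, and its point b belongs to V.\<close>

lemma piecewise_affine_join:
  assumes h: "piecewise_affine V h" and h0: "h 0 = b" and V: "b \<in> V"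
  shows "piecewise_affine V (linepath a b +++ h)"
proof -
  let ?g = "linepath a b +++ h"
  have lo: "?g t = a + (2 * t) *\<^sub>R (b - a)" if "t \<le> 1/2" for t
    using that by (simp add: joinpaths_def linepath_def algebra_simps)
  have hi: "?g t = h (2 * t - 1)" if "t \<ge> 1/2" for t
  proof (cases "t = 1/2")
    case True
    show ?thesis unfolding True using h0 by (simp add: joinpaths_def linepath_def)
  qed (use that in \<open>auto simp: joinpaths_def\<close>)
  note H = h[unfolded piecewise_affine_def]
  show ?thesis
    unfolding piecewise_affine_def
  proof (intro conjI allI impI)
    fix t :: real assume t: "0 \<le> t \<and> t < 1"
    show "\<exists>\<epsilon>>0. \<exists>B. \<forall>s. 0 \<le> s \<and> s \<le> \<epsilon> \<longrightarrow> ?g (t + s) = ?g t + s *\<^sub>R B"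
    proof (cases "t < 1/2")
      case True
      then show ?thesis
        by (intro exI[of _ "1/2 - t"] exI[of _ "2 *\<^sub>R (b - a)"] conjI allI impI) (auto simp: lo algebra_simps)
    next
      case False
      then have "0 \<le> 2 * t - 1 \<and> 2 * t - 1 < 1" using t by auto
      then obtain \<epsilon> B where e: "\<epsilon> > 0" "\<And>s. 0 \<le> s \<Longrightarrow> s \<le> \<epsilon> \<Longrightarrow> h (2 * t - 1 + s) = h (2 * t - 1) + s *\<^sub>R B"
        using H by meson
      show ?thesis
      proof (intro exI[of _ "\<epsilon>/2"] exI[of _ "2 *\<^sub>R B"] conjI allI impI)
        fix s assume s: "0 \<le> s \<and> s \<le> \<epsilon> / 2"
        then show "?g (t + s) = ?g t + s *\<^sub>R 2 *\<^sub>R B"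
          using e(2)[of "2 * s"] hi[of t] hi[of "t + s"] False by (simp add: algebra_simps)
      qed (use e in auto)
    qed
  next
    fix t :: real assume t: "0 < t \<and> t \<le> 1"
    show "\<exists>\<epsilon>>0. \<exists>A. \<forall>s. 0 \<le> s \<and> s \<le> \<epsilon> \<longrightarrow> ?g (t - s) = ?g t + s *\<^sub>R A"
    proof (cases "t \<le> 1/2")
      case True
      then show ?thesis
        by (intro exI[of _ 1] exI[of _ "- 2 *\<^sub>R (b - a)"] conjI allI impI) (auto simp: lo algebra_simps)
    next
      case False
      then have "0 < 2 * t - 1 \<and> 2 * t - 1 \<le> 1" using t by auto
      then obtain \<epsilon> A where e: "\<epsilon> > 0" "\<And>s. 0 \<le> s \<Longrightarrow> s \<le> \<epsilon> \<Longrightarrow> h (2 * t - 1 - s) = h (2 * t - 1) + s *\<^sub>R A"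
        using H by meson
      show ?thesis
      proof (intro exI[of _ "min (\<epsilon>/2) (t - 1/2)"] exI[of _ "2 *\<^sub>R A"] conjI allI impI)
        fix s assume s: "0 \<le> s \<and> s \<le> min (\<epsilon>/2) (t - 1/2)"
        then show "?g (t - s) = ?g t + s *\<^sub>R 2 *\<^sub>R A"
          using e(2)[of "2 * s"] hi[of t] hi[of "t - s"] False by (simp add: algebra_simps)
      qed (use e False in auto)
    qed
  next
    fix t :: real assume t: "0 < t \<and> t < 1 \<and> ?g t \<notin> V"
    show "\<exists>\<epsilon>>0. \<exists>B. \<forall>s. \<bar>s\<bar> \<le> \<epsilon> \<longrightarrow> ?g (t + s) = ?g t + s *\<^sub>R B"
    proof (cases t "1/2 :: real" rule: linorder_cases)
      case less
      then show ?thesis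
        by (intro exI[of _ "1/2 - t"] exI[of _ "2 *\<^sub>R (b - a)"] conjI allI impI) (auto simp: lo algebra_simps)
    next
      case equal
      have "?g t = b" unfolding equal using hi[of "1/2"] h0 by simp
      then show ?thesis using t V by simp
    next
      case greater
      then have "0 < 2 * t - 1 \<and> 2 * t - 1 < 1 \<and> h (2 * t - 1) \<notin> V" using t hi[of t] by auto
      then obtain \<epsilon> B where e: "\<epsilon> > 0" "\<And>s. \<bar>s\<bar> \<le> \<epsilon> \<Longrightarrow> h (2 * t - 1 + s) = h (2 * t - 1) + s *\<^sub>R B"
        using H by meson
      show ?thesis
      proof (intro exI[of _ "min (\<epsilon>/2) (t - 1/2)"] exI[of _ "2 *\<^sub>R B"] conjI allI impI)
        fix s assume s: "\<bar>s\<bar> \<le> min (\<epsilon>/2) (t - 1/2)"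
        then have "\<bar>2 * s\<bar> \<le> \<epsilon>" "t + s \<ge> 1/2" by auto
        then show "?g (t + s) = ?g t + s *\<^sub>R 2 *\<^sub>R B"
          using e(2)[of "2 * s"] hi[of t] hi[of "t + s"] greater by (simp add: algebra_simps)
      qed (use e greater in auto)
    qed
  qed
qed

section \<open>Polygonal curves near a point\<close>

lemma polyline_pathstart: "pathstart (polyline (a # l)) = a"
  by (induction "a # l" arbitrary: a l rule: polyline.induct) auto

lemma polyline_pathfinish: "pathfinish (polyline (l @ [a])) = a"
proof (induction l)
  case (Cons b l)
  then show ?case by (cases l rule: list.exhaust; cases "tl l") auto
qed (simp add: pathfinish_def)

lemma piecewise_affine_polyline: "set l \<subseteq> V \<Longrightarrow> piecewise_affine V (polyline l)"
proof (induction l rule: polyline.induct)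
  case (4 a b c vs)
  have "polyline (b # c # vs) 0 = b" using polyline_pathstart[of b "c # vs"] by (simp add: pathstart_def)
  then show ?case using 4 by (simp add: piecewise_affine_join)
qed (simp_all add: piecewise_affine_linepath)

definition ray :: "real^2 \<Rightarrow> real^2 \<Rightarrow> (real^2) set" where
  "ray p A = {p + s *\<^sub>R A | s. s \<ge> 0}"

text \<open>Choose \<delta> below the distance from p to K and below the length of both segments:
  inside the ball the segments cannot be told from rays.\<close>

lemma local_rays_of_decomposition:
  assumes C: "C = (\<lambda>s. p + s *\<^sub>R A) ` {0..\<epsilon>} \<union> (\<lambda>s. p + s *\<^sub>R B) ` {0..\<epsilon>} \<union> K"
    and K: "compact K" "p \<notin> K" and \<epsilon>: "\<epsilon> > 0" and nz: "A \<noteq> 0" "B \<noteq> 0"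
  obtains \<delta> where "\<delta> > 0" "C \<inter> ball p \<delta> = (ray p A \<union> ray p B) \<inter> ball p \<delta>"
proof -
  obtain d where d: "d > 0" "\<And>x. x \<in> K \<Longrightarrow> d \<le> dist p x"
    using separate_point_closed[OF compact_imp_closed[OF K(1)] K(2)] by blast
  define \<delta> where "\<delta> = min d (\<epsilon> * min (norm A) (norm B))"
  have \<delta>: "\<delta> > 0" using d \<epsilon> nz by (simp add: \<delta>_def)
  have r: "x \<in> (\<lambda>s. p + s *\<^sub>R E) ` {0..\<epsilon>}" if x: "x \<in> ray p E" "x \<in> ball p \<delta>" and E: "E = A \<or> E = B" for x E
  proof -
    obtain s where s: "s \<ge> 0" "x = p + s *\<^sub>R E" using x by (auto simp: ray_def)
    have "s * norm E < \<delta>" using x(2) s by (simp add: dist_norm)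
    also have "\<delta> \<le> \<epsilon> * min (norm A) (norm B)" by (simp add: \<delta>_def)
    also have "\<dots> \<le> \<epsilon> * norm E" using E \<epsilon> by (intro mult_left_mono) auto
    finally have "s < \<epsilon>" using E nz by auto
    then show ?thesis using s by auto
  qed
  have "C \<inter> ball p \<delta> \<subseteq> (ray p A \<union> ray p B) \<inter> ball p \<delta>"
    using d(2) unfolding C by (fastforce simp: ray_def \<delta>_def)
  moreover have "(ray p A \<union> ray p B) \<inter> ball p \<delta> \<subseteq> C \<inter> ball p \<delta>"
    using r unfolding C by blast
  ultimately show ?thesis using that \<delta> by blast
qed

text \<open>A simple closed curve passes p only once, so away from the parameters of p it stays at
  positive distance and two affine germs remain. If both pointed in the same direction, the two arcs
  would overlap, against injectivity.\<close>

lemma simple_piecewise_affine_local_rays: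
  assumes pa: "piecewise_affine V g" and simp: "simple_path g" and closed: "pathfinish g = pathstart g"
    and start: "pathstart g \<in> V" and p: "p \<in> path_image g"
  obtains A B \<delta> where "\<delta> > 0" "A \<noteq> 0" "B \<noteq> 0" "path_image g \<inter> ball p \<delta> = (ray p A \<union> ray p B) \<inter> ball p \<delta>"
    "p \<in> V \<or> A = - B" "\<And>c. c > 0 \<Longrightarrow> A \<noteq> c *\<^sub>R B"
proof -
  note goal = that
  have inj: "x = y \<or> x = 0 \<and> y = 1 \<or> x = 1 \<and> y = 0"
    if "x \<in> {0..1}" "y \<in> {0..1}" "g x = g y" for x y
    using simp that unfolding simple_path_def loop_free_def by blast
  have cont: "continuous_on {0..1} g" using simp by (simp add: simple_path_def path_def)
  have g01: "g 0 = g 1" using closed by (simp add: pathstart_def pathfinish_def)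
  obtain t where t: "0 \<le> t" "t \<le> 1" "p = g t" using p by (auto simp: path_image_def)
  \<comment> \<open>The common core of two cases: p is left backwards from parameter ta and forwards
    from tb. These agree when p is an interior point of the parametrisation, and are 1 and 0 at the
    base point.\<close>
  have main: thesis
    if \<epsilon>: "\<epsilon> > 0" and A: "\<And>s. 0 \<le> s \<Longrightarrow> s \<le> \<epsilon> \<Longrightarrow> g (ta - s) = p + s *\<^sub>R A"
      and B: "\<And>s. 0 \<le> s \<Longrightarrow> s \<le> \<epsilon> \<Longrightarrow> g (tb + s) = p + s *\<^sub>R B"
      and V: "p \<in> V \<or> A = - B" and K: "compact K" "K \<subseteq> {0..1}" "\<And>x. x \<in> K \<Longrightarrow> g x \<noteq> p"
      and cov: "{0..1} = {ta - \<epsilon>..ta} \<union> {tb..tb + \<epsilon>} \<union> K"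
      and ne: "\<And>s s'. 0 < s \<Longrightarrow> s \<le> \<epsilon> \<Longrightarrow> 0 < s' \<Longrightarrow> s' \<le> \<epsilon> \<Longrightarrow> g (ta - s) \<noteq> g (tb + s')"
      and neA: "g (ta - \<epsilon>) \<noteq> p" and neB: "g (tb + \<epsilon>) \<noteq> p" for \<epsilon> A B ta tb K
  proof -
    have nz: "A \<noteq> 0" "B \<noteq> 0" using A[of \<epsilon>] B[of \<epsilon>] neA neB \<epsilon> by auto
    have imA: "g ` {ta - \<epsilon>..ta} = (\<lambda>s. p + s *\<^sub>R A) ` {0..\<epsilon>}"
    proof -
      have "{ta - \<epsilon>..ta} = (\<lambda>s. ta - s) ` {0..\<epsilon>}" by (simp add: image_diff_atLeastAtMost)
      then have "g ` {ta - \<epsilon>..ta} = (\<lambda>s. g (ta - s)) ` {0..\<epsilon>}" by (metis image_image)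
      also have "\<dots> = (\<lambda>s. p + s *\<^sub>R A) ` {0..\<epsilon>}" by (rule image_cong) (use A in auto)
      finally show ?thesis .
    qed
    have imB: "g ` {tb..tb + \<epsilon>} = (\<lambda>s. p + s *\<^sub>R B) ` {0..\<epsilon>}"
    proof -
      have "{tb..tb + \<epsilon>} = (\<lambda>s. tb + s) ` {0..\<epsilon>}" by simp
      then have "g ` {tb..tb + \<epsilon>} = (\<lambda>s. g (tb + s)) ` {0..\<epsilon>}" by (metis image_image)
      also have "\<dots> = (\<lambda>s. p + s *\<^sub>R B) ` {0..\<epsilon>}" by (rule image_cong) (use B in auto)
      finally show ?thesis .
    qed
    have C: "path_image g = (\<lambda>s. p + s *\<^sub>R A) ` {0..\<epsilon>} \<union> (\<lambda>s. p + s *\<^sub>R B) ` {0..\<epsilon>} \<union> g ` K"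
      unfolding path_image_def cov image_Un imA imB ..
    have gK: "compact (g ` K)" "p \<notin> g ` K"
      using K by (auto intro!: compact_continuous_image continuous_on_subset[OF cont])
    obtain \<delta> where \<delta>: "\<delta> > 0" "path_image g \<inter> ball p \<delta> = (ray p A \<union> ray p B) \<inter> ball p \<delta>"
      by (rule local_rays_of_decomposition[OF C gK \<epsilon> nz]) (rule that)
    have "A \<noteq> c *\<^sub>R B" if c: "c > 0" for c
    proof
      assume AB: "A = c *\<^sub>R B"
      \<comment> \<open>Small enough that both s and s * c are admissible parameters; the two arcs
        then meet at p + s A.\<close>
      define s where "s = min \<epsilon> (\<epsilon> / c)"
      have s: "0 < s" "s \<le> \<epsilon>" "0 < s * c" "s * c \<le> \<epsilon>"
        using \<epsilon> c by (auto simp: s_def min_def field_simps)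
      then have "g (ta - s) = g (tb + s * c)" using A[of s] B[of "s * c"] AB by simp
      then show False using ne[of s "s * c"] s by blast
    qed
    then show thesis by (rule goal[OF \<delta>(1) nz \<delta>(2) V])
  qed
  note PA = pa[unfolded piecewise_affine_def]
  show thesis
  proof (cases "0 < t \<and> t < 1")
    case True
    have "\<exists>\<epsilon>>0. \<exists>A B. (\<forall>s. 0 \<le> s \<and> s \<le> \<epsilon> \<longrightarrow> g (t - s) = p + s *\<^sub>R A \<and> g (t + s) = p + s *\<^sub>R B) \<and> (p \<in> V \<or> A = - B)"
    proof (cases "p \<in> V")
      case True
      obtain \<epsilon>1 B where 1: "\<epsilon>1 > 0" "\<forall>s. 0 \<le> s \<and> s \<le> \<epsilon>1 \<longrightarrow> g (t + s) = g t + s *\<^sub>R B" using PA t \<open>0 < t \<and> t < 1\<close> by meson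
      obtain \<epsilon>2 A where 2: "\<epsilon>2 > 0" "\<forall>s. 0 \<le> s \<and> s \<le> \<epsilon>2 \<longrightarrow> g (t - s) = g t + s *\<^sub>R A" using PA t \<open>0 < t \<and> t < 1\<close> by meson
      show ?thesis 
        by (rule exI[of _ "min \<epsilon>1 \<epsilon>2"], rule conjI, use 1 2 in simp, rule exI[of _ A], rule exI[of _ B])
          (use 1 2 True t in auto)
    next
      case False
      then obtain \<epsilon> B where e: "\<epsilon> > 0" "\<forall>s. \<bar>s\<bar> \<le> \<epsilon> \<longrightarrow> g (t + s) = g t + s *\<^sub>R B" using PA t \<open>0 < t \<and> t < 1\<close> by meson
      show ?thesis
      proof (rule exI[of _ \<epsilon>], rule conjI[OF e(1)], rule exI[of _ "- B"], rule exI[of _ B], intro conjI allI impI)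
        fix s assume s: "0 \<le> s \<and> s \<le> \<epsilon>"
        then show "g (t - s) = p + s *\<^sub>R - B" "g (t + s) = p + s *\<^sub>R B"
          using e(2)[rule_format, of "- s"] e(2)[rule_format, of s] t by auto
      qed (use e in auto)
    qed
    then obtain \<epsilon>0 A B where e0: "\<epsilon>0 > 0" "\<And>s. 0 \<le> s \<Longrightarrow> s \<le> \<epsilon>0 \<Longrightarrow> g (t - s) = p + s *\<^sub>R A"
      "\<And>s. 0 \<le> s \<Longrightarrow> s \<le> \<epsilon>0 \<Longrightarrow> g (t + s) = p + s *\<^sub>R B" "p \<in> V \<or> A = - B" by blast
    define m where "m = min t (1 - t)"
    define \<epsilon> where "\<epsilon> = min \<epsilon>0 (m / 2)"
    have m: "m > 0" "m \<le> t" "m \<le> 1 - t" using True by (auto simp: m_def)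
    have \<epsilon>2: "\<epsilon> \<le> m / 2" "\<epsilon> \<le> \<epsilon>0" "\<epsilon> > 0" using e0(1) m(1) by (auto simp: \<epsilon>_def)
    have \<epsilon>: "\<epsilon> > 0" "\<epsilon> \<le> \<epsilon>0" "\<epsilon> < t" "t + \<epsilon> < 1" using m \<epsilon>2 by linarith+
    show thesis
    proof (rule main[where \<epsilon>=\<epsilon> and A=A and B=B and ta=t and tb=t and K="{0..t-\<epsilon>} \<union> {t+\<epsilon>..1}"])
      show "g x \<noteq> p" if "x \<in> {0..t-\<epsilon>} \<union> {t+\<epsilon>..1}" for x
        using inj[of x t] that \<epsilon> True t by auto
      show "g (t - s) \<noteq> g (t + s')" if "0 < s" "s \<le> \<epsilon>" "0 < s'" "s' \<le> \<epsilon>" for s s'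
        using inj[of "t - s" "t + s'"] that \<epsilon> by auto
      show "g (t - \<epsilon>) \<noteq> p" "g (t + \<epsilon>) \<noteq> p"
        using inj[of "t - \<epsilon>" t] inj[of "t + \<epsilon>" t] \<epsilon> t by auto
    qed (use \<epsilon> e0 in auto)
  next
    case False
    then have p01: "p = g 0" "p = g 1" using t g01 by (cases "t = 0"; auto)+
    have pV: "p \<in> V" using start p01 by (simp add: pathstart_def)
    obtain \<epsilon>1 B where 1: "\<epsilon>1 > 0" "\<And>s. 0 \<le> s \<Longrightarrow> s \<le> \<epsilon>1 \<Longrightarrow> g (0 + s) = g 0 + s *\<^sub>R B"
      using PA by (metis order_refl zero_less_one)
    obtain \<epsilon>2 A where 2: "\<epsilon>2 > 0" "\<And>s. 0 \<le> s \<Longrightarrow> s \<le> \<epsilon>2 \<Longrightarrow> g (1 - s) = g 1 + s *\<^sub>R A"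
      using PA by (metis order_refl zero_less_one)
    \<comment> \<open>The bound 1/4 keeps the parameter intervals at 0 and at 1 disjoint.\<close>
    define \<epsilon> where "\<epsilon> = min (min \<epsilon>1 \<epsilon>2) (1/4)"
    have \<epsilon>: "\<epsilon> > 0" "\<epsilon> \<le> \<epsilon>1" "\<epsilon> \<le> \<epsilon>2" "\<epsilon> \<le> 1/4" using 1(1) 2(1) by (auto simp: \<epsilon>_def)
    show thesis
    proof (rule main[where \<epsilon>=\<epsilon> and A=A and B=B and ta=1 and tb=0 and K="{\<epsilon>..1-\<epsilon>}"])
      show "g x \<noteq> p" if "x \<in> {\<epsilon>..1-\<epsilon>}" for x
        using inj[of x 0] that \<epsilon> p01 by auto
      show "g (1 - s) \<noteq> g (0 + s')" if "0 < s" "s \<le> \<epsilon>" "0 < s'" "s' \<le> \<epsilon>" for s s'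
        using inj[of "1 - s" "0 + s'"] that \<epsilon> by auto
      show "g (1 - \<epsilon>) \<noteq> p" "g (0 + \<epsilon>) \<noteq> p"
        using inj[of "1 - \<epsilon>" 0] inj[of "0 + \<epsilon>" 0] \<epsilon> p01 by auto
      show "g (0 + s) = p + s *\<^sub>R B" if "0 \<le> s" "s \<le> \<epsilon>" for s using 1(2)[of s] that \<epsilon> p01 by auto
      show "g (1 - s) = p + s *\<^sub>R A" if "0 \<le> s" "s \<le> \<epsilon>" for s using 2(2)[of s] that \<epsilon> p01 by auto
    qed (use \<epsilon> pV in auto)
  qed
qed

section \<open>Oblique coordinates and the support function\<close>

definition det2 :: "real^2 \<Rightarrow> real^2 \<Rightarrow> real" where "det2 A B = A$1 * B$2 - A$2 * B$1"

lemma det2_zero_parallel: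
  assumes "det2 A B = 0" "A \<noteq> 0" shows "\<exists>c. B = c *\<^sub>R A"
proof -
  have nA: "A \<bullet> A \<noteq> 0" using assms(2) by simp
  have "(A \<bullet> A) *\<^sub>R B = (A \<bullet> B) *\<^sub>R A"
  proof -
    have e: "A$1 * B$2 = A$2 * B$1" using assms(1) by (simp add: det2_def)
    have "(A$1*A$1 + A$2*A$2) * B$1 = (A$1*B$1 + A$2*B$2) * A$1"
    proof -
      have "A$2*A$2*B$1 = A$2 * (A$1 * B$2)" using e by simp
      then show ?thesis by (simp add: algebra_simps)
    qed
    moreover have "(A$1*A$1 + A$2*A$2) * B$2 = (A$1*B$1 + A$2*B$2) * A$2"
    proof -
      have "A$1*A$1*B$2 = A$1 * (A$2 * B$1)" using e by simp
      then show ?thesis by (simp add: algebra_simps)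
    qed
    ultimately show ?thesis by (simp add: vec_eq_iff forall_2 inner_real2)
  qed
  then have "B = ((A \<bullet> B) / (A \<bullet> A)) *\<^sub>R A"
    using nA by (metis (no_types, lifting) divide_inverse_commute scaleR_left_imp_eq scaleR_scaleR real_vector.scale_left_imp_eq nonzero_mult_div_cancel_left times_divide_eq_right)
  then show ?thesis ..
qed

text \<open>Cramer's rule: a and b form the dual basis, obtained by rotating B and A and dividing by
  the determinant.\<close>

lemma det2_coordinates:
  assumes d: "det2 A B \<noteq> 0"
  obtains a b where "a \<bullet> A = 1" "a \<bullet> B = 0" "b \<bullet> A = 0" "b \<bullet> B = 1" "\<And>x. x = (a \<bullet> x) *\<^sub>R A + (b \<bullet> x) *\<^sub>R B"
proof
  let ?a = "- (1 / det2 A B) *\<^sub>R perp B" and ?b = "(1 / det2 A B) *\<^sub>R perp A"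
  have in_a: "?a \<bullet> x = det2 x B / det2 A B" and in_b: "?b \<bullet> x = det2 A x / det2 A B" for x
  proof -
    have "perp B \<bullet> x = - det2 x B" "perp A \<bullet> x = det2 A x" by (simp_all add: inner_real2 perp_def det2_def)
    then show "?a \<bullet> x = det2 x B / det2 A B" "?b \<bullet> x = det2 A x / det2 A B" by simp_all
  qed
  show "?a \<bullet> A = 1" "?a \<bullet> B = 0" "?b \<bullet> A = 0" "?b \<bullet> B = 1"
    unfolding in_a in_b using d by (auto simp: det2_def)
  fix x
  have "det2 A B *\<^sub>R x = det2 x B *\<^sub>R A + det2 A x *\<^sub>R B"
    by (simp add: vec_eq_iff forall_2 det2_def algebra_simps)
  then have "(1 / det2 A B) *\<^sub>R (det2 A B *\<^sub>R x) = (1 / det2 A B) *\<^sub>R (det2 x B *\<^sub>R A + det2 A x *\<^sub>R B)" by simp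
  then show "x = (?a \<bullet> x) *\<^sub>R A + (?b \<bullet> x) *\<^sub>R B"
    unfolding in_a in_b using d by (simp add: scaleR_add_right)
qed

lemma inner_le_support_function:
  assumes "bounded D" "x \<in> closure D"
  shows "x \<bullet> \<omega> \<le> support_function D \<omega>"
proof -
  have "bounded ((\<lambda>x. x \<bullet> \<omega>) ` D)" using assms(1) by (intro bounded_linear_image bounded_linear_inner_left)
  then have bdd: "bdd_above ((\<lambda>x. x \<bullet> \<omega>) ` D)" by (rule bounded_imp_bdd_above)
  have "closed {x. x \<bullet> \<omega> \<le> support_function D \<omega>}" by (intro closed_Collect_le continuous_intros)
  moreover have "D \<subseteq> {x. x \<bullet> \<omega> \<le> support_function D \<omega>}"
    unfolding support_function_def using cSUP_upper[OF _ bdd] by blast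
  ultimately show ?thesis using closure_minimal assms(2) by blast
qed

lemma open_polygon: "polygon_with_vertices D vs \<Longrightarrow> open D"
  by (auto simp: polygon_with_vertices_def intro!: open_inside closed_simple_path_image)

text \<open>\<open>inside C\<close> is a union of components of the complement, so a connected set
  missing C cannot leave it.\<close>

lemma connected_subset_inside:
  assumes "connected T" "T \<inter> C = {}" "T \<inter> inside C \<noteq> {}"
  shows "T \<subseteq> inside C"
proof
  fix y assume y: "y \<in> T"
  obtain x where x: "x \<in> T" "x \<in> inside C" using assms(3) by blast
  have "connected_component (- C) x y"
    unfolding connected_component_def using assms x y by (intro exI[of _ T]) auto
  then show "y \<in> inside C" using inside_same_component x(2) by blast
qed

text \<open>
  Near \<open>p\<close> the boundary curve consists of two rays. The two sectors between them are connected and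
  miss the curve, so each lies in \<open>D\<close> or outside \<open>D\<close>; the sector with angle at least \<open>\<pi>\<close> has points
  beyond the support line. If the rays are opposite, \<open>D\<close> contains a half-disc and the
  support line meets its frontier in more than \<open>p\<close>. The Jordan curve theorem is not needed.
\<close>

lemma polygon_local_sector:
  assumes poly: "polygon_with_vertices D vs" and bd: "bounded D"
    and reg: "regular_direction D \<omega>" and p: "p \<in> support_line D \<omega> \<inter> frontier D"
  obtains A B \<delta> where "\<delta> > 0" "det2 A B \<noteq> 0" "p \<in> set vs" "A \<bullet> \<omega> < 0" "B \<bullet> \<omega> < 0"
    "\<And>x. x \<in> D \<inter> ball p \<delta> \<longleftrightarrow> x \<in> ball p \<delta> \<and> (\<exists>s>0. \<exists>t>0. x = p + s *\<^sub>R A + t *\<^sub>R B)"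
proof -
  define g where "g = polyline (vs @ [hd vs])"
  define C where "C = path_image g"
  have vs: "vs \<noteq> []" and simp: "simple_path g" and D: "D = inside C"
    using poly by (auto simp: polygon_with_vertices_def g_def C_def)
  have sv: "set (vs @ [hd vs]) = set vs" using vs by auto
  have ps: "pathstart g = hd vs" unfolding g_def using polyline_pathstart[of "hd vs" "tl vs @ [hd vs]"] vs by (simp flip: append_Cons)
  have pf: "pathfinish g = hd vs" unfolding g_def by (rule polyline_pathfinish)
  have pa: "piecewise_affine (set vs) g" unfolding g_def by (rule piecewise_affine_polyline) (simp add: vs)
  have Cc: "closed C" "compact C" using simp by (auto simp: C_def compact_simple_path_image closed_simple_path_image)
  have Dop: "open D" by (rule open_polygon[OF poly])
  have DC: "D \<inter> C = {}" unfolding D by (rule inside_no_overlap)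
  have frC: "frontier D \<subseteq> C" unfolding D by (rule frontier_inside_subset[OF Cc(1)])
  have \<omega>: "norm \<omega> = 1" and uniq: "\<And>x. x \<in> support_line D \<omega> \<inter> frontier D \<Longrightarrow> x = p"
    using reg p unfolding regular_direction_def by blast+
  have ph: "p \<bullet> \<omega> = support_function D \<omega>" using p by (simp add: support_line_def)
  have le_cl: "x \<bullet> \<omega> \<le> p \<bullet> \<omega>" if "x \<in> closure D" for x
    unfolding ph by (rule inner_le_support_function[OF bd that])
  have le: "x \<bullet> \<omega> \<le> p \<bullet> \<omega>" if "x \<in> D" for x
    using le_cl that closure_subset by blast
  \<comment> \<open>Such a point lies on the frontier, so touching the support line would make it
    equal to p by regularity.\<close>
  have strict: "x \<bullet> \<omega> < p \<bullet> \<omega>" if x: "x \<in> closure D" "x \<in> C" "x \<noteq> p" for x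
  proof -
    have "x \<in> frontier D" using x DC Dop by (auto simp: frontier_def interior_open)
    then have "x \<bullet> \<omega> \<noteq> p \<bullet> \<omega>" using uniq[of x] x(3) by (auto simp: support_line_def ph)
    then show ?thesis using le_cl[OF x(1)] by simp
  qed
  have pC: "p \<in> path_image g" using p frC by (auto simp: C_def)
  obtain A B \<delta> where \<delta>: "\<delta> > 0" and nz: "A \<noteq> 0" "B \<noteq> 0"
    and rays: "C \<inter> ball p \<delta> = (ray p A \<union> ray p B) \<inter> ball p \<delta>"
    and V: "p \<in> set vs \<or> A = - B" and ndir: "\<And>c. c > 0 \<Longrightarrow> A \<noteq> c *\<^sub>R B"
    unfolding C_def
    by (rule simple_piecewise_affine_local_rays[OF pa simp _ _ pC]) (use ps pf vs in auto)
  have meets: "D \<inter> ball p \<delta> \<noteq> {}"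
  proof -
    have "p \<in> closure D" using p by (simp add: frontier_def)
    then show ?thesis using \<delta> by (metis closure_iff_nhds_not_empty centre_in_ball open_ball order_refl)
  qed
  have fill: "T \<subseteq> D" if "connected T" "T \<inter> C = {}" "T \<inter> D \<noteq> {}" for T
    using connected_subset_inside that unfolding D by blast
  have small: "\<exists>s0>0. \<forall>s. 0 \<le> s \<and> s < s0 \<longrightarrow> p + s *\<^sub>R E \<in> ball p \<delta>" for E
  proof (intro exI[of _ "\<delta> / (norm E + 1)"] conjI allI impI)
    show "\<delta> / (norm E + 1) > 0" using \<delta> by (simp add: add_nonneg_pos)
    fix s assume s: "0 \<le> s \<and> s < \<delta> / (norm E + 1)"
    then have "s * (norm E + 1) < \<delta>" by (simp add: pos_less_divide_eq add_nonneg_pos)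
    then have "s * norm E < \<delta>" using s by (simp add: algebra_simps)
    then show "p + s *\<^sub>R E \<in> ball p \<delta>" using s by (simp add: dist_norm)
  qed
  \<comment> \<open>Parallel rays must be opposite, because \<open>ndir\<close> excludes equal
    directions; the curve is then a straight segment near p.\<close>
  have det: "det2 A B \<noteq> 0"
  proof
    assume "det2 A B = 0"
    then obtain c where c: "B = c *\<^sub>R A" using det2_zero_parallel nz by blast
    then have c0: "c < 0" using nz ndir[of "1/c"] by (cases c "0::real" rule: linorder_cases) auto
    have on_line: "x \<in> ray p A \<union> ray p B \<longleftrightarrow> (x - p) \<bullet> perp A = 0" for x
    proof
      assume "x \<in> ray p A \<union> ray p B"
      then show "(x - p) \<bullet> perp A = 0" by (auto simp: ray_def c inner_real2 perp_def)
    next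
      assume "(x - p) \<bullet> perp A = 0"
      then have "det2 A (x - p) = 0" by (simp add: det2_def inner_real2 perp_def algebra_simps)
      then obtain d where d: "x - p = d *\<^sub>R A" using det2_zero_parallel nz by blast
      then have x: "x = p + d *\<^sub>R A" by (simp add: algebra_simps)
      show "x \<in> ray p A \<union> ray p B"
      proof (cases "d \<ge> 0")
        case False
        then have "x = p + (d / c) *\<^sub>R B" "d / c \<ge> 0" using c c0 x by (auto simp: divide_nonpos_neg)
        then show ?thesis by (auto simp: ray_def)
      qed (use x in \<open>auto simp: ray_def\<close>)
    qed
    \<comment> \<open>For \<sigma> = 1 and \<sigma> = -1 these are the two open half-discs cut off
      by the line through p.\<close>
    define H where "H \<sigma> = ball p \<delta> \<inter> {x. (\<sigma> *\<^sub>R perp A) \<bullet> x > (\<sigma> *\<^sub>R perp A) \<bullet> p}" for \<sigma> :: real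
    have H_conn: "connected (H \<sigma>)" for \<sigma>
      unfolding H_def by (intro convex_connected convex_Int convex_ball convex_halfspace_gt)
    have H_C: "H \<sigma> \<inter> C = {}" for \<sigma>
    proof -
      have "x \<notin> C" if x: "x \<in> H \<sigma>" for x
      proof
        assume "x \<in> C"
        then have "x \<in> ray p A \<union> ray p B" using x rays unfolding H_def by blast
        then show False using x on_line[of x] by (simp add: H_def inner_commute inner_diff_right inner_diff_left)
      qed
      then show ?thesis by blast
    qed
    obtain x where x: "x \<in> D" "x \<in> ball p \<delta>" using meets by blast
    then have "x \<notin> ray p A \<union> ray p B" using DC rays by blast
    then have "(x - p) \<bullet> perp A \<noteq> 0" using on_line by blast
    moreover have "(x - p) \<bullet> perp A = perp A \<bullet> x - perp A \<bullet> p"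
      by (simp add: inner_diff_right inner_commute[of _ "perp A"])
    ultimately have "perp A \<bullet> x \<noteq> perp A \<bullet> p" by simp
    then have "x \<in> H 1 \<or> x \<in> H (-1)" using x(2) by (simp add: H_def) linarith
    then obtain \<sigma> :: real where \<sigma>: "\<sigma> \<noteq> 0" "x \<in> H \<sigma>" by (metis zero_neq_one neg_equal_0_iff_equal)
    have HD: "H \<sigma> \<subseteq> D" by (rule fill[OF H_conn H_C]) (use \<sigma> x in blast)
    have cl: "y \<in> closure D" if y: "y \<in> ball p \<delta>" "(y - p) \<bullet> perp A = 0" for y
      unfolding closure_approachable
    proof (intro allI impI)
      fix e :: real assume e: "e > 0"
      have pn: "perp A \<noteq> 0" using nz(1) by (auto simp: perp_def vec_eq_iff forall_2)
      define h where "h = min e (\<delta> - dist p y) / (2 * (\<bar>\<sigma>\<bar> * norm (perp A)))"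
      have den: "\<bar>\<sigma>\<bar> * norm (perp A) > 0" using \<sigma> pn by simp
      have h: "h > 0" using e y den by (simp add: h_def)
      have hn: "h * (\<bar>\<sigma>\<bar> * norm (perp A)) < e" "h * (\<bar>\<sigma>\<bar> * norm (perp A)) < \<delta> - dist p y"
        using den e y by (auto simp: h_def)
      define z where "z = y + (h * \<sigma>) *\<^sub>R perp A"
      have dz: "dist z y = h * (\<bar>\<sigma>\<bar> * norm (perp A))" using h by (simp add: z_def dist_norm abs_mult)
      have zb: "z \<in> ball p \<delta>" using dist_triangle[of p z y] dz hn by (simp add: dist_commute)
      have "(\<sigma> *\<^sub>R perp A) \<bullet> z - (\<sigma> *\<^sub>R perp A) \<bullet> p = \<sigma> * ((y - p) \<bullet> perp A) + h * (\<sigma> * \<sigma>) * (perp A \<bullet> perp A)"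
        by (simp add: z_def inner_add_right inner_diff_left inner_commute algebra_simps)
      also have "\<dots> > 0"
        using y(2) h pn not_real_square_gt_zero[of \<sigma>] \<sigma>(1) by (simp add: zero_less_mult_iff)
      finally have "z \<in> H \<sigma>" using zb by (simp add: H_def)
      then have "z \<in> D" using HD by blast
      moreover have "dist z y < e" unfolding dz by (rule hn(1))
      ultimately show "\<exists>z\<in>D. dist z y < e" by blast
    qed
    obtain s0 where s0: "s0 > 0" "\<And>s. 0 \<le> s \<Longrightarrow> s < s0 \<Longrightarrow> p + s *\<^sub>R A \<in> ball p \<delta>" using small by blast
    obtain s1 where s1: "s1 > 0" "\<And>s. 0 \<le> s \<Longrightarrow> s < s1 \<Longrightarrow> p + s *\<^sub>R - A \<in> ball p \<delta>" using small by blast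
    define s where "s = min s0 s1 / 2"
    have s: "s > 0" "s < s0" "s < s1" using s0 s1 by (auto simp: s_def)
    have perpA: "A \<bullet> perp A = 0" by (simp add: inner_real2 perp_def)
    \<comment> \<open>Points of the diameter on both sides of p lie on the curve and in the closure
      of D, hence strictly below the support line; but A . \<omega> and -A . \<omega> cannot both be
      negative.\<close>
    have "(p + s *\<^sub>R E) \<bullet> \<omega> < p \<bullet> \<omega>" if E: "E = A \<or> E = - A" for E
    proof (rule strict)
      have b: "p + s *\<^sub>R E \<in> ball p \<delta>" using E s0(2)[of s] s1(2)[of s] s by auto
      have l: "(p + s *\<^sub>R E - p) \<bullet> perp A = 0" using E perpA by auto
      show "p + s *\<^sub>R E \<in> closure D" by (rule cl[OF b l])
      show "p + s *\<^sub>R E \<in> C" using rays b on_line[of "p + s *\<^sub>R E"] l by blast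
      show "p + s *\<^sub>R E \<noteq> p" using E s nz by auto
    qed
    from this[of A] this[of "- A"] show False using s by (simp add: inner_add_left inner_diff_left mult_less_0_iff zero_less_mult_iff)
  qed
  then have pV: "p \<in> set vs" using V by (auto simp: det2_def)
  obtain a b where ab: "a \<bullet> A = 1" "a \<bullet> B = 0" "b \<bullet> A = 0" "b \<bullet> B = 1"
    and exp: "\<And>x. x = (a \<bullet> x) *\<^sub>R A + (b \<bullet> x) *\<^sub>R B"
    by (rule det2_coordinates[OF det]) (rule that)
  have on_rays: "x \<in> ray p A \<union> ray p B \<longleftrightarrow> (a \<bullet> (x - p) \<ge> 0 \<and> b \<bullet> (x - p) = 0) \<or> (a \<bullet> (x - p) = 0 \<and> b \<bullet> (x - p) \<ge> 0)" for x
  proof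
    assume "x \<in> ray p A \<union> ray p B"
    then show "(a \<bullet> (x - p) \<ge> 0 \<and> b \<bullet> (x - p) = 0) \<or> (a \<bullet> (x - p) = 0 \<and> b \<bullet> (x - p) \<ge> 0)"
      by (auto simp: ray_def ab)
  next
    assume h: "(a \<bullet> (x - p) \<ge> 0 \<and> b \<bullet> (x - p) = 0) \<or> (a \<bullet> (x - p) = 0 \<and> b \<bullet> (x - p) \<ge> 0)"
    have "x = p + ((a \<bullet> (x - p)) *\<^sub>R A + (b \<bullet> (x - p)) *\<^sub>R B)" using exp[of "x - p"] by (simp add: algebra_simps)
    then show "x \<in> ray p A \<union> ray p B" using h unfolding ray_def
      by (auto intro: exI[of _ "a \<bullet> (x - p)"] exI[of _ "b \<bullet> (x - p)"])
  qed
  \<comment> \<open>In the dual coordinates S1 is the convex sector. The reflex sector is the union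
    of two half-discs, connected because they overlap in direction -A - B.\<close>
  define S1 where "S1 = ball p \<delta> \<inter> ({x. a \<bullet> x > a \<bullet> p} \<inter> {x. b \<bullet> x > b \<bullet> p})"
  define Ha where "Ha = ball p \<delta> \<inter> {x. a \<bullet> x < a \<bullet> p}"
  define Hb where "Hb = ball p \<delta> \<inter> {x. b \<bullet> x < b \<bullet> p}"
  have S1_conn: "connected S1" unfolding S1_def
    by (intro convex_connected convex_Int convex_ball convex_halfspace_gt)
  obtain s0 where s0: "s0 > 0" "\<And>s. 0 \<le> s \<Longrightarrow> s < s0 \<Longrightarrow> p + s *\<^sub>R (- A - B) \<in> ball p \<delta>" using small by blast
  have "p + (s0/2) *\<^sub>R (- A - B) \<in> Ha \<inter> Hb"
    using s0 s0(2)[of "s0/2"] by (simp add: Ha_def Hb_def inner_add_right inner_diff_right ab)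
  then have S2_conn: "connected (Ha \<union> Hb)"
    unfolding Ha_def Hb_def by (intro connected_Un convex_connected convex_Int convex_ball convex_halfspace_lt) auto
  have not_C: "x \<notin> C" if "x \<in> S1 \<or> x \<in> Ha \<union> Hb" for x
  proof
    assume "x \<in> C"
    then have "x \<in> ray p A \<union> ray p B" using that rays unfolding S1_def Ha_def Hb_def by blast
    then show False using that on_rays[of x] by (auto simp: S1_def Ha_def Hb_def inner_diff_right)
  qed
  have cover: "x \<in> S1 \<or> x \<in> Ha \<union> Hb" if x: "x \<in> ball p \<delta>" "x \<notin> C" for x
  proof -
    have "x \<notin> ray p A \<union> ray p B" using x rays by blast
    then show ?thesis using x on_rays[of x] by (auto simp: S1_def Ha_def Hb_def inner_diff_right not_less)
  qed
  have S2: "D \<inter> (Ha \<union> Hb) = {}"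
  proof (rule ccontr)
    assume "D \<inter> (Ha \<union> Hb) \<noteq> {}"
    then have sub: "Ha \<union> Hb \<subseteq> D" using not_C by (intro fill S2_conn) auto
    \<comment> \<open>A - B has dual coordinates 1 and -1, so with either sign it points into the
      reflex sector; \<sigma> makes its product with \<omega> nonnegative. Adding \<eta> \<omega>
      makes the product positive, and \<eta> is small enough that the negative coordinate stays
      negative. E thus leads beyond the support line from within that sector.\<close>
    define \<sigma> :: real where "\<sigma> = (if (A - B) \<bullet> \<omega> \<ge> 0 then 1 else -1)"
    define \<eta> where "\<eta> = 1 / (\<bar>a \<bullet> \<omega>\<bar> + \<bar>b \<bullet> \<omega>\<bar> + 1)"
    define E where "E = \<sigma> *\<^sub>R (A - B) + \<eta> *\<^sub>R \<omega>"
    have \<eta>: "\<eta> > 0" by (simp add: \<eta>_def add_nonneg_pos)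
    have "\<eta> * (\<bar>a \<bullet> \<omega>\<bar> + \<bar>b \<bullet> \<omega>\<bar> + 1) = 1" by (simp add: \<eta>_def)
    then have "\<eta> * \<bar>a \<bullet> \<omega>\<bar> + \<eta> * \<bar>b \<bullet> \<omega>\<bar> + \<eta> = 1" by (simp add: algebra_simps)
    moreover have "\<eta> * \<bar>a \<bullet> \<omega>\<bar> \<ge> 0" "\<eta> * \<bar>b \<bullet> \<omega>\<bar> \<ge> 0" using \<eta> by auto
    moreover have "\<eta> * (a \<bullet> \<omega>) \<le> \<eta> * \<bar>a \<bullet> \<omega>\<bar>" "\<eta> * (b \<bullet> \<omega>) \<le> \<eta> * \<bar>b \<bullet> \<omega>\<bar>" using \<eta> by (intro mult_left_mono; simp)+
    ultimately have lt: "\<eta> * (a \<bullet> \<omega>) < 1" "\<eta> * (b \<bullet> \<omega>) < 1" using \<eta> by linarith+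
    have neg: "a \<bullet> E < 0 \<or> b \<bullet> E < 0"
      using lt by (auto simp: E_def \<sigma>_def inner_add_right inner_diff_right ab)
    have "E \<bullet> \<omega> = \<sigma> * ((A - B) \<bullet> \<omega>) + \<eta> * (\<omega> \<bullet> \<omega>)" by (simp add: E_def inner_add_left)
    moreover have "\<sigma> * ((A - B) \<bullet> \<omega>) \<ge> 0" by (simp add: \<sigma>_def)
    ultimately have E\<omega>: "E \<bullet> \<omega> > 0" using \<eta> \<omega> by (simp add: norm_eq_1)
    obtain s0 where s0: "s0 > 0" "\<And>s. 0 \<le> s \<Longrightarrow> s < s0 \<Longrightarrow> p + s *\<^sub>R E \<in> ball p \<delta>" using small by blast
    have "p + (s0/2) *\<^sub>R E \<in> Ha \<union> Hb"
      using s0(1) s0(2)[of "s0/2"] neg by (auto simp: Ha_def Hb_def inner_add_right mult_less_0_iff)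
    then have "(p + (s0/2) *\<^sub>R E) \<bullet> \<omega> \<le> p \<bullet> \<omega>" using sub le by blast
    then show False using E\<omega> s0(1) by (simp add: inner_add_left mult_le_0_iff)
  qed
  have "D \<inter> ball p \<delta> \<subseteq> S1" using cover S2 DC by blast
  moreover have "S1 \<subseteq> D" using not_C meets calculation by (intro fill S1_conn) auto
  ultimately have DS1: "D \<inter> ball p \<delta> = S1" by (auto simp: S1_def)
  \<comment> \<open>Points of an edge near p are limits of points of the sector and lie on the
    curve, so \<open>strict\<close> applies.\<close>
  have neg: "E \<bullet> \<omega> < 0" if EF: "E = A \<and> F = B \<or> E = B \<and> F = A" for E F
  proof -
    obtain s0 where s0: "s0 > 0" "\<And>s. 0 \<le> s \<Longrightarrow> s < s0 \<Longrightarrow> p + s *\<^sub>R E \<in> ball p \<delta>" using small by blast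
    define s where "s = s0 / 2"
    have s: "s > 0" "p + s *\<^sub>R E \<in> ball p \<delta>" using s0 by (auto simp: s_def)
    have "p + s *\<^sub>R E \<in> closure D"
      unfolding closure_approachable
    proof (intro allI impI)
      fix e :: real assume e: "e > 0"
      define y where "y = p + s *\<^sub>R E"
      define h where "h = min e (\<delta> - dist p y) / (2 * norm F)"
      have F: "norm F > 0" using EF nz by auto
      have h: "h > 0" "h * norm F < e" "h * norm F < \<delta> - dist p y" using e F s(2) by (auto simp: h_def y_def)
      have dz: "dist (y + h *\<^sub>R F) y = h * norm F" using h by (simp add: dist_norm)
      then have "y + h *\<^sub>R F \<in> ball p \<delta>" using dist_triangle[of p "y + h *\<^sub>R F" y] h by (simp add: dist_commute)
      then have "y + h *\<^sub>R F \<in> S1" using EF s h by (auto simp: S1_def y_def inner_add_right ab)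
      then show "\<exists>z\<in>D. dist z (p + s *\<^sub>R E) < e" using DS1 dz h by (intro bexI[of _ "y + h *\<^sub>R F"]) (auto simp: y_def)
    qed
    moreover have "p + s *\<^sub>R E \<in> C"
      using rays s EF unfolding ray_def by (auto intro!: exI[of _ s])
    moreover have "p + s *\<^sub>R E \<noteq> p" using EF s nz by auto
    ultimately have "(p + s *\<^sub>R E) \<bullet> \<omega> < p \<bullet> \<omega>" by (rule strict)
    then show ?thesis using s by (simp add: inner_add_left mult_less_0_iff)
  qed
  have S1_iff: "x \<in> D \<inter> ball p \<delta> \<longleftrightarrow> x \<in> ball p \<delta> \<and> (\<exists>s>0. \<exists>t>0. x = p + s *\<^sub>R A + t *\<^sub>R B)" for x
  proof -
    have "x = p + (a \<bullet> (x - p)) *\<^sub>R A + (b \<bullet> (x - p)) *\<^sub>R B" using exp[of "x - p"] by (simp add: algebra_simps)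
    then have "x \<in> S1 \<Longrightarrow> \<exists>s>0. \<exists>t>0. x = p + s *\<^sub>R A + t *\<^sub>R B"
      unfolding S1_def by (intro exI[of _ "a \<bullet> (x - p)"] conjI exI[of _ "b \<bullet> (x - p)"]) (auto simp: inner_diff_right)
    moreover have "x \<in> ball p \<delta> \<Longrightarrow> \<exists>s>0. \<exists>t>0. x = p + s *\<^sub>R A + t *\<^sub>R B \<Longrightarrow> x \<in> S1"
      by (auto simp: S1_def inner_add_right ab)
    ultimately show ?thesis unfolding DS1 by (auto simp: S1_def)
  qed
  show thesis by (rule that[OF \<delta> det pV _ _ S1_iff]) (use neg in blast)+
qed

section \<open>Asymptotics of the indicator function\<close>

text \<open>Integrate the antiderivative exp (s \<alpha>) / \<alpha> over {0..n} and let n grow; the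
  value at n tends to 0 because Re \<alpha> < 0. The third claim supplies the majorant for the
  sector integral.\<close>

lemma exp_halfline:
  fixes \<alpha> :: complex
  assumes \<alpha>: "Re \<alpha> < 0"
  shows "integrable lborel (\<lambda>s::real. indicator {0<..} s *\<^sub>R exp (s *\<^sub>R \<alpha>))"
    "(LINT s|lborel. indicator {0<..} s *\<^sub>R exp (s *\<^sub>R \<alpha>)) = - 1 / \<alpha>"
    "integrable lborel (\<lambda>s::real. indicator {0<..} s * exp (s * Re \<alpha>))"
proof -
  define f where "f s = exp (s *\<^sub>R \<alpha>)" for s :: real
  have cf: "continuous_on UNIV f" unfolding f_def by (intro continuous_intros)
  have fm [measurable]: "f \<in> borel_measurable borel" using cf by (rule borel_measurable_continuous_onI)
  have nf: "norm (f s) = exp (s * Re \<alpha>)" for s by (simp add: f_def)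
  have "(\<lambda>s. exp (- (- Re \<alpha>) * s)) integrable_on {0..}"
    by (rule integrable_on_exp_minus_to_infinity) (use \<alpha> in simp)
  then have "(\<lambda>s. exp (s * Re \<alpha>)) absolutely_integrable_on {0..}"
    by (intro nonnegative_absolutely_integrable_1) (auto simp: mult.commute)
  then have "integrable lebesgue (\<lambda>s. indicator {0..} s *\<^sub>R exp (s * Re \<alpha>))"
    by (simp add: set_integrable_def)
  then have "integrable lborel (\<lambda>s. indicator {0..} s *\<^sub>R exp (s * Re \<alpha>))"
    by (subst (asm) integrable_completion) auto
  then have "integrable lborel (\<lambda>s. indicator {0<..} s *\<^sub>R (indicator {0..} s *\<^sub>R exp (s * Re \<alpha>)))"
    by (rule integrable_mult_indicator[rotated]) simp
  also have "(\<lambda>s. indicator {0<..} s *\<^sub>R (indicator {0..} s *\<^sub>R exp (s * Re \<alpha>))) = (\<lambda>s. indicator {0<..} s * exp (s * Re \<alpha>))"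
    by (auto simp: indicator_def)
  finally show i: "integrable lborel (\<lambda>s::real. indicator {0<..} s * exp (s * Re \<alpha>))" .
  have i2: "integrable lborel (\<lambda>s. indicator {0<..} s *\<^sub>R f s)"
    by (rule Bochner_Integration.integrable_bound[OF i]) (auto simp: nf)
  then show "integrable lborel (\<lambda>s::real. indicator {0<..} s *\<^sub>R exp (s *\<^sub>R \<alpha>))" by (simp add: f_def)
  define F where "F s = f s / \<alpha>" for s
  have \<alpha>0: "\<alpha> \<noteq> 0" using \<alpha> by auto
  have dF: "(F has_vector_derivative f s) (at s within S)" for s S
  proof -
    have "((\<lambda>s. exp (s *\<^sub>R \<alpha>)) has_vector_derivative exp (s *\<^sub>R \<alpha>) * \<alpha>) (at s within S)"
      by (rule exp_scaleR_has_vector_derivative_right)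
    then have "((\<lambda>s. exp (s *\<^sub>R \<alpha>) / \<alpha>) has_vector_derivative (exp (s *\<^sub>R \<alpha>) * \<alpha>) / \<alpha>) (at s within S)"
      by (rule has_vector_derivative_divide)
    then show ?thesis using \<alpha>0 by (simp add: F_def[abs_def] f_def)
  qed
  have FTC: "(LINT s|lborel. indicator {0..real n} s *\<^sub>R f s) = F (real n) - F 0" for n :: nat
    by (rule integral_FTC_Icc[OF _ dF continuous_on_subset[OF cf]]) auto
  have "(\<lambda>n. LINT s|lborel. indicator {0..real n} s *\<^sub>R f s) \<longlonglongrightarrow> (LINT s|lborel. indicator {0<..} s *\<^sub>R f s)"
  proof (rule integral_dominated_convergence[where w="\<lambda>s. indicator {0<..} s * exp (s * Re \<alpha>)"])
    show "AE s in lborel. (\<lambda>n. indicator {0..real n} s *\<^sub>R f s) \<longlonglongrightarrow> indicator {0<..} s *\<^sub>R f s"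
      using AE_lborel_singleton[of 0]
    proof eventually_elim
      case (elim s)
      obtain N :: nat where N: "s \<le> real N" using real_arch_simple by blast
      have "\<forall>\<^sub>F n in sequentially. indicator {0..real n} s *\<^sub>R f s = indicator {0<..} s *\<^sub>R f s"
        unfolding eventually_sequentially using N elim by (intro exI[of _ N]) (auto simp: indicator_def)
      then show ?case by (rule tendsto_eventually)
    qed
    show "AE s in lborel. norm (indicator {0..real n} s *\<^sub>R f s) \<le> indicator {0<..} s * exp (s * Re \<alpha>)" for n
      using AE_lborel_singleton[of 0] by eventually_elim (auto simp: indicator_def nf)
  qed (use i in auto)
  then have lim1: "(\<lambda>n. F (real n) - F 0) \<longlonglongrightarrow> (LINT s|lborel. indicator {0<..} s *\<^sub>R f s)" unfolding FTC .
  have "(\<lambda>n. F (real n)) \<longlonglongrightarrow> 0"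
  proof (rule Lim_null_comparison)
    show "\<forall>\<^sub>F n in sequentially. norm (F (real n)) \<le> exp (real n * Re \<alpha>) / norm \<alpha>"
      by (simp add: F_def norm_divide nf)
    have "(\<lambda>n. exp (Re \<alpha>) ^ n) \<longlonglongrightarrow> 0" by (rule LIMSEQ_power_zero) (use \<alpha> in simp)
    then have "(\<lambda>n. exp (real n * Re \<alpha>)) \<longlonglongrightarrow> 0" by (simp add: exp_of_nat_mult)
    then show "(\<lambda>n. exp (real n * Re \<alpha>) / norm \<alpha>) \<longlonglongrightarrow> 0" by (rule tendsto_divide_zero)
  qed
  then have "(\<lambda>n. F (real n) - F 0) \<longlonglongrightarrow> 0 - F 0" by (intro tendsto_diff tendsto_const)
  then have "(LINT s|lborel. indicator {0<..} s *\<^sub>R f s) = 0 - F 0" using lim1 LIMSEQ_unique by blast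
  then show "(LINT s|lborel. indicator {0<..} s *\<^sub>R exp (s *\<^sub>R \<alpha>)) = - 1 / \<alpha>"
    by (simp add: F_def f_def)
qed

lemma integrable_lborel_prod:
  fixes f g :: "real \<Rightarrow> 'b::{real_normed_field, banach, second_countable_topology}"
  assumes f: "integrable lborel f" and g: "integrable lborel g"
  shows "integrable (lborel :: (real \<times> real) measure) (\<lambda>p. f (fst p) * g (snd p))"
    "(LINT p|(lborel :: (real \<times> real) measure). f (fst p) * g (snd p)) = (LINT s|lborel. f s) * (LINT t|lborel. g t)"
proof -
  have [measurable]: "f \<in> borel_measurable lborel" "g \<in> borel_measurable lborel" using f g by auto
  have int: "integrable (lborel \<Otimes>\<^sub>M lborel) (\<lambda>p. f (fst p) * g (snd p))"
  proof (rule lborel_pair.Fubini_integrable)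
    show "(\<lambda>p. f (fst p) * g (snd p)) \<in> borel_measurable (lborel \<Otimes>\<^sub>M lborel)" by measurable
    show "integrable lborel (\<lambda>x. LINT y|lborel. norm (f (fst (x, y)) * g (snd (x, y))))"
      using f by (simp add: norm_mult)
  qed (use g in simp)
  then show "integrable (lborel :: (real \<times> real) measure) (\<lambda>p. f (fst p) * g (snd p))" by (simp add: lborel_prod)
  show "(LINT p|(lborel :: (real \<times> real) measure). f (fst p) * g (snd p)) = (LINT s|lborel. f s) * (LINT t|lborel. g t)"
    using lborel_pair.integral_fst'[OF int] by (simp add: lborel_prod)
qed

text \<open>
  Substituting \<open>x = p + (s A + t B) / \<tau>\<close> turns the integral into \<open>\<tau>\<^sup>-\<^sup>2\<close> times one that
  converges, by dominated convergence, to a multiple of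
  \<open>\<integral>\<^sub>0\<^sup>\<infinity> exp (s \<alpha>) ds \<integral>\<^sub>0\<^sup>\<infinity> exp (t \<beta>) dt = 1 / (\<alpha> \<beta>)\<close>.
\<close>

lemma sector_asymptotics:
  fixes F :: "real^2 \<Rightarrow> complex" and A B \<omega> p :: "real^2"
  assumes F [measurable]: "F \<in> borel_measurable borel" and bound: "\<And>x. cmod (F x) \<le> M"
    and d: "det2 A B \<noteq> 0" and A\<omega>: "A \<bullet> \<omega> < 0" and B\<omega>: "B \<bullet> \<omega> < 0"
    and outside: "\<And>s t. \<not> (s > 0 \<and> t > 0) \<Longrightarrow> F (p + s *\<^sub>R A + t *\<^sub>R B) = 0"
    and lim: "\<And>s t. s > 0 \<Longrightarrow> t > 0 \<Longrightarrow> ((\<lambda>\<tau>. F (p + (s / \<tau>) *\<^sub>R A + (t / \<tau>) *\<^sub>R B)) \<longlongrightarrow> c) at_top"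
    and c: "c \<noteq> 0"
  obtains K where "K \<noteq> 0"
    "((\<lambda>\<tau>. of_real (\<tau>\<^sup>2) * (LINT x|lborel. F x * exp_solution k \<omega> \<tau> (x - p))) \<longlongrightarrow> K) at_top"
proof -
  define \<alpha> where "\<alpha> = Complex (A \<bullet> \<omega>) (A \<bullet> perp \<omega>)"
  define \<beta> where "\<beta> = Complex (B \<bullet> \<omega>) (B \<bullet> perp \<omega>)"
  have Re: "Re \<alpha> < 0" "Re \<beta> < 0" using A\<omega> B\<omega> by (auto simp: \<alpha>_def \<beta>_def)
  then have nz: "\<alpha> \<noteq> 0" "\<beta> \<noteq> 0" by auto
  define P where "P q \<tau> = p + (fst q / \<tau>) *\<^sub>R A + (snd q / \<tau>) *\<^sub>R B" for q :: "real \<times> real" and \<tau> :: real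
  define h where "h \<tau> q = F (P q \<tau>) * exp_solution k \<omega> \<tau> ((fst q / \<tau>) *\<^sub>R A + (snd q / \<tau>) *\<^sub>R B)" for \<tau> q
  define l where "l q = c * ((indicator {0<..} (fst q) *\<^sub>R exp (fst q *\<^sub>R \<alpha>)) * (indicator {0<..} (snd q) *\<^sub>R exp (snd q *\<^sub>R \<beta>)))" for q
  \<comment> \<open>A majorant independent of \<tau>: after rescaling, the modulus of the
    exponential is exp (s Re \<alpha> + t Re \<beta>) for every \<tau> > 0.\<close>
  define b where "b q = M * ((indicator {0<..} (fst q) * exp (fst q * Re \<alpha>)) * (indicator {0<..} (snd q) * exp (snd q * Re \<beta>)))" for q
  define K where "K = of_real \<bar>det2 A B\<bar> * (c * ((- 1 / \<alpha>) * (- 1 / \<beta>)))"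
  have K0: "K \<noteq> 0" using c d nz by (simp add: K_def)
  have em [measurable]: "exp_solution k \<omega> \<tau> \<in> borel_measurable borel" for \<tau>
    using C_k_imp_continuous[OF C_infD[OF exp_solution_smooth, of 0]] by (rule borel_measurable_continuous_onI)
  have Pm [measurable]: "(\<lambda>q. (fst q / \<tau>) *\<^sub>R A + (snd q / \<tau>) *\<^sub>R B) \<in> borel_measurable borel"
    "(\<lambda>q. P q \<tau>) \<in> borel_measurable borel" for \<tau>
    unfolding P_def divide_inverse by (intro borel_measurable_continuous_onI continuous_intros)+
  have hm: "h \<tau> \<in> borel_measurable lborel" for \<tau> unfolding h_def[abs_def] by measurable
  have lm: "l \<in> borel_measurable lborel"
    unfolding l_def[abs_def]
    by (intro borel_measurable_times borel_measurable_const borel_measurable_integrable integrable_lborel_prod(1) exp_halfline(1) Re)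
  have bi: "integrable lborel b"
    unfolding b_def[abs_def] by (intro integrable_mult_right integrable_lborel_prod(1) exp_halfline(3) Re)
  have li: "(LINT q|lborel. l q) = c * ((- 1 / \<alpha>) * (- 1 / \<beta>))"
    unfolding l_def integral_mult_right_zero integrable_lborel_prod(2)[OF exp_halfline(1)[OF Re(1)] exp_halfline(1)[OF Re(2)]]
      exp_halfline(2)[OF Re(1)] exp_halfline(2)[OF Re(2)] ..
  \<comment> \<open>The factor \<tau> cancels in the real part exactly; in the imaginary part it
    leaves sqrt (1 + (k/\<tau>)^2), which tends to 1.\<close>
  have expo: "exp_solution k \<omega> \<tau> ((s / \<tau>) *\<^sub>R A + (t / \<tau>) *\<^sub>R B) =
      exp (Complex (s * (A \<bullet> \<omega>) + t * (B \<bullet> \<omega>)) (sqrt (1 + (k / \<tau>)\<^sup>2) * (s * (A \<bullet> perp \<omega>) + t * (B \<bullet> perp \<omega>))))"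
    if "\<tau> > 0" for \<tau> s t
  proof -
    have "sqrt (\<tau>\<^sup>2 + k\<^sup>2) = \<tau> * sqrt (1 + (k / \<tau>)\<^sup>2)"
    proof -
      have "\<tau>\<^sup>2 + k\<^sup>2 = \<tau>\<^sup>2 * (1 + (k / \<tau>)\<^sup>2)" using that by (simp add: field_simps)
      then show ?thesis using that by (simp add: real_sqrt_mult)
    qed
    moreover have "\<tau> * (s / \<tau> * x + t / \<tau> * y) = s * x + t * y" "\<tau> * q * (s / \<tau> * x + t / \<tau> * y) = q * (s * x + t * y)" for q x y
      using that by (simp_all add: field_simps)
    ultimately show ?thesis by (simp only: exp_solution_def inner_add_left inner_scaleR_left)
  qed
  have conv: "((\<lambda>\<tau>. LINT q|lborel. h \<tau> q) \<longlongrightarrow> (LINT q|lborel. l q)) at_top"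
  proof (rule integral_dominated_convergence_at_top[where w=b])
    show "AE q in lborel. ((\<lambda>\<tau>. h \<tau> q) \<longlongrightarrow> l q) at_top"
    proof (rule AE_I2)
      fix q :: "real \<times> real"
      obtain s t where q: "q = (s, t)" by (cases q)
      show "((\<lambda>\<tau>. h \<tau> q) \<longlongrightarrow> l q) at_top"
      proof (cases "s > 0 \<and> t > 0")
        case True
        have e: "((\<lambda>\<tau>. exp_solution k \<omega> \<tau> ((s / \<tau>) *\<^sub>R A + (t / \<tau>) *\<^sub>R B)) \<longlongrightarrow> exp (s *\<^sub>R \<alpha> + t *\<^sub>R \<beta>)) at_top"
        proof -
          have "((\<lambda>\<tau>::real. k / \<tau>) \<longlongrightarrow> 0) at_top" by (rule tendsto_divide_0[OF tendsto_const]) (auto intro: filterlim_mono[OF filterlim_ident at_top_le_at_infinity])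
          then have "((\<lambda>\<tau>. exp (Complex (s * (A \<bullet> \<omega>) + t * (B \<bullet> \<omega>)) (sqrt (1 + (k / \<tau>)\<^sup>2) * (s * (A \<bullet> perp \<omega>) + t * (B \<bullet> perp \<omega>)))))
              \<longlongrightarrow> exp (Complex (s * (A \<bullet> \<omega>) + t * (B \<bullet> \<omega>)) (sqrt (1 + 0\<^sup>2) * (s * (A \<bullet> perp \<omega>) + t * (B \<bullet> perp \<omega>))))) at_top"
            by (intro tendsto_intros)
          moreover have "exp (Complex (s * (A \<bullet> \<omega>) + t * (B \<bullet> \<omega>)) (sqrt (1 + 0\<^sup>2) * (s * (A \<bullet> perp \<omega>) + t * (B \<bullet> perp \<omega>)))) = exp (s *\<^sub>R \<alpha> + t *\<^sub>R \<beta>)"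
            by (rule arg_cong[where f=exp]) (simp add: \<alpha>_def \<beta>_def complex_eq_iff)
          ultimately show ?thesis
            by (subst tendsto_cong[OF eventually_mono[OF eventually_gt_at_top[of 0] expo]]) simp_all
        qed
        have "((\<lambda>\<tau>. h \<tau> q) \<longlongrightarrow> c * exp (s *\<^sub>R \<alpha> + t *\<^sub>R \<beta>)) at_top"
          unfolding h_def P_def q fst_conv snd_conv using True by (intro tendsto_mult lim e) auto
        then show ?thesis using True by (simp add: l_def q exp_add)
      next
        case False
        have "h \<tau> q = 0" if "\<tau> > 0" for \<tau>
          using outside[of "s / \<tau>" "t / \<tau>"] False that by (auto simp: h_def P_def q zero_less_divide_iff)
        moreover have "l q = 0" using False by (auto simp: l_def q)
        ultimately show ?thesis
          by (intro tendsto_eventually eventually_mono[OF eventually_gt_at_top[of 0]]) simp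
      qed
    qed
    show "\<forall>\<^sub>F \<tau> in at_top. AE q in lborel. norm (h \<tau> q) \<le> b q"
      using eventually_gt_at_top[of 0]
    proof eventually_elim
      case (elim \<tau>)
      show ?case
      proof (rule AE_I2)
        fix q :: "real \<times> real"
        obtain s t where q: "q = (s, t)" by (cases q)
        show "norm (h \<tau> q) \<le> b q"
        proof (cases "s > 0 \<and> t > 0")
          case True
          have "norm (h \<tau> q) = cmod (F (P q \<tau>)) * exp (s * (A \<bullet> \<omega>) + t * (B \<bullet> \<omega>))"
            unfolding h_def q fst_conv snd_conv expo[OF elim] by (simp add: norm_mult)
          also have "\<dots> \<le> M * exp (s * (A \<bullet> \<omega>) + t * (B \<bullet> \<omega>))"
            by (intro mult_right_mono bound) auto
          also have "\<dots> = b q" using True by (simp add: b_def q \<alpha>_def \<beta>_def exp_add)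
          finally show ?thesis .
        next
          case False
          then have "h \<tau> q = 0"
            using outside[of "s / \<tau>" "t / \<tau>"] elim by (auto simp: h_def P_def q zero_less_divide_iff)
          moreover have "b q = 0" using False by (auto simp: b_def q)
          ultimately show ?thesis by simp
        qed
      qed
    qed
  qed (use hm lm bi in auto)
  have eq: "of_real (\<tau>\<^sup>2) * (LINT x|lborel. F x * exp_solution k \<omega> \<tau> (x - p)) = of_real \<bar>det2 A B\<bar> * (LINT q|lborel. h \<tau> q)" if \<tau>: "\<tau> > 0" for \<tau>
  proof -
    \<comment> \<open>Scaling both edges by 1/\<tau> multiplies the Jacobian by 1/\<tau>^2, which
      the prefactor cancels.\<close>
    define A' B' where "A' = (1/\<tau>) *\<^sub>R A" "B' = (1/\<tau>) *\<^sub>R B"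
    have det': "A'$1 * B'$2 - A'$2 * B'$1 = det2 A B / \<tau>\<^sup>2"
      using \<tau> by (simp add: A'_B'_def det2_def power2_eq_square field_simps)
    have "(LINT x|lborel. F x * exp_solution k \<omega> \<tau> (x - p)) = (LINT x|distr lborel borel ((+) p). F x * exp_solution k \<omega> \<tau> (x - p))"
      by (simp add: lborel_distr_plus)
    also have "\<dots> = (LINT y|lborel. F (p + y) * exp_solution k \<omega> \<tau> y)"
      by (subst integral_distr) auto
    also have "\<dots> = \<bar>det2 A B / \<tau>\<^sup>2\<bar> *\<^sub>R (LINT q|lborel. F (p + (fst q *\<^sub>R A' + snd q *\<^sub>R B')) * exp_solution k \<omega> \<tau> (fst q *\<^sub>R A' + snd q *\<^sub>R B'))"
      using d \<tau> by (subst integral_plane_coordinates(2)[of A' B']) (auto simp: det')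
    also have "\<dots> = \<bar>det2 A B / \<tau>\<^sup>2\<bar> *\<^sub>R (LINT q|lborel. h \<tau> q)"
      by (simp add: h_def P_def A'_B'_def add.assoc)
    finally show ?thesis using \<tau> by (simp add: scaleR_conv_of_real abs_divide)
  qed
  have "((\<lambda>\<tau>. of_real \<bar>det2 A B\<bar> * (LINT q|lborel. h \<tau> q)) \<longlongrightarrow> K) at_top"
    using tendsto_mult[OF tendsto_const conv, of "of_real \<bar>det2 A B\<bar>"] unfolding li K_def .
  then have "((\<lambda>\<tau>. of_real (\<tau>\<^sup>2) * (LINT x|lborel. F x * exp_solution k \<omega> \<tau> (x - p))) \<longlongrightarrow> K) at_top"
    by (subst tendsto_cong[OF eventually_mono[OF eventually_gt_at_top[of 0] eq]]) simp_all
  then show ?thesis using that K0 by blast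
qed

text \<open>On the closure of D only p reaches the support line: from a point of the open set D one
  can still move in direction \<omega>, and for frontier points regularity applies. Compactness of
  the closure without the ball turns the strict inequality into a gap.\<close>

lemma support_gap:
  assumes bd: "bounded D" and op: "open D" and reg: "regular_direction D \<omega>"
    and p: "p \<in> support_line D \<omega> \<inter> frontier D" and \<delta>: "\<delta> > 0"
  obtains c where "c > 0" "\<And>x. x \<in> D \<Longrightarrow> x \<notin> ball p \<delta> \<Longrightarrow> x \<bullet> \<omega> \<le> support_function D \<omega> - c"
proof -
  have \<omega>: "norm \<omega> = 1" and uniq: "\<And>x. x \<in> support_line D \<omega> \<inter> frontier D \<Longrightarrow> x = p"
    using reg p unfolding regular_direction_def by blast+
  define h where "h = support_function D \<omega>"
  have le_cl: "x \<bullet> \<omega> \<le> h" if "x \<in> closure D" for x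
    unfolding h_def by (rule inner_le_support_function[OF bd that])
  have le: "x \<bullet> \<omega> \<le> h" if "x \<in> D" for x
    using le_cl that closure_subset by blast
  have lt: "x \<bullet> \<omega> < h" if x: "x \<in> closure D" "x \<noteq> p" for x
  proof (cases "x \<in> D")
    case True
    then obtain e where e: "e > 0" "ball x e \<subseteq> D" using op unfolding open_contains_ball by blast
    have "x + (e/2) *\<^sub>R \<omega> \<in> D" using e \<omega> by (intro subsetD[OF e(2)]) (simp add: dist_norm)
    then have "(x + (e/2) *\<^sub>R \<omega>) \<bullet> \<omega> \<le> h" by (rule le)
    then show ?thesis using e \<omega> by (simp add: inner_add_left norm_eq_1)
  next
    case False
    then have "x \<in> frontier D" using x op by (simp add: frontier_def interior_open)
    then have "x \<bullet> \<omega> \<noteq> h" using uniq[of x] x(2) by (auto simp: support_line_def h_def)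
    then show ?thesis using le_cl[OF x(1)] by simp
  qed
  define S where "S = closure D - ball p \<delta>"
  have S: "compact S" using bd by (simp add: S_def compact_diff)
  show thesis
  proof (cases "S = {}")
    case True
    show ?thesis by (rule that[of 1]) (use True closure_subset[of D] in \<open>auto simp: S_def\<close>)
  next
    case False
    have "continuous_on S (\<lambda>x. x \<bullet> \<omega>)" by (intro continuous_intros)
    from continuous_attains_sup[OF S False this]
    obtain y where y: "y \<in> S" "\<And>x. x \<in> S \<Longrightarrow> x \<bullet> \<omega> \<le> y \<bullet> \<omega>" by blast
    have "y \<bullet> \<omega> < h" using y(1) \<delta> by (intro lt) (auto simp: S_def)
    then show ?thesis
      using that[of "h - y \<bullet> \<omega>"] y(2) closure_subset[of D] by (auto simp: S_def h_def)
  qed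
qed

section \<open>From the sector to the whole polygon\<close>

lemma exp_solution_shift: "exp_solution k \<omega> \<tau> x = exp_solution k \<omega> \<tau> p * exp_solution k \<omega> \<tau> (x - p)"
  unfolding exp_solution_def exp_add[symmetric]
  by (rule arg_cong[where f=exp]) (simp add: complex_eq_iff inner_diff_left algebra_simps)

lemma cmod_exp_solution: "cmod (exp_solution k \<omega> \<tau> x) = exp (\<tau> * (x \<bullet> \<omega>))"
  by (simp add: exp_solution_def)

lemma Holder_on_imp_continuous_on:
  assumes "Holder_on S \<alpha> f" "\<alpha> > 0"
  shows "continuous_on S f"
  unfolding continuous_on_def
proof
  fix x assume x: "x \<in> S"
  obtain C where C: "\<And>x y. x \<in> S \<Longrightarrow> y \<in> S \<Longrightarrow> cmod (f x - f y) \<le> C * dist x y powr \<alpha>"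
    using assms(1) unfolding Holder_on_def by blast
  have "((\<lambda>y. f y - f x) \<longlongrightarrow> 0) (at x within S)"
  proof (rule Lim_null_comparison)
    show "\<forall>\<^sub>F y in at x within S. norm (f y - f x) \<le> C * dist y x powr \<alpha>"
      using C x by (auto simp: eventually_at intro!: exI[of _ 1])
    have "((\<lambda>y. dist y x) \<longlongrightarrow> dist x x) (at x within S)" by (intro tendsto_intros)
    then have "((\<lambda>y. dist y x) \<longlongrightarrow> 0) (at x within S)" by simp
    then have "((\<lambda>y. dist y x powr \<alpha>) \<longlongrightarrow> 0 powr \<alpha>) (at x within S)"
      by (intro tendsto_powr') (use assms(2) in auto)
    then show "((\<lambda>y. C * dist y x powr \<alpha>) \<longlongrightarrow> 0) (at x within S)"
      using assms(2) by (auto intro: tendsto_mult_right_zero)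
  qed
  then show "(f \<longlongrightarrow> f x) (at x within S)" using LIM_zero_iff by blast
qed

text \<open>Near p the coefficient may be replaced almost everywhere by its Hoelder representative,
  whose continuity gives the limit \<rho>'(p) u(p) inside the sector. Away from p the support gap
  makes the normalised exponential O(exp (- c \<tau>)), which outweighs the factor \<tau>^2.\<close>

lemma volume_integral_asymptotics:
  assumes poly: "polygon_with_vertices D vs" and bd: "bounded D"
    and rho: "in_Linf D \<rho>" and hol: "\<And>q. q \<in> set vs \<Longrightarrow> Holder_nonzero_at D \<rho> q"
    and u: "continuous_on (closure D) u" and reg: "regular_direction D \<omega>"
    and p: "p \<in> support_line D \<omega> \<inter> frontier D" and up: "u p \<noteq> 0"
  obtains K where "K \<noteq> 0"
    "((\<lambda>\<tau>. of_real (\<tau>\<^sup>2) * ((LINT x|lebesgue_on D. \<rho> x * u x * exp_solution k \<omega> \<tau> x) / exp_solution k \<omega> \<tau> p)) \<longlongrightarrow> K) at_top"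
proof -
  have op: "open D" by (rule open_polygon[OF poly])
  obtain A B \<delta>0 where \<delta>0: "\<delta>0 > 0" "det2 A B \<noteq> 0" "p \<in> set vs" "A \<bullet> \<omega> < 0" "B \<bullet> \<omega> < 0"
    and sector: "\<And>x. x \<in> D \<inter> ball p \<delta>0 \<longleftrightarrow> x \<in> ball p \<delta>0 \<and> (\<exists>s>0. \<exists>t>0. x = p + s *\<^sub>R A + t *\<^sub>R B)"
    by (rule polygon_local_sector[OF poly bd reg p]) (rule that)
  obtain \<eta> \<alpha> \<rho>' where \<eta>: "\<eta> > 0" "\<alpha> > 0" and hr: "Holder_on (cball p \<eta>) \<alpha> \<rho>'"
    and ae: "AE x in lebesgue_on (ball p \<eta> \<inter> closure D). \<rho> x = \<rho>' x" and \<rho>'p: "\<rho>' p \<noteq> 0"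
    using hol[OF \<delta>0(3)] unfolding Holder_nonzero_at_def by blast
  have c\<rho>': "continuous_on (cball p \<eta>) \<rho>'" by (rule Holder_on_imp_continuous_on[OF hr \<eta>(2)])
  define \<delta> where "\<delta> = min \<delta>0 \<eta>"
  have \<delta>: "\<delta> > 0" "ball p \<delta> \<subseteq> ball p \<delta>0" "ball p \<delta> \<subseteq> ball p \<eta>" using \<delta>0 \<eta> by (auto simp: \<delta>_def)
  define E where "E = D \<inter> ball p \<delta>"
  have E: "open E" "E \<subseteq> D" "bounded E" using op bd by (auto simp: E_def bounded_Int)
  define G where "G x = \<rho>' x * u x" for x
  have cG: "continuous_on (closure D \<inter> cball p \<eta>) G"
    unfolding G_def by (intro continuous_on_mult continuous_on_subset[OF c\<rho>'] continuous_on_subset[OF u]) auto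
  have Esub: "E \<subseteq> closure D \<inter> cball p \<eta>" using \<delta>(3) closure_subset[of D] by (auto simp: E_def)
  \<comment> \<open>Built from \<rho>' and not from \<rho>: continuous on the open set E, hence
    Borel and with a limit at p, which an element of L-infinity does not provide.\<close>
  define F where "F x = indicator E x *\<^sub>R G x" for x
  have Fm: "F \<in> borel_measurable borel"
    unfolding F_def[abs_def]
    by (rule borel_measurable_continuous_on_indicator) (use E continuous_on_subset[OF cG Esub] in auto)
  have "compact (closure D \<inter> cball p \<eta>)" using bd by (simp add: compact_Int_closed)
  then have "bounded (G ` (closure D \<inter> cball p \<eta>))" by (intro compact_imp_bounded compact_continuous_image cG)
  then obtain M where M: "\<And>x. x \<in> closure D \<inter> cball p \<eta> \<Longrightarrow> cmod (G x) \<le> M" unfolding bounded_iff by blast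
  have FM: "cmod (F x) \<le> \<bar>M\<bar>" for x
  proof (cases "x \<in> E")
    case True
    then have "cmod (G x) \<le> M" using Esub by (intro M) blast
    then show ?thesis using True by (simp add: F_def)
  qed (simp add: F_def)
  obtain a b where ab: "a \<bullet> A = 1" "a \<bullet> B = 0" "b \<bullet> A = 0" "b \<bullet> B = 1"
    by (rule det2_coordinates[OF \<delta>0(2)]) (rule that)
  have E_iff: "x \<in> E \<longleftrightarrow> x \<in> ball p \<delta> \<and> (\<exists>s>0. \<exists>t>0. x = p + s *\<^sub>R A + t *\<^sub>R B)" for x
    using sector[of x] \<delta>(2) by (auto simp: E_def)
  have outside: "F (p + s *\<^sub>R A + t *\<^sub>R B) = 0" if "\<not> (s > 0 \<and> t > 0)" for s t
  proof -
    have "p + s *\<^sub>R A + t *\<^sub>R B \<notin> E"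
    proof
      assume "p + s *\<^sub>R A + t *\<^sub>R B \<in> E"
      then obtain s' t' where st: "s' > 0" "t' > 0" "p + s *\<^sub>R A + t *\<^sub>R B = p + s' *\<^sub>R A + t' *\<^sub>R B"
        using E_iff by blast
      then have "a \<bullet> (s *\<^sub>R A + t *\<^sub>R B) = a \<bullet> (s' *\<^sub>R A + t' *\<^sub>R B)" "b \<bullet> (s *\<^sub>R A + t *\<^sub>R B) = b \<bullet> (s' *\<^sub>R A + t' *\<^sub>R B)"
        by (simp_all add: add.assoc)
      then show False using st that by (simp add: inner_add_right ab)
    qed
    then show ?thesis by (simp add: F_def)
  qed
  have pcl: "p \<in> closure D \<inter> cball p \<eta>" using p \<eta> by (simp add: frontier_def)
  have lim: "((\<lambda>\<tau>. F (p + (s / \<tau>) *\<^sub>R A + (t / \<tau>) *\<^sub>R B)) \<longlongrightarrow> G p) at_top" if st: "s > 0" "t > 0" for s t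
  proof -
    have z: "((\<lambda>\<tau>::real. r / \<tau>) \<longlongrightarrow> 0) at_top" for r
      by (rule tendsto_divide_0[OF tendsto_const]) (auto intro: filterlim_mono[OF filterlim_ident at_top_le_at_infinity])
    have x: "((\<lambda>\<tau>. p + (s / \<tau>) *\<^sub>R A + (t / \<tau>) *\<^sub>R B) \<longlongrightarrow> p + 0 *\<^sub>R A + 0 *\<^sub>R B) at_top"
      by (intro tendsto_intros z)
    then have x: "((\<lambda>\<tau>. p + (s / \<tau>) *\<^sub>R A + (t / \<tau>) *\<^sub>R B) \<longlongrightarrow> p) at_top" by simp
    have "\<forall>\<^sub>F \<tau> in at_top. p + (s / \<tau>) *\<^sub>R A + (t / \<tau>) *\<^sub>R B \<in> ball p \<delta>"
      using x \<delta>(1) by (intro topological_tendstoD) auto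
    then have inE: "\<forall>\<^sub>F \<tau> in at_top. p + (s / \<tau>) *\<^sub>R A + (t / \<tau>) *\<^sub>R B \<in> E"
      using eventually_gt_at_top[of 0]
    proof eventually_elim
      case (elim \<tau>)
      then show ?case unfolding E_iff using st by (intro conjI exI[of _ "s / \<tau>"] exI[of _ "t / \<tau>"]) auto
    qed
    have "((\<lambda>\<tau>. G (p + (s / \<tau>) *\<^sub>R A + (t / \<tau>) *\<^sub>R B)) \<longlongrightarrow> G p) at_top"
      by (rule continuous_on_tendsto_compose[OF cG x pcl], rule eventually_mono[OF inE]) (use Esub in blast)
    then show ?thesis
      by (rule Lim_transform_eventually) (use inE in \<open>auto elim!: eventually_mono simp: F_def\<close>)
  qed
  have Gp: "G p \<noteq> 0" using \<rho>'p up by (simp add: G_def)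
  obtain K where K: "K \<noteq> 0"
    "((\<lambda>\<tau>. of_real (\<tau>\<^sup>2) * (LINT x|lborel. F x * exp_solution k \<omega> \<tau> (x - p))) \<longlongrightarrow> K) at_top"
    by (rule sector_asymptotics[OF Fm FM \<delta>0(2,4,5) outside lim Gp]) (assumption | rule that)+
  obtain c where c: "c > 0" "\<And>x. x \<in> D \<Longrightarrow> x \<notin> ball p \<delta> \<Longrightarrow> x \<bullet> \<omega> \<le> support_function D \<omega> - c"
    by (rule support_gap[OF bd op reg p \<delta>(1)]) (rule that)
  have ph: "p \<bullet> \<omega> = support_function D \<omega>" using p by (simp add: support_line_def)
  define w where "w \<tau> x = exp_solution k \<omega> \<tau> (x - p)" for \<tau> x
  have wm [measurable]: "w \<tau> \<in> borel_measurable borel" for \<tau>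
  proof (rule borel_measurable_continuous_onI)
    show "continuous_on UNIV (w \<tau>)"
      unfolding w_def by (rule continuous_on_compose2[OF C_k_imp_continuous[OF C_infD[OF exp_solution_smooth, of 0], of UNIV]]) (auto intro!: continuous_intros)
  qed
  have w_le: "cmod (w \<tau> x) \<le> 1" if "x \<in> D" "\<tau> > 0" for \<tau> x
  proof -
    have "x \<bullet> \<omega> \<le> p \<bullet> \<omega>"
      unfolding ph using that(1) closure_subset by (intro inner_le_support_function[OF bd]) blast
    then show ?thesis using that by (simp add: w_def cmod_exp_solution inner_diff_left mult_le_0_iff)
  qed
  have w_small: "cmod (w \<tau> x) \<le> exp (- c * \<tau>)" if "x \<in> D" "x \<notin> E" "\<tau> > 0" for \<tau> x
  proof -
    have "x \<bullet> \<omega> - p \<bullet> \<omega> \<le> - c" using c(2)[of x] that by (simp add: E_def ph)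
    then have "\<tau> * (x \<bullet> \<omega> - p \<bullet> \<omega>) \<le> \<tau> * (- c)" using that by (intro mult_left_mono) auto
    then show ?thesis by (simp add: w_def cmod_exp_solution inner_diff_left mult.commute)
  qed
  have ru: "integrable (lebesgue_on D) (\<lambda>x. \<rho> x * u x)" by (rule integrable_coefficient_mult[OF op bd rho u])
  have wmD: "w \<tau> \<in> borel_measurable (lebesgue_on D)" for \<tau>
    by (intro measurable_restrict_space1 measurable_completion) simp
  have iw: "integrable (lebesgue_on D) (\<lambda>x. \<rho> x * u x * w \<tau> x)" if \<tau>: "\<tau> > 0" for \<tau>
  proof (rule Bochner_Integration.integrable_bound[OF integrable_norm[OF ru]])
    show "AE x in lebesgue_on D. norm (\<rho> x * u x * w \<tau> x) \<le> norm (norm (\<rho> x * u x))"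
    proof (rule AE_I2)
      fix x assume "x \<in> space (lebesgue_on D)"
      then have "cmod (w \<tau> x) \<le> 1" using w_le \<tau> by simp
      then have "cmod (\<rho> x * u x) * cmod (w \<tau> x) \<le> cmod (\<rho> x * u x) * 1" by (intro mult_left_mono) auto
      then show "norm (\<rho> x * u x * w \<tau> x) \<le> norm (norm (\<rho> x * u x))" by (simp add: norm_mult)
    qed
  qed (use borel_measurable_times[OF borel_measurable_integrable[OF ru] wmD] in simp)
  define I0 where "I0 = (LINT x|lebesgue_on D. cmod (\<rho> x * u x))"
  define J where "J \<tau> = (LINT x|lebesgue_on D. \<rho> x * u x * w \<tau> x)" for \<tau>
  \<comment> \<open>On E the integrands agree almost everywhere; the error is the integral over D
    outside E, where \<open>w_small\<close> applies.\<close>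
  have split: "cmod (J \<tau> - (LINT x|lborel. F x * w \<tau> x)) \<le> exp (- c * \<tau>) * I0" if \<tau>: "\<tau> > 0" for \<tau>
  proof -
    have El: "E \<in> sets lebesgue" using E(1) by simp
    have inD: "integrable (lebesgue_on D) (\<lambda>x. indicator E x * (\<rho> x * u x * w \<tau> x))"
    proof -
      have "E \<in> sets (lebesgue_on D)" using El E(2) op by (subst sets_restrict_space_iff) auto
      then have "integrable (lebesgue_on D) (\<lambda>x. indicator E x *\<^sub>R (\<rho> x * u x * w \<tau> x))"
        by (rule integrable_mult_indicator[OF _ iw[OF \<tau>]])
      also have "(\<lambda>x. indicator E x *\<^sub>R (\<rho> x * u x * w \<tau> x)) = (\<lambda>x. indicator E x * (\<rho> x * u x * w \<tau> x))"
        by (auto simp: indicator_def fun_eq_iff)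
      finally show ?thesis .
    qed
    have "(LINT x|lebesgue_on D. indicator E x * (\<rho> x * u x * w \<tau> x)) = (LINT x|lebesgue_on E. \<rho> x * u x * w \<tau> x)"
      by (rule lebesgue_on_indicator(2)[OF E(1) op E(2)])
    also have "\<dots> = (LINT x|lebesgue_on E. F x * w \<tau> x)"
    proof (rule integral_cong_AE)
      have "integrable (lebesgue_on E) (\<lambda>x. \<rho> x * u x * w \<tau> x)"
        using inD by (simp add: lebesgue_on_indicator(1)[OF E(1) op E(2)])
      then show "(\<lambda>x. \<rho> x * u x * w \<tau> x) \<in> borel_measurable (lebesgue_on E)" by (rule borel_measurable_integrable)
      show "(\<lambda>x. F x * w \<tau> x) \<in> borel_measurable (lebesgue_on E)"
        using Fm by (intro measurable_restrict_space1 measurable_completion) simp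
      have "AE x in lebesgue. x \<in> ball p \<eta> \<inter> closure D \<longrightarrow> \<rho> x = \<rho>' x"
        using ae by (subst (asm) AE_restrict_space_iff) auto
      then have "AE x in lebesgue. x \<in> E \<longrightarrow> \<rho> x * u x * w \<tau> x = F x * w \<tau> x"
      proof eventually_elim
        case (elim x)
        then show ?case using \<delta>(3) closure_subset[of D] by (auto simp: F_def G_def E_def)
      qed
      then show "AE x in lebesgue_on E. \<rho> x * u x * w \<tau> x = F x * w \<tau> x"
        using El by (subst AE_restrict_space_iff) auto
    qed
    also have "\<dots> = (LINT x|lborel. indicator E x *\<^sub>R (F x * w \<tau> x))"
      by (rule integral_lebesgue_on_open(2)[OF E(1)]) (use Fm in measurable)
    also have "\<dots> = (LINT x|lborel. F x * w \<tau> x)"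
      by (intro Bochner_Integration.integral_cong refl) (simp add: F_def indicator_def)
    finally have "J \<tau> - (LINT x|lborel. F x * w \<tau> x) = (LINT x|lebesgue_on D. \<rho> x * u x * w \<tau> x - indicator E x * (\<rho> x * u x * w \<tau> x))"
      using iw[OF \<tau>] inD by (simp add: J_def)
    also have "cmod \<dots> \<le> (LINT x|lebesgue_on D. exp (- c * \<tau>) * cmod (\<rho> x * u x))"
    proof (rule Bochner_Integration.integral_norm_bound_integral)
      fix x assume "x \<in> space (lebesgue_on D)"
      then have x: "x \<in> D" by simp
      show "norm (\<rho> x * u x * w \<tau> x - indicator E x * (\<rho> x * u x * w \<tau> x)) \<le> exp (- c * \<tau>) * cmod (\<rho> x * u x)"
      proof (cases "x \<in> E")
        case False
        then have "cmod (\<rho> x * u x) * cmod (w \<tau> x) \<le> cmod (\<rho> x * u x) * exp (- c * \<tau>)"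
          using w_small x \<tau> by (intro mult_left_mono) auto
        then show ?thesis using False by (simp add: norm_mult mult.commute mult.left_commute)
      qed simp
    qed (use iw[OF \<tau>] inD ru in auto)
    finally show ?thesis by (simp add: I0_def)
  qed
  have "((\<lambda>\<tau>. of_real (\<tau>\<^sup>2) * (J \<tau> - (LINT x|lborel. F x * w \<tau> x))) \<longlongrightarrow> 0) at_top"
  proof (rule Lim_null_comparison)
    show "\<forall>\<^sub>F \<tau> in at_top. norm (of_real (\<tau>\<^sup>2) * (J \<tau> - (LINT x|lborel. F x * w \<tau> x))) \<le> \<tau>\<^sup>2 * exp (- c * \<tau>) * I0"
      using eventually_gt_at_top[of 0]
    proof eventually_elim
      case (elim \<tau>)
      then show ?case using mult_left_mono[OF split[OF elim], of "\<tau>\<^sup>2"] by (simp add: norm_mult norm_power mult.assoc)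
    qed
    have "((\<lambda>\<tau>. \<tau>\<^sup>2 * exp (- c * \<tau>)) \<longlongrightarrow> 0) at_top" using c(1) by real_asymp
    then show "((\<lambda>\<tau>. \<tau>\<^sup>2 * exp (- c * \<tau>) * I0) \<longlongrightarrow> 0) at_top" by (rule tendsto_mult_left_zero)
  qed
  from tendsto_add[OF this K(2)[folded w_def]]
  have "((\<lambda>\<tau>. of_real (\<tau>\<^sup>2) * J \<tau>) \<longlongrightarrow> K) at_top"
    by (simp only: distrib_left[symmetric] diff_add_cancel add_0)
  moreover have "J \<tau> = (LINT x|lebesgue_on D. \<rho> x * u x * exp_solution k \<omega> \<tau> x) / exp_solution k \<omega> \<tau> p" for \<tau>
  proof -
    have "(LINT x|lebesgue_on D. \<rho> x * u x * exp_solution k \<omega> \<tau> x) = (LINT x|lebesgue_on D. exp_solution k \<omega> \<tau> p * (\<rho> x * u x * w \<tau> x))"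
    proof (rule Bochner_Integration.integral_cong[OF refl])
      fix x
      show "\<rho> x * u x * exp_solution k \<omega> \<tau> x = exp_solution k \<omega> \<tau> p * (\<rho> x * u x * w \<tau> x)"
        unfolding w_def by (subst exp_solution_shift[of k \<omega> \<tau> x p]) (simp only: mult_ac)
    qed
    moreover have "exp_solution k \<omega> \<tau> p \<noteq> 0" by (simp add: exp_solution_def)
    ultimately show ?thesis by (simp add: J_def)
  qed
  ultimately show ?thesis using that K(1) by simp
qed

section \<open>Recovering the support function from the indicator\<close>

theorem theorem4p1:
  fixes \<Omega> D :: "(real^2) set" and vs :: "(real^2) list" and \<nu> :: "real^2 \<Rightarrow> real^2"
    and k :: real and \<rho> u f g :: "real^2 \<Rightarrow> complex" and \<omega> p :: "real^2"
  assumes Omega: "C2_domain \<Omega>"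
    and nu: "\<And>x. x \<in> frontier \<Omega> \<Longrightarrow> outward_unit_normal \<Omega> x (\<nu> x)"
    and k: "k > 0"
    and D: "polygon_with_vertices D vs" "closure D \<subseteq> \<Omega>"
    and rho: "in_Linf D \<rho>" "\<And>q. q \<in> set vs \<Longrightarrow> Holder_nonzero_at D \<rho> q"
    and u: "strong_solution \<Omega> k (\<lambda>x. 1 + indicator D x * \<rho> x) u"
      "continuous_on (closure \<Omega>) u"
    and cauchy_data: "boundary_trace \<Omega> u f" "normal_derivative \<Omega> \<nu> u g"
    and omega: "regular_direction D \<omega>"
    and p: "p \<in> support_line D \<omega> \<inter> frontier D"
    and up: "u p \<noteq> 0"
  shows "(\<forall>\<^sub>F \<tau> in at_top. enclosure_indicator \<Omega> \<nu> k \<omega> f g \<tau> \<noteq> 0) \<and>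
    ((\<lambda>\<tau>. ln (cmod (enclosure_indicator \<Omega> \<nu> k \<omega> f g \<tau>)) / \<tau>) \<longlongrightarrow> support_function D \<omega>) at_top"
proof -
  have op: "open D" by (rule open_polygon[OF D(1)])
  have bd: "bounded D"
    using Omega D(2) closure_subset[of D] unfolding C2_domain_def by (meson bounded_subset subset_trans)
  have uD: "continuous_on (closure D) u"
    using u(2) D(2) closure_subset[of \<Omega>] by (auto intro: continuous_on_subset)
  have \<omega>: "norm \<omega> = 1" using omega by (simp add: regular_direction_def)
  define I where "I = enclosure_indicator \<Omega> \<nu> k \<omega> f g"
  define h where "h = support_function D \<omega>"
  have ph: "p \<bullet> \<omega> = h" using p by (simp add: support_line_def h_def)
  have I: "I \<tau> = - of_real (k\<^sup>2) * (LINT x|lebesgue_on D. \<rho> x * u x * exp_solution k \<omega> \<tau> x)" for \<tau>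
    unfolding I_def by (rule enclosure_indicator_eq[OF Omega nu op D(2) rho(1) u cauchy_data \<omega>])
  obtain K where K: "K \<noteq> 0"
    "((\<lambda>\<tau>. of_real (\<tau>\<^sup>2) * ((LINT x|lebesgue_on D. \<rho> x * u x * exp_solution k \<omega> \<tau> x) / exp_solution k \<omega> \<tau> p)) \<longlongrightarrow> K) at_top"
    by (rule volume_integral_asymptotics[OF D(1) bd rho uD omega p up]) (assumption | rule that)+
  \<comment> \<open>The modulus of the indicator with exp (\<tau> h) / \<tau>^2 divided out. Its
    limit r is positive, so ln R stays bounded and the indicator is eventually nonzero.\<close>
  define R where "R \<tau> = cmod (of_real (k\<^sup>2) * (of_real (\<tau>\<^sup>2) * ((LINT x|lebesgue_on D. \<rho> x * u x * exp_solution k \<omega> \<tau> x) / exp_solution k \<omega> \<tau> p)))" for \<tau>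
  define r where "r = cmod (of_real (k\<^sup>2) * K)"
  have r: "r > 0" using K(1) k by (simp add: r_def)
  have R: "(R \<longlongrightarrow> r) at_top" unfolding R_def r_def by (intro tendsto_norm tendsto_mult tendsto_const K(2))
  have R_pos: "\<forall>\<^sub>F \<tau> in at_top. R \<tau> > 0" using R r by (rule order_tendstoD(1))
  have IR: "cmod (I \<tau>) = R \<tau> * exp (\<tau> * h) / \<tau>\<^sup>2" if "\<tau> > 0" for \<tau>
    using that by (simp add: I R_def norm_mult norm_divide cmod_exp_solution ph norm_power)
  have "\<forall>\<^sub>F \<tau> in at_top. I \<tau> \<noteq> 0"
    using R_pos eventually_gt_at_top[of 0]
  proof eventually_elim
    case (elim \<tau>)
    then have "cmod (I \<tau>) > 0" by (simp add: IR)
    then show ?case by auto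
  qed
  moreover have "((\<lambda>\<tau>. ln (cmod (I \<tau>)) / \<tau>) \<longlongrightarrow> h) at_top"
  proof -
    have inv: "((\<lambda>\<tau>::real. 1 / \<tau>) \<longlongrightarrow> 0) at_top" by real_asymp
    have lnt: "((\<lambda>\<tau>::real. 2 * ln \<tau> / \<tau>) \<longlongrightarrow> 0) at_top" by real_asymp
    have "((\<lambda>\<tau>. ln (R \<tau>) * (1 / \<tau>) + h - 2 * ln \<tau> / \<tau>) \<longlongrightarrow> ln r * 0 + h - 0) at_top"
      by (intro tendsto_diff tendsto_add tendsto_mult tendsto_ln R inv lnt tendsto_const) (use r in simp)
    then have "((\<lambda>\<tau>. ln (R \<tau>) * (1 / \<tau>) + h - 2 * ln \<tau> / \<tau>) \<longlongrightarrow> h) at_top" by simp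
    moreover have "\<forall>\<^sub>F \<tau> in at_top. ln (R \<tau>) * (1 / \<tau>) + h - 2 * ln \<tau> / \<tau> = ln (cmod (I \<tau>)) / \<tau>"
      using R_pos eventually_gt_at_top[of 0]
    proof eventually_elim
      case (elim \<tau>)
      then have lnI: "ln (cmod (I \<tau>)) = ln (R \<tau>) + \<tau> * h - 2 * ln \<tau>"
        by (simp add: IR ln_mult ln_div ln_realpow)
      show ?case using elim by (simp add: lnI add_divide_distrib diff_divide_distrib)
    qed
    ultimately show ?thesis by (rule Lim_transform_eventually)
  qed
  ultimately show ?thesis by (simp add: I_def h_def)
qed

end
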